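(* Let $u\ge 0$ be an integer and $k$ a positive even integer. Let $a_1,\dots,a_u\in\{1,2,4,8\}$ and $c_1,\dots,c_k\in\{1,2,3,4,6\}$, and put ${\bf h}=c_1+\cdots+c_k$. Assume ${\bf h}\equiv 0\pmod 8$. Define $$\psi_{l,t}(\tau)=\prod_{i=1}^u\mathcal F(a_i\tau)\prod_{j=1}^k\Psi(c_j\tau),$$ where $\mathcal F(\tau)=\sum_{m,n\in\mathbb Z}q^{m^2+mn+n^2}$, $\Psi(\tau)=\sum_{n\ge0}q^{n(n+1)/2}$, $q=e^{2\pi i\tau}$. Let $L=\mathrm{lcm}\big[3\,\mathrm{lcm}(a_1,\dots,a_u),\,2\,\mathrm{lcm}(c_1,\dots,c_k)\big]$ and $\chi=\left(\frac{(-1)^{k/2}4c_1c_2\cdots c_k}{\cdot}\right)$. Then $q^{{\bf h}/8}\psi_{l,t}(\tau)$ is a modular form in $M_{u+k/2}(\Gamma_0(L),\chi')$, where $\chi'=\chi$ if $u$ is even and $\chi'=\left(\frac{\cdot}{3}\right)\chi$ if $u$ is odd.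
   Context: $\psi_{l,t}$ is the generating function of the number of representations of $n$ by the mixed form $\sum_{i=1}^u a_i(x_{2i-1}^2+x_{2i-1}x_{2i}+x_{2i}^2)+\sum_{i=1}^k c_i\,z_i(z_i+1)/2$ with $x_i\in\mathbb Z$, $z_i\in\mathbb Z_{\ge 0}$. $M_w(\Gamma_0(L),\chi')$ denotes the space of holomorphic modular forms of weight $w$ on $\Gamma_0(L)$ with character $\chi'$; $\left(\frac{m}{\cdot}\right)$ and $\left(\frac{\cdot}{3}\right)$ are Kronecker/Legendre symbols. When $u=0$, $\mathrm{lcm}(a_1,\dots,a_u)$ is taken to be $1$. *)

theory Defs
  imports "HOL-Complex_Analysis.Complex_Analysis" "HOL-Number_Theory.Number_Theory"
begin

definition kronecker_prime :: "int \<Rightarrow> int \<Rightarrow> int" where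
  "kronecker_prime m p =
     (if p = 2
      then (if even m then 0 else if m mod 8 \<in> {1, 7} then 1 else - 1)
      else Legendre m p)"

text \<open>The Kronecker symbol \<open>(m / n)\<close>. For negative \<open>n\<close>, \<open>prime_factors n\<close> consists of the
  positive primes dividing \<open>n\<close>; the sign factor is \<open>(m / -1)\<close>.\<close>

definition kronecker :: "int \<Rightarrow> int \<Rightarrow> int" where
  "kronecker m n =
     (if n = 0 then (if \<bar>m\<bar> = 1 then 1 else 0)
      else (if n < 0 \<and> m < 0 then - 1 else 1) *
           (\<Prod>p\<in>prime_factors n. kronecker_prime m p ^ multiplicity p n))"

definition upper_half_plane :: "complex set" where
  "upper_half_plane = {\<tau>. Im \<tau> > 0}"

definition slash ::
    "int \<Rightarrow> int \<Rightarrow> int \<Rightarrow> int \<Rightarrow> int \<Rightarrow> (complex \<Rightarrow> complex) \<Rightarrow> complex \<Rightarrow> complex" where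
  "slash w a b c d f \<tau> =
     (of_int c * \<tau> + of_int d) powi (- w) *
     f ((of_int a * \<tau> + of_int b) / (of_int c * \<tau> + of_int d))"

text \<open>\<open>f\<close> is a holomorphic function of \<open>exp (2 \<pi> i \<tau> / N)\<close> on the whole unit disc, centre
  included; equivalently it has a Fourier expansion in nonnegative powers of that parameter.\<close>

definition holomorphic_at_infinity :: "(complex \<Rightarrow> complex) \<Rightarrow> bool" where
  "holomorphic_at_infinity f \<longleftrightarrow>
     (\<exists>N::nat. N > 0 \<and> (\<exists>g. g holomorphic_on ball 0 1 \<and>
        (\<forall>\<tau>\<in>upper_half_plane. f \<tau> = g (exp (2 * of_real pi * \<i> * \<tau> / of_nat N)))))"

text \<open>A character of the unit group modulo \<open>L\<close>, given as a function on the integers. Its values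
  at integers not coprime to \<open>L\<close> are irrelevant.\<close>

definition character_mod :: "nat \<Rightarrow> (int \<Rightarrow> complex) \<Rightarrow> bool" where
  "character_mod L chi \<longleftrightarrow>
     chi 1 = 1 \<and>
     (\<forall>m n. coprime m (int L) \<longrightarrow> [m = n] (mod int L) \<longrightarrow> chi m = chi n) \<and>
     (\<forall>m n. coprime m (int L) \<longrightarrow> coprime n (int L) \<longrightarrow> chi (m * n) = chi m * chi n)"

text \<open>The space \<open>M\<^sub>w(\<Gamma>\<^sub>0(L), chi)\<close>. The values of \<open>f\<close> outside the upper half plane are irrelevant.
  Holomorphy at all cusps is imposed by letting \<open>(a b; c d)\<close> run over \<open>SL\<^sub>2(\<int>)\<close>.\<close>

definition modular_forms :: "int \<Rightarrow> nat \<Rightarrow> (int \<Rightarrow> complex) \<Rightarrow> (complex \<Rightarrow> complex) set" where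
  "modular_forms w L chi = {f.
     character_mod L chi \<and>
     f holomorphic_on upper_half_plane \<and>
     (\<forall>a b c d. a * d - b * c = 1 \<longrightarrow> int L dvd c \<longrightarrow>
        (\<forall>\<tau>\<in>upper_half_plane. slash w a b c d f \<tau> = chi d * f \<tau>)) \<and>
     (\<forall>a b c d. a * d - b * c = 1 \<longrightarrow> holomorphic_at_infinity (slash w a b c d f))}"

definition nome :: "complex \<Rightarrow> complex" where
  "nome \<tau> = exp (2 * of_real pi * \<i> * \<tau>)"

definition F_theta :: "complex \<Rightarrow> complex" where
  "F_theta \<tau> = (\<Sum>\<^sub>\<infinity>(m, n)\<in>(UNIV :: (int \<times> int) set). nome \<tau> powi (m\<^sup>2 + m * n + n\<^sup>2))"

definition Psi_theta :: "complex \<Rightarrow> complex" where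
  "Psi_theta \<tau> = (\<Sum>n. nome \<tau> ^ (n * (n + 1) div 2))"

definition psi :: "nat \<Rightarrow> nat \<Rightarrow> (nat \<Rightarrow> nat) \<Rightarrow> (nat \<Rightarrow> nat) \<Rightarrow> complex \<Rightarrow> complex" where
  "psi u k a c \<tau> =
     (\<Prod>i\<in>{1..u}. F_theta (of_nat (a i) * \<tau>)) * (\<Prod>j\<in>{1..k}. Psi_theta (of_nat (c j) * \<tau>))"

end

theory Submission
  imports Defs "HOL-Probability.Characteristic_Functions"
begin

text \<open>Up to the factor \<open>2\<^sup>-\<^sup>k\<close>, the function in question is a product of the theta series \<open>\<F>(a\<^sub>i\<tau>)\<close> and
  \<open>\<theta>\<^sub>1\<^sub>/\<^sub>2(c\<^sub>j\<tau>)\<close>, where \<open>\<theta>\<^sub>r(\<tau>) = \<Sum>\<^sub>n exp (\<pi>\<i>(n + r)\<^sup>2\<tau>)\<close>, since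
  \<open>q\<^sup>1\<^sup>/\<^sup>8 \<Psi>(\<tau>) = \<theta>\<^sub>1\<^sub>/\<^sub>2(\<tau>) / 2\<close> and
  \<open>\<F>(\<tau>) = \<theta>\<^sub>0(2\<tau>) \<theta>\<^sub>0(6\<tau>) + \<theta>\<^sub>1\<^sub>/\<^sub>2(2\<tau>) \<theta>\<^sub>1\<^sub>/\<^sub>2(6\<tau>)\<close>.

  Poisson summation and analytic continuation express \<open>\<theta>\<^sub>r(- 1 / \<tau>)\<close> by rational theta series in \<open>\<tau>\<close>.
  Hence homogeneous polynomials in the \<open>\<theta>\<^sub>r(\<alpha>\<tau>)\<close> with \<open>r\<close> and \<open>\<alpha> > 0\<close> rational are stable under the
  slash action of \<open>SL\<^sub>2(\<int>)\<close>. As each of them is a power series in some \<open>q\<^sup>1\<^sup>/\<^sup>N\<close>, they are holomorphic at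
  every cusp, and only the transformation law remains.

  Inversion gives \<open>\<F>(- 1 / (3\<tau>)) = - \<i>\<surd>3 \<tau> \<F>(\<tau>)\<close>; as \<open>\<Gamma>\<^sub>0(3)\<close> is generated by \<open>- I\<close> and two
  parabolic matrices, \<open>\<F>\<close> has weight \<open>1\<close> and character \<open>(\<cdot>/3)\<close>. For a matrix \<open>(A B; C D)\<close> with \<open>C\<close>
  even and \<open>D > 0\<close>, two inversions of \<open>\<theta>\<^sub>1\<^sub>/\<^sub>2\<close> give the multiplier
  \<open>exp (\<pi>\<i>BD/4) G(2B, D) \<surd>((C\<tau> + D)/D)\<close> with a quadratic Gauss sum \<open>G\<close>. In the product over \<open>j\<close>
  the exponential factors cancel because \<open>8\<close> divides \<open>\<Sum>\<^sub>j c\<^sub>j\<close>, and as the number of factors is even, of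
  the Gauss sums only \<open>G(b, D) = (b/D) G(1, D)\<close> and \<open>G(1, D)\<^sup>2 = (-1/D) D\<close> are needed.\<close>

section \<open>Uniqueness of Fourier coefficients\<close>

lemma nome_add: "nome (x + y) = nome x * nome y"
  by (simp add: nome_def ring_distribs exp_add)

lemma nome_minus: "nome (- x) = inverse (nome x)"
  by (simp add: nome_def exp_minus)

lemma nome_0 [simp]: "nome 0 = 1"
  by (simp add: nome_def)

lemma nome_of_int [simp]: "nome (of_int n) = 1"
  by (simp add: nome_def exp_eq_1)

lemma nome_eq_1_iff: "nome (of_real x) = 1 \<longleftrightarrow> x \<in> \<int>"
  by (auto simp: nome_def exp_eq_1 Ints_def)

lemma nome_add_of_int [simp]: "nome (x + of_int n) = nome x"
  by (simp add: nome_add)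

lemma nome_half_of_int: "nome (of_int n / 2) = (if even n then 1 else - 1)"
proof (cases "even n")
  case True
  then show ?thesis by (auto elim!: evenE)
next
  case False
  then obtain m where "n = 2 * m + 1" by (elim oddE)
  then have "nome (of_int n / 2) = nome (1 / 2 + of_int m)"
    by (simp add: field_simps)
  also have "\<dots> = nome (1 / 2)"
    by (rule nome_add_of_int)
  also have "\<dots> = - 1"
    by (simp add: nome_def)
  finally show ?thesis using False by simp
qed

lemma nome_of_nat_mult: "nome (of_nat n * x) = nome x ^ n"
  by (simp add: nome_def exp_of_nat_mult[symmetric] mult_ac)

lemma nome_sum: "finite A \<Longrightarrow> nome (\<Sum>i\<in>A. f i) = (\<Prod>i\<in>A. nome (f i))"
  by (induction rule: finite_induct) (simp_all add: nome_add)

lemma norm_nome: "norm (nome z) = exp (- (2 * pi * Im z))"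
  by (simp add: nome_def)

lemma nome_neq_0 [simp]: "nome z \<noteq> 0"
  by (simp add: nome_def)

lemma holomorphic_on_nome [holomorphic_intros]:
  "f holomorphic_on A \<Longrightarrow> (\<lambda>z. nome (f z)) holomorphic_on A"
  unfolding nome_def by (intro holomorphic_intros)

lemma continuous_on_nome [continuous_intros]:
  "continuous_on A f \<Longrightarrow> continuous_on A (\<lambda>z. nome (f z))"
  unfolding nome_def by (intro continuous_intros)

inductive trig_polynomial :: "(real \<Rightarrow> complex) \<Rightarrow> bool" where
  monomial: "trig_polynomial (\<lambda>x. c * nome (of_int k * of_real x))"
| add: "trig_polynomial f \<Longrightarrow> trig_polynomial g \<Longrightarrow> trig_polynomial (\<lambda>x. f x + g x)"

lemma trig_polynomial_const: "trig_polynomial (\<lambda>x. c)"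
  using trig_polynomial.monomial[of c 0] by simp

lemma trig_polynomial_monomial_mult:
  "trig_polynomial f \<Longrightarrow> trig_polynomial (\<lambda>x. c * nome (of_int k * of_real x) * f x)"
proof (induction rule: trig_polynomial.induct)
  case (monomial c' k')
  have "(\<lambda>x. c * nome (of_int k * of_real x) * (c' * nome (of_int k' * of_real x))) =
      (\<lambda>x. (c * c') * nome (of_int (k + k') * of_real x))"
    by (simp add: nome_add ring_distribs mult_ac)
  then show ?case using trig_polynomial.monomial[of "c * c'" "k + k'"] by simp
next
  case (add f g)
  from trig_polynomial.add[OF add.IH] show ?case by (simp add: ring_distribs)
qed

lemma trig_polynomial_mult:
  assumes "trig_polynomial f" "trig_polynomial g"
  shows "trig_polynomial (\<lambda>x. f x * g x)"
  using assms(1)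
proof (induction rule: trig_polynomial.induct)
  case (monomial c k)
  show ?case by (rule trig_polynomial_monomial_mult[OF assms(2)])
next
  case (add f h)
  from trig_polynomial.add[OF add.IH] show ?case by (simp add: ring_distribs)
qed

lemma trig_polynomial_real_linear:
  fixes f :: "complex \<Rightarrow> real"
  assumes "bounded_linear f"
  shows "trig_polynomial (\<lambda>x. of_real (f (nome (of_real x))))"
proof -
  interpret bounded_linear f by fact
  let ?a = "complex_of_real (f 1) / 2" and ?b = "of_real (f \<i>) / (2 * \<i>)"
  have "of_real (f (nome (of_real x))) =
      (?a + ?b) * nome (of_int 1 * of_real x) + (?a - ?b) * nome (of_int (- 1) * of_real x)" for x
  proof -
    define z where "z = cis (2 * pi * x)"
    have nome: "nome (of_int 1 * of_real x) = z" "nome (of_int (- 1) * of_real x) = cnj z"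
        "nome (of_real x) = z"
      by (simp_all add: z_def nome_def cis_conv_exp exp_cnj mult_ac)
    have "f z = f (Re z *\<^sub>R 1 + Im z *\<^sub>R \<i>)"
      by (rule arg_cong[of _ _ f]) (simp add: complex_eq_iff)
    also have "\<dots> = Re z * f 1 + Im z * f \<i>"
      by (simp only: add scaleR) simp
    finally show ?thesis
      unfolding nome by (simp add: complex_eq_iff field_simps)
  qed
  moreover have "trig_polynomial (\<lambda>x. (?a + ?b) * nome (of_int 1 * of_real x) +
      (?a - ?b) * nome (of_int (- 1) * of_real x))"
    by (intro trig_polynomial.intros)
  ultimately show ?thesis by presburger
qed

lemma trig_polynomial_polynomial_function:
  fixes p :: "complex \<Rightarrow> complex"
  assumes "polynomial_function p"
  shows "trig_polynomial (\<lambda>x. p (nome (of_real x)))"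
proof -
  have real: "trig_polynomial (\<lambda>x. of_real (q (nome (of_real x))))"
    if "real_polynomial_function q" for q :: "complex \<Rightarrow> real"
    using that
    by (induction rule: real_polynomial_function.induct)
       (auto intro: trig_polynomial_real_linear trig_polynomial_const trig_polynomial.add
           trig_polynomial_mult)
  have "real_polynomial_function (\<lambda>z. Re (p z))" "real_polynomial_function (\<lambda>z. Im (p z))"
    using assms bounded_linear_Re bounded_linear_Im unfolding polynomial_function_def o_def
    by blast+
  then have "trig_polynomial (\<lambda>x. of_real (Re (p (nome (of_real x)))) +
      \<i> * of_real (Im (p (nome (of_real x)))))"
    by (intro trig_polynomial.add trig_polynomial_mult trig_polynomial_const real)
  then show ?thesis by (simp add: complex_eq[symmetric])
qed

lemma nome_image_unit_interval: "(\<lambda>x. nome (of_real x)) ` {0..1} = sphere 0 1"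
proof (intro equalityI subsetI)
  fix z :: complex assume "z \<in> sphere 0 1"
  then have "exp (\<i> * of_real (Arg2pi z)) = z"
    by (simp add: complex_norm_eq_1_exp)
  then have "z = nome (of_real (Arg2pi z / (2 * pi)))"
    by (simp add: nome_def)
  moreover have "Arg2pi z / (2 * pi) \<in> {0..1}"
    using Arg2pi[of z] by auto
  ultimately show "z \<in> (\<lambda>x. nome (of_real x)) ` {0..1}" by blast
qed (auto simp: norm_nome)

lemma periodic_factors_through_circle:
  fixes f :: "real \<Rightarrow> 'a::topological_space"
  assumes continuous: "continuous_on {0..1} f" and periodic: "f 0 = f 1"
  obtains g where "continuous_on (sphere (0::complex) 1) g"
    "\<And>x. x \<in> {0..1} \<Longrightarrow> g (nome (of_real x)) = f x"
proof
  define g where "g = (\<lambda>z. f (Arg2pi z / (2 * pi)))"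
  show g_nome: "g (nome (of_real x)) = f x" if "x \<in> {0..1}" for x
  proof (cases "x = 1")
    case True
    moreover have "Arg2pi 1 = 0" by (rule Arg2pi_unique[of 1]) auto
    ultimately show ?thesis using nome_of_int[of 1] periodic by (simp add: g_def)
  next
    case False
    then have "Arg2pi (nome (of_real x)) = 2 * pi * x"
      using that by (intro Arg2pi_unique[of 1]) (auto simp: nome_def mult_ac)
    then show ?thesis by (simp add: g_def)
  qed
  have "quotient_map (top_of_set {0..1}) (top_of_set (sphere 0 1)) (\<lambda>x::real. nome (of_real x))"
    by (rule T1_Spaces.continuous_imp_quotient_map)
       (auto simp: nome_image_unit_interval[symmetric] compact_space_subtopology
           Hausdorff_space_subtopology
         intro!: continuous_intros)
  moreover have "continuous_map (top_of_set {0..1}) euclidean (\<lambda>x. g (nome (of_real x)))"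
    using continuous_on_cong[THEN iffD2, OF refl _ continuous, of "\<lambda>x. g (nome (of_real x))"] g_nome
    by simp
  ultimately have "continuous_map (top_of_set (sphere 0 1)) euclidean g"
    using continuous_compose_quotient_map_eq unfolding o_def by metis
  then show "continuous_on (sphere (0::complex) 1) g" by simp
qed

lemma has_integral_mult_trig_polynomial_0:
  fixes f :: "real \<Rightarrow> complex"
  assumes "\<And>k::int. ((\<lambda>x. f x * nome (of_int k * of_real x)) has_integral 0) S"
    and "trig_polynomial p"
  shows "((\<lambda>x. f x * p x) has_integral 0) S"
  using assms(2)
proof (induction rule: trig_polynomial.induct)
  case (monomial c k)
  from has_integral_mult_right[OF assms(1), of c k] show ?case by (simp add: mult_ac)
next
  case (add p q)
  from has_integral_add[OF add.IH] show ?case by (simp add: ring_distribs)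
qed

lemma L2_norm_0_if_fourier_coeffs_0:
  fixes f :: "real \<Rightarrow> complex"
  assumes continuous: "continuous_on {0..1} f" and periodic: "f 0 = f 1"
    and coeffs: "\<And>k::int. ((\<lambda>x. f x * nome (of_int k * of_real x)) has_integral 0) {0..1}"
  shows "integral {0..1} (\<lambda>x. (norm (f x))\<^sup>2) = 0" (is "?I = 0")
proof -
  obtain g where g: "continuous_on (sphere 0 1) g" "\<And>x. x \<in> {0..1} \<Longrightarrow> g (nome (of_real x)) = f x"
    using periodic_factors_through_circle[OF continuous periodic] by blast
  obtain B where "B > 0" and norm_f: "\<And>x. x \<in> {0..1} \<Longrightarrow> norm (f x) \<le> B"
    using compact_imp_bounded[OF compact_continuous_image[OF continuous]]
    by (auto simp: bounded_pos)
  have "(\<lambda>x. (norm (f x))\<^sup>2) integrable_on {0..1}"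
    by (intro integrable_continuous_real continuous_intros continuous)
  from has_integral_linear[OF integrable_integral[OF this] bounded_linear_of_real]
  have norm_integral: "((\<lambda>x. f x * cnj (f x)) has_integral of_real ?I) {0..1}"
    by (simp add: o_def complex_norm_square[symmetric])
  have "\<bar>?I\<bar> \<le> B * e" if "e > 0" for e
  proof -
    obtain p where polynomial: "polynomial_function p"
      and approx: "\<And>z. z \<in> sphere 0 1 \<Longrightarrow> norm (cnj (g z) - p z) < e"
      using Stone_Weierstrass_polynomial_function[OF compact_sphere _ \<open>e > 0\<close>, of 0 1
          "\<lambda>z. cnj (g z)"]
        continuous_on_cnj[OF g(1)] by auto
    from has_integral_mult_trig_polynomial_0[OF coeffs
        trig_polynomial_polynomial_function[OF polynomial]]
    have "((\<lambda>x. f x * cnj (f x) - f x * p (nome (of_real x))) has_integral (of_real ?I - 0)) {0..1}"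
      by (rule has_integral_diff[OF norm_integral])
    then have "((\<lambda>x. f x * cnj (f x) - f x * p (nome (of_real x))) has_integral of_real ?I) {0..1}"
      by simp
    moreover have "norm (f x * cnj (f x) - f x * p (nome (of_real x))) \<le> B * e"
      if "x \<in> {0..1}" for x
    proof -
      have "nome (of_real x) \<in> sphere 0 1" by (simp add: norm_nome)
      from approx[OF this] have "norm (cnj (f x) - p (nome (of_real x))) \<le> e"
        by (simp add: g(2)[OF that])
      then show ?thesis
        unfolding right_diff_distrib[symmetric] norm_mult using \<open>B > 0\<close> norm_f that
        by (intro mult_mono) auto
    qed
    ultimately have "norm (complex_of_real ?I) \<le> B * e * measure lborel {0..1::real}"
      using \<open>B > 0\<close> \<open>e > 0\<close> by (intro has_integral_bound_real) auto
    then show ?thesis by simp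
  qed
  from this[of "\<bar>?I\<bar> / (2 * B)"] \<open>B > 0\<close> show ?thesis
    by (cases "?I = 0") (auto simp: field_simps)
qed

theorem continuous_eq_0_if_fourier_coeffs_0:
  fixes f :: "real \<Rightarrow> complex"
  assumes continuous: "continuous_on {0..1} f" and "f 0 = f 1"
    and "\<And>k::int. ((\<lambda>x. f x * nome (of_int k * of_real x)) has_integral 0) {0..1}"
    and "x \<in> {0..1}"
  shows "f x = 0"
proof -
  have norm_continuous: "continuous_on {0..1} (\<lambda>x. (norm (f x))\<^sup>2)"
    by (intro continuous_intros continuous)
  then have "((\<lambda>x. (norm (f x))\<^sup>2) has_integral 0) (cbox 0 1)"
    using L2_norm_0_if_fourier_coeffs_0[OF assms(1-3)]
    by (metis cbox_interval has_integral_integral integrable_continuous_real)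
  from has_integral_0_cbox_imp_0[OF _ _ this, of x] norm_continuous \<open>x \<in> {0..1}\<close> show ?thesis
    by simp
qed

section \<open>Poisson summation\<close>

lemma continuous_on_infsum:
  fixes f :: "'i \<Rightarrow> 'a::topological_space \<Rightarrow> 'b::banach"
  assumes "\<And>n. continuous_on S (f n)" "\<And>n x. x \<in> S \<Longrightarrow> norm (f n x) \<le> M n" "M summable_on A"
  shows "continuous_on S (\<lambda>x. \<Sum>\<^sub>\<infinity>n\<in>A. f n x)"
  by (rule uniform_limit_theorem[OF _ Weierstrass_m_test_general[OF assms(2,3)]])
     (auto intro!: always_eventually continuous_intros assms(1))

lemma integral_infsum:
  fixes f :: "'i \<Rightarrow> real \<Rightarrow> 'b::banach"
  assumes continuous: "\<And>n. continuous_on {a..b} (f n)"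
    and bound: "\<And>n x. x \<in> {a..b} \<Longrightarrow> norm (f n x) \<le> M n" and M_summable: "M summable_on A"
  shows "((\<lambda>n. integral {a..b} (f n)) has_sum integral {a..b} (\<lambda>x. \<Sum>\<^sub>\<infinity>n\<in>A. f n x)) A"
proof -
  obtain I J where partial_integrals: "\<And>X. ((\<lambda>x. \<Sum>n\<in>X. f n x) has_integral I X) {a..b}"
    and infsum_integral: "((\<lambda>x. \<Sum>\<^sub>\<infinity>n\<in>A. f n x) has_integral J) {a..b}"
    and integrals_tendsto: "(I \<longlongrightarrow> J) (finite_subsets_at_top A)"
    by (rule uniform_limit_integral[OF Weierstrass_m_test_general[OF bound M_summable]])
       (auto intro!: continuous_intros continuous)
  have "I X = (\<Sum>n\<in>X. integral {a..b} (f n))" if "finite X" for X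
    by (rule has_integral_unique[OF partial_integrals])
       (intro has_integral_sum integrable_integral integrable_continuous_real continuous that)
  then have "\<forall>\<^sub>F X in finite_subsets_at_top A. I X = (\<Sum>n\<in>X. integral {a..b} (f n))"
    by (simp add: eventually_finite_subsets_at_top_weakI)
  with integrals_tendsto have "((\<lambda>X. \<Sum>n\<in>X. integral {a..b} (f n)) \<longlongrightarrow> J) (finite_subsets_at_top A)"
    by (rule Lim_transform_eventually)
  then show ?thesis
    using integral_unique[OF infsum_integral] by (simp add: has_sum_def)
qed

lemma integral_nome:
  "integral {0..1} (\<lambda>x. nome (of_int k * of_real x)) = (if k = 0 then 1 else 0)"
proof (cases "k = 0")
  case False
  define c where "c = 2 * of_real pi * \<i> * of_int k"
  have "c \<noteq> 0" using False by (simp add: c_def)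
  have "((\<lambda>x. nome (of_int k * of_real x)) has_integral
      nome (of_int k * of_real 1) / c - nome (of_int k * of_real 0) / c) {0..1}"
  proof (rule fundamental_theorem_of_calculus)
    fix x :: real assume "x \<in> {0..1}"
    show "((\<lambda>x. nome (of_int k * of_real x) / c) has_vector_derivative nome (of_int k * of_real x))
        (at x within {0..1})"
      unfolding nome_def using \<open>c \<noteq> 0\<close>
      by (auto intro!: derivative_eq_intros has_vector_derivative_real_field
          simp: c_def field_simps)
  qed auto
  then show ?thesis using False by (simp add: integral_unique)
qed simp

lemma fourier_coeff_series:
  assumes "(\<lambda>k. norm (a k)) summable_on (UNIV :: int set)"
  shows "integral {0..1} (\<lambda>x. (\<Sum>\<^sub>\<infinity>k. a k * nome (of_int k * of_real x)) *
      nome (- of_int j * of_real x)) = a j"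
proof -
  define f where "f = (\<lambda>k x. a k * nome (of_int (k - j) * of_real x))"
  have "((\<lambda>k. integral {0..1} (f k)) has_sum integral {0..1} (\<lambda>x. \<Sum>\<^sub>\<infinity>k. f k x)) UNIV"
    using assms unfolding f_def
    by (intro integral_infsum[where M = "\<lambda>k. norm (a k)"])
       (auto intro!: continuous_intros simp: norm_mult norm_nome)
  moreover have "((\<lambda>k. integral {0..1} (f k)) has_sum a j) UNIV"
    by (rule has_sum_finite_neutralI[of "{j}"])
       (auto simp: f_def integral_nome simp del: of_int_diff)
  ultimately have "integral {0..1} (\<lambda>x. \<Sum>\<^sub>\<infinity>k. f k x) = a j"
    by (rule has_sum_unique)
  moreover have "f k x = a k * nome (of_int k * of_real x) * nome (- of_int j * of_real x)" for k x
    by (simp add: f_def nome_add[symmetric] algebra_simps)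
  ultimately show ?thesis
    by (simp add: infsum_cmult_left')
qed

lemma integral_sum_unit_intervals:
  fixes f :: "real \<Rightarrow> 'a::banach"
  assumes "continuous_on UNIV f"
  shows "(\<Sum>n\<in>{- int N..<int N}. integral {of_int n..of_int n + 1} f) =
      integral {- real N..real N} f"
proof (induction N)
  case (Suc N)
  have combine: "integral {x..y} f + integral {y..z} f = integral {x..z} f"
    if "x \<le> y" "y \<le> z" for x y z
    using that assms
    by (intro Henstock_Kurzweil_Integration.integral_combine integrable_continuous_real)
       (auto intro: continuous_on_subset)
  have "{- int (Suc N)..<int (Suc N)} = insert (- int (Suc N)) (insert (int N) {- int N..<int N})"
    by auto
  then have "(\<Sum>n\<in>{- int (Suc N)..<int (Suc N)}. integral {of_int n..of_int n + 1} f) =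
      integral {- real (Suc N)..- real N} f + integral {- real N..real N} f +
          integral {real N..real (Suc N)} f"
    using Suc by (simp add: add_ac)
  also have "\<dots> = integral {- real (Suc N)..real (Suc N)} f"
    by (simp add: combine)
  finally show ?case .
qed simp

lemma integral_symmetric_limit:
  fixes f :: "real \<Rightarrow> complex"
  assumes "integrable lborel f"
  shows "(\<lambda>N. integral {- real N..real N} f) \<longlonglongrightarrow> (LINT x|lborel. f x)"
proof -
  have Un_intervals: "(\<Union>N. {- real N..real N}) = UNIV"
  proof (rule UNIV_eq_I[symmetric])
    fix x :: real
    show "x \<in> (\<Union>N. {- real N..real N})"
      by (rule UN_I[of "nat \<lceil>\<bar>x\<bar>\<rceil>"]) (auto, linarith+)
  qed
  have "set_integrable lborel A f" if "A \<in> sets lborel" for A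
    using integrable_mult_indicator[OF that assms] by (simp add: set_integrable_def)
  then have "(LINT x:{- real N..real N}|lborel. f x) = integral {- real N..real N} f" for N
    by (intro set_borel_integral_eq_integral) auto
  moreover have "(\<lambda>N. LINT x:{- real N..real N}|lborel. f x) \<longlonglongrightarrow>
      (LINT x:(\<Union>N. {- real N..real N})|lborel. f x)"
    using assms
    by (intro set_integral_cont_up)
       (auto simp: incseq_def Un_intervals set_integrable_def)
  ultimately show ?thesis
    by (simp add: Un_intervals set_lebesgue_integral_def)
qed

lemma filterlim_symmetric_intervals:
  "filterlim (\<lambda>N. {- int N..<int N}) (finite_subsets_at_top UNIV) sequentially"
  unfolding filterlim_finite_subsets_at_top
proof (intro allI impI)
  fix X :: "int set" assume "finite X \<and> X \<subseteq> UNIV"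
  then obtain B where abs_le_B: "\<And>x. x \<in> X \<Longrightarrow> \<bar>x\<bar> \<le> B"
    by (metis bdd_above.unfold bdd_above_finite finite_imageI imageI)
  have "\<forall>\<^sub>F N in sequentially. nat B < N"
    by (rule eventually_gt_at_top)
  then show "\<forall>\<^sub>F N in sequentially. finite {- int N..<int N} \<and> X \<subseteq> {- int N..<int N} \<and>
      {- int N..<int N} \<subseteq> UNIV"
    by eventually_elim (use abs_le_B in force)
qed

lemma integral_periodization:
  fixes f :: "real \<Rightarrow> complex"
  assumes continuous: "continuous_on UNIV f" and integrable: "integrable lborel f"
    and bound: "\<And>n x. x \<in> {0..1} \<Longrightarrow> norm (f (x + of_int n)) \<le> M n"
    and M_summable: "M summable_on (UNIV :: int set)"
  shows "integral {0..1} (\<lambda>x. \<Sum>\<^sub>\<infinity>n::int. f (x + of_int n)) = (LINT x|lborel. f x)" (is "?I = _")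
proof -
  have "continuous_on {0..1} (\<lambda>x. f (x + of_int n))" for n
    by (rule continuous_on_compose2[OF continuous]) (auto intro!: continuous_intros)
  then have "((\<lambda>n. integral {0..1} (\<lambda>x. f (x + of_int n))) has_sum ?I) UNIV"
    by (rule integral_infsum[OF _ bound M_summable])
  moreover have "integral {0..1} (\<lambda>x. f (x + of_int n)) = integral {of_int n..of_int n + 1} f" for n
    using integral_shift_real_ivl[of "of_int n" "of_int n" "of_int n + 1" f] by simp
  ultimately have "((\<lambda>X. \<Sum>n\<in>X. integral {of_int n..of_int n + 1} f) \<longlongrightarrow> ?I)
      (finite_subsets_at_top UNIV)"
    by (simp add: has_sum_def)
  from filterlim_compose[OF this filterlim_symmetric_intervals]
  have "(\<lambda>N. integral {- real N..real N} f) \<longlonglongrightarrow> ?I"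
    by (simp add: integral_sum_unit_intervals[OF continuous])
  then show ?thesis
    by (rule LIMSEQ_unique[OF _ integral_symmetric_limit[OF integrable]])
qed

definition fourier_transform :: "(real \<Rightarrow> complex) \<Rightarrow> real \<Rightarrow> complex" where
  "fourier_transform f y = (LINT x|lborel. f x * nome (- of_real (y * x)))"

lemma fourier_coeff_periodization:
  fixes f :: "real \<Rightarrow> complex"
  assumes continuous: "continuous_on UNIV f" and integrable: "integrable lborel f"
    and bound: "\<And>n x. x \<in> {0..1} \<Longrightarrow> norm (f (x + of_int n)) \<le> M n"
    and M_summable: "M summable_on (UNIV :: int set)"
  shows "integral {0..1} (\<lambda>x. (\<Sum>\<^sub>\<infinity>n::int. f (x + of_int n)) * nome (- of_int k * of_real x)) =
    fourier_transform f (of_int k)"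
proof -
  define g where "g = (\<lambda>x. f x * nome (- of_real (of_int k * x)))"
  have g_shift: "g (x + of_int n) = f (x + of_int n) * nome (- of_int k * of_real x)"
    for x and n :: int
    using nome_add_of_int[of "- of_int k * of_real x" "- (k * n)"]
    by (simp add: g_def algebra_simps)
  have "integral {0..1} (\<lambda>x. \<Sum>\<^sub>\<infinity>n::int. g (x + of_int n)) = (LINT x|lborel. g x)"
  proof (rule integral_periodization[OF _ _ _ M_summable])
    show "continuous_on UNIV g"
      unfolding g_def by (intro continuous_intros continuous)
    show "integrable lborel g"
      using integrable by (rule Bochner_Integration.integrable_bound)
        (use borel_measurable_integrable[OF integrable] in
          \<open>auto simp: g_def norm_mult norm_nome nome_def\<close>)
    show "norm (g (x + of_int n)) \<le> M n" if "x \<in> {0..1}" for n x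
      unfolding g_shift using bound[OF that] by (simp add: norm_mult norm_nome)
  qed
  then show ?thesis
    by (simp add: g_shift infsum_cmult_left') (simp add: g_def fourier_transform_def)
qed

theorem poisson_summation:
  fixes f :: "real \<Rightarrow> complex"
  assumes continuous: "continuous_on UNIV f" and integrable: "integrable lborel f"
    and bound: "\<And>n x. x \<in> {0..1} \<Longrightarrow> norm (f (x + of_int n)) \<le> M n"
    and M_summable: "M summable_on (UNIV :: int set)"
    and transform: "(\<lambda>k. norm (fourier_transform f (of_int k))) summable_on (UNIV :: int set)"
  shows "(\<Sum>\<^sub>\<infinity>n::int. f (of_int n)) = (\<Sum>\<^sub>\<infinity>k::int. fourier_transform f (of_int k))"
proof -
  define P where "P = (\<lambda>x. \<Sum>\<^sub>\<infinity>n::int. f (x + of_int n))"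
  define Q where "Q = (\<lambda>x. \<Sum>\<^sub>\<infinity>k::int. fourier_transform f (of_int k) * nome (of_int k * of_real x))"
  have "continuous_on {0..1} (\<lambda>x. f (x + of_int n))" for n :: int
    by (rule continuous_on_compose2[OF continuous]) (auto intro!: continuous_intros)
  then have P_continuous: "continuous_on {0..1} P"
    unfolding P_def by (rule continuous_on_infsum[OF _ bound M_summable])
  have Q_continuous: "continuous_on {0..1} Q"
    unfolding Q_def
    by (rule continuous_on_infsum[OF _ _ transform])
       (auto intro!: continuous_intros simp: norm_mult norm_nome)
  have coeffs: "((\<lambda>x. (P x - Q x) * nome (of_int k * of_real x)) has_integral 0) {0..1}" for k
  proof -
    have has_coeff: "((\<lambda>x. g x * nome (of_int k * of_real x)) has_integral
        fourier_transform f (of_int (- k))) {0..1}"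
      if "continuous_on {0..1} g"
        and "integral {0..1} (\<lambda>x. g x * nome (- of_int (- k) * of_real x)) =
            fourier_transform f (of_int (- k))" for g
      using that
      by (auto simp: has_integral_iff intro!: integrable_continuous_real continuous_intros)
    have "integral {0..1} (\<lambda>x. P x * nome (- of_int (- k) * of_real x)) =
        fourier_transform f (of_int (- k))"
      unfolding P_def
      by (rule fourier_coeff_periodization[OF continuous integrable bound M_summable])
    moreover have "integral {0..1} (\<lambda>x. Q x * nome (- of_int (- k) * of_real x)) =
        fourier_transform f (of_int (- k))"
      unfolding Q_def by (rule fourier_coeff_series[OF transform])
    ultimately show ?thesis
      using has_integral_diff[OF has_coeff[OF P_continuous] has_coeff[OF Q_continuous]]
      by (simp add: left_diff_distrib)
  qed
  have "P 0 = P 1"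
    unfolding P_def
    by (rule infsum_reindex_bij_witness[of _ "\<lambda>n. n + 1" "\<lambda>n. n - 1"]) (auto simp: add_ac)
  moreover have "Q 0 = Q 1" by (simp add: Q_def)
  ultimately have "P 0 - Q 0 = 0"
    by (intro continuous_eq_0_if_fourier_coeffs_0[of "\<lambda>x. P x - Q x"] coeffs continuous_intros
        P_continuous Q_continuous) auto
  then show ?thesis by (simp add: P_def Q_def)
qed

lemma std_normal_density_affine:
  assumes "t > 0"
  defines "s \<equiv> sqrt (2 * pi * t)"
  shows "complex_of_real (std_normal_density (s * r + s * x)) =
    of_real (1 / sqrt (2 * pi)) * of_real (exp (- (pi * t * (x + r)\<^sup>2)))"
proof -
  have "s\<^sup>2 = 2 * pi * t" using assms by simp
  then have "(s * r + s * x)\<^sup>2 / 2 = pi * t * (x + r)\<^sup>2"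
    by (simp add: distrib_left[symmetric] power_mult_distrib add.commute)
  then show ?thesis by (simp add: std_normal_density_def)
qed

lemma integrable_gaussian:
  assumes "t > 0"
  shows "integrable lborel (\<lambda>x. complex_of_real (exp (- (pi * t * (x + r)\<^sup>2))))"
proof -
  define s where "s = sqrt (2 * pi * t)"
  have "s \<noteq> 0" using assms by (simp add: s_def)
  then have "integrable lborel (\<lambda>x. complex_of_real (std_normal_density (s * r + s * x)))"
    by (intro lborel_integrable_real_affine) simp_all
  then have "integrable lborel (\<lambda>x. of_real (sqrt (2 * pi)) *
      (of_real (1 / sqrt (2 * pi)) * complex_of_real (exp (- (pi * t * (x + r)\<^sup>2)))))"
    unfolding s_def std_normal_density_affine[OF assms] by (rule integrable_mult_right)
  then show ?thesis by simp
qed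

theorem fourier_transform_gaussian:
  fixes t r y :: real
  assumes "t > 0"
  defines "f \<equiv> (\<lambda>x. complex_of_real (exp (- (pi * t * (x + r)\<^sup>2))))"
  shows "fourier_transform f y = nome (of_real (y * r)) * of_real (exp (- (pi * y\<^sup>2 / t)) / sqrt t)"
proof -
  define s where "s = sqrt (2 * pi * t)"
  have scale: "s > 0" "s\<^sup>2 = 2 * pi * t" using assms by (simp_all add: s_def)
  define v where "v = - (2 * pi * y / s)"
  have integrand: "complex_of_real (std_normal_density (s * r + s * x)) *
      iexp (v * (s * r + s * x)) =
      (of_real (1 / sqrt (2 * pi)) * nome (- of_real (y * r))) * (f x * nome (- of_real (y * x)))"
    for x
  proof -
    have "v * (s * r + s * x) = 2 * pi * (- (y * r) + - (y * x))"
      using scale(1) by (simp add: v_def field_simps)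
    then have "iexp (v * (s * r + s * x)) = nome (- of_real (y * r)) * nome (- of_real (y * x))"
      by (simp only: nome_add[symmetric]) (simp add: nome_def algebra_simps)
    then show ?thesis
      unfolding s_def std_normal_density_affine[OF assms(1)] f_def by (simp only: mult_ac)
  qed
  have "v\<^sup>2 / 2 = pi * y\<^sup>2 / t"
    by (simp add: v_def power_divide power_mult_distrib scale(2)) (simp add: power2_eq_square)
  then have "of_real (exp (- (pi * y\<^sup>2 / t))) = char std_normal_distribution v"
    by (simp add: char_std_normal_distribution)
  also have "\<dots> = (LINT x|lborel. complex_of_real (std_normal_density x) * iexp (v * x))"
    unfolding char_def by (subst integral_density) (auto simp: scaleR_conv_of_real)
  also have "\<dots> = s *\<^sub>R (LINT x|lborel. complex_of_real (std_normal_density (s * r + s * x)) *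
      iexp (v * (s * r + s * x)))"
    using scale(1) by (subst lborel_integral_real_affine[of s _ "s * r"]) auto
  also have "\<dots> = of_real (s / sqrt (2 * pi)) * nome (- of_real (y * r)) * fourier_transform f y"
    unfolding integrand
    by (simp only: integral_mult_right_zero fourier_transform_def scaleR_conv_of_real) simp
  also have "s / sqrt (2 * pi) = sqrt t"
    by (simp add: s_def real_sqrt_mult)
  finally have "of_real (exp (- (pi * y\<^sup>2 / t))) =
      of_real (sqrt t) * inverse (nome (of_real (y * r))) * fourier_transform f y"
    by (simp only: nome_minus)
  moreover have "F = N * (E / S)" if "E = S * inverse N * F" "S \<noteq> 0" "N \<noteq> 0" for E F N S :: complex
    using that by simp
  ultimately show ?thesis
    using assms(1) by (simp only: of_real_divide) simp
qed

section \<open>Theta series and their inversion\<close>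

definition twisted_theta :: "(int \<Rightarrow> complex) \<Rightarrow> real \<Rightarrow> complex \<Rightarrow> complex" where
  "twisted_theta c r \<tau> = (\<Sum>\<^sub>\<infinity>n. c n * nome ((of_int n + of_real r)\<^sup>2 / 2 * \<tau>))"

abbreviation theta :: "real \<Rightarrow> complex \<Rightarrow> complex" where
  "theta \<equiv> twisted_theta (\<lambda>_. 1)"

lemma summable_on_power_nat_abs:
  fixes q :: real
  assumes "0 \<le> q" "q < 1"
  shows "(\<lambda>n::int. q ^ nat \<bar>n\<bar>) summable_on UNIV"
proof -
  have geometric: "(\<lambda>n. q ^ n) summable_on (UNIV :: nat set)"
    using assms by (intro norm_summable_imp_summable_on) (simp add: summable_geometric)
  have "(\<lambda>n::int. q ^ nat \<bar>n\<bar>) summable_on range int"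
    using geometric by (subst summable_on_reindex) (auto simp: o_def)
  moreover have "(\<lambda>n::int. q ^ nat \<bar>n\<bar>) summable_on range (\<lambda>n. - int n)"
    using geometric by (subst summable_on_reindex) (auto simp: o_def inj_on_def)
  moreover have "range int \<union> range (\<lambda>n. - int n) = UNIV"
    by (auto simp: image_iff) (metis int_cases2)
  ultimately show ?thesis
    using summable_on_union by metis
qed

lemma exp_neg_square_le:
  fixes t R r :: real and n :: int
  assumes "t > 0" "\<bar>r\<bar> \<le> R"
  shows "exp (- (t * (of_int n + r)\<^sup>2)) \<le> exp (t * (R + 1/4)) * exp (- t) ^ nat \<bar>n\<bar>"
proof -
  have "\<bar>of_int n + r\<bar> - 1/4 \<le> (of_int n + r)\<^sup>2"
    using zero_le_power2[of "\<bar>of_int n + r\<bar> - 1/2"] by (simp add: power2_eq_square algebra_simps)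
  then have "\<bar>of_int n\<bar> - (R + 1/4) \<le> (of_int n + r)\<^sup>2"
    using assms by linarith
  then have "t * (\<bar>of_int n\<bar> - (R + 1/4)) \<le> t * (of_int n + r)\<^sup>2"
    using assms by (intro mult_left_mono) auto
  then have "exp (- (t * (of_int n + r)\<^sup>2)) \<le> exp (t * (R + 1/4) + of_nat (nat \<bar>n\<bar>) * (- t))"
    by (simp add: algebra_simps)
  also have "\<dots> = exp (t * (R + 1/4)) * exp (- t) ^ nat \<bar>n\<bar>"
    by (simp only: exp_add exp_of_nat_mult)
  finally show ?thesis .
qed

lemma summable_on_exp_bound:
  fixes t :: real
  assumes "t > 0"
  shows "(\<lambda>n::int. C * exp (- t) ^ nat \<bar>n\<bar>) summable_on UNIV"
  using assms by (intro summable_on_cmult_right summable_on_power_nat_abs) auto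

lemma summable_on_exp_neg_square:
  fixes t r :: real
  assumes "t > 0"
  shows "(\<lambda>n::int. exp (- (t * (of_int n + r)\<^sup>2))) summable_on UNIV"
  by (rule summable_on_comparison_test[OF summable_on_exp_bound[OF assms]])
     (use exp_neg_square_le[OF assms order_refl] in auto)

lemma norm_nome_square:
  "norm (nome ((of_int n + of_real r)\<^sup>2 / 2 * \<tau>)) = exp (- (pi * Im \<tau> * (of_int n + r)\<^sup>2))"
proof -
  have "(of_int n + of_real r)\<^sup>2 / 2 * \<tau> = of_real ((of_int n + r)\<^sup>2 / 2) * \<tau>"
    by simp
  then show ?thesis
    by (simp only: norm_nome times_complex.simps Im_complex_of_real Re_complex_of_real) simp
qed

lemma twisted_theta_term_le:
  assumes Im_bounds: "0 < y" "y \<le> Im \<tau>" and norm_c_le: "norm (c n) \<le> C"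
  shows "norm (c n * nome ((of_int n + of_real r)\<^sup>2 / 2 * \<tau>)) \<le>
      C * exp (- (pi * y * (of_int n + r)\<^sup>2))"
proof -
  have "pi * y * (of_int n + r)\<^sup>2 \<le> pi * Im \<tau> * (of_int n + r)\<^sup>2"
    using Im_bounds by (intro mult_right_mono) auto
  then show ?thesis
    unfolding norm_mult norm_nome_square using norm_c_le norm_ge_zero[of "c n"]
    by (intro mult_mono) (auto simp del: norm_ge_zero)
qed

lemma twisted_theta_abs_summable:
  assumes "Im \<tau> > 0" and bounded: "bounded (range c)"
  shows "(\<lambda>n. norm (c n * nome ((of_int n + of_real r)\<^sup>2 / 2 * \<tau>))) summable_on UNIV"
proof -
  obtain C where norm_c_le: "\<And>n. norm (c n) \<le> C"
    using bounded by (auto simp: bounded_iff)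
  have "(\<lambda>n::int. C * exp (- (pi * Im \<tau> * (of_int n + r)\<^sup>2))) summable_on UNIV"
    using assms(1) by (intro summable_on_cmult_right summable_on_exp_neg_square) simp
  then show ?thesis
    by (rule Infinite_Sum.abs_summable_on_comparison_test')
       (rule twisted_theta_term_le[OF assms(1) order_refl norm_c_le])
qed

lemmas twisted_theta_summable = abs_summable_summable[OF twisted_theta_abs_summable]

lemma bounded_range_nome_of_real [simp]: "bounded (range (\<lambda>n. nome (of_real (f n))))"
  by (auto intro!: boundedI[of _ 1] simp: norm_nome)

lemma bounded_range_periodic:
  fixes c :: "int \<Rightarrow> 'a::real_normed_vector"
  assumes "M > 0" "\<And>x y. [x = y] (mod M) \<Longrightarrow> c x = c y"
  shows "bounded (range c)"
proof -
  have "c n = c (n mod M)" for n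
    by (rule assms(2)) (simp add: cong_def)
  moreover have "n mod M \<in> {0..<M}" for n
    using assms(1) by simp
  ultimately have "range c \<subseteq> c ` {0..<M}" by blast
  then show ?thesis
    by (meson bounded_subset finite_imageI finite_imp_bounded finite_atLeastLessThan_int)
qed

lemma twisted_theta_cmult: "twisted_theta (\<lambda>n. k * c n) r \<tau> = k * twisted_theta c r \<tau>"
  by (simp add: twisted_theta_def infsum_cmult_right' mult.assoc)

lemma twisted_theta_sum:
  assumes "finite A" "\<And>s. s \<in> A \<Longrightarrow> bounded (range (c s))" "Im \<tau> > 0"
  shows "twisted_theta (\<lambda>n. \<Sum>s\<in>A. c s n) r \<tau> = (\<Sum>s\<in>A. twisted_theta (c s) r \<tau>)"
proof -
  have "((\<lambda>n. \<Sum>s\<in>A. c s n * nome ((of_int n + of_real r)\<^sup>2 / 2 * \<tau>)) has_sum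
      (\<Sum>s\<in>A. twisted_theta (c s) r \<tau>)) UNIV"
    using assms(1,2)
  proof (induction rule: finite_induct)
    case (insert s A)
    have "((\<lambda>n. c s n * nome ((of_int n + of_real r)\<^sup>2 / 2 * \<tau>)) has_sum
        twisted_theta (c s) r \<tau>) UNIV"
      unfolding twisted_theta_def using insert.prems
      by (intro has_sum_infsum twisted_theta_summable assms(3)) auto
    with insert show ?case by (auto intro: has_sum_add)
  qed simp
  then show ?thesis
    by (simp add: twisted_theta_def sum_distrib_right infsumI)
qed

lemma twisted_theta_add_of_real:
  "twisted_theta c r (\<tau> + of_real x) =
      twisted_theta (\<lambda>n. c n * nome (of_real (x * (of_int n + r)\<^sup>2 / 2))) r \<tau>"
  unfolding twisted_theta_def
  by (intro infsum_cong) (simp add: mult.assoc nome_add[symmetric] algebra_simps add_divide_distrib)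

lemma infsum_split_residues:
  fixes f :: "int \<Rightarrow> 'a::banach"
  assumes M_pos: "M > 0" and f_summable: "f summable_on UNIV"
  shows "infsum f UNIV = (\<Sum>s\<in>{0..<M}. \<Sum>\<^sub>\<infinity>n. f (M * n + s))"
proof -
  have "infsum f (\<Union>s\<in>{0..<M}. range (\<lambda>n. M * n + s)) =
      (\<Sum>s\<in>{0..<M}. infsum f (range (\<lambda>n. M * n + s)))"
  proof (rule sum_infsum[symmetric])
    fix s t assume "s \<in> {0..<M}" "t \<in> {0..<M}" "s \<noteq> t"
    then have "(M * n + s) mod M \<noteq> (M * m + t) mod M" for n m by simp
    then have "M * n + s \<noteq> M * m + t" for n m by metis
    then show "range (\<lambda>n. M * n + s) \<inter> range (\<lambda>n. M * n + t) = {}"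
      by blast
  qed (auto intro: summable_on_subset_banach[OF f_summable])
  moreover have "(\<Union>s\<in>{0..<M}. range (\<lambda>n. M * n + s)) = UNIV"
  proof (rule UNIV_eq_I[symmetric])
    fix n show "n \<in> (\<Union>s\<in>{0..<M}. range (\<lambda>n. M * n + s))"
      using M_pos by (intro UN_I[of "n mod M"] image_eqI[of _ _ "n div M"]) auto
  qed
  moreover have "infsum f (range (\<lambda>n. M * n + s)) = (\<Sum>\<^sub>\<infinity>n. f (M * n + s))" for s
    using M_pos by (subst infsum_reindex) (auto simp: inj_on_def o_def)
  ultimately show ?thesis by simp
qed

lemma twisted_theta_periodic:
  assumes Im_pos: "Im \<tau> > 0" and M_pos: "M > 0" and periodic: "\<And>x y. [x = y] (mod M) \<Longrightarrow> c x = c y"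
  shows "twisted_theta c r \<tau> =
      (\<Sum>s\<in>{0..<M}. c s * theta ((of_int s + r) / of_int M) ((of_int M)\<^sup>2 * \<tau>))"
proof -
  have "bounded (range c)"
    using M_pos periodic by (rule bounded_range_periodic)
  from infsum_split_residues[OF M_pos twisted_theta_summable[OF Im_pos this]]
  have "twisted_theta c r \<tau> =
      (\<Sum>s\<in>{0..<M}. \<Sum>\<^sub>\<infinity>n. c (M * n + s) * nome ((of_int (M * n + s) + of_real r)\<^sup>2 / 2 * \<tau>))"
    by (simp only: twisted_theta_def)
  moreover have "c (M * n + s) * nome ((of_int (M * n + s) + of_real r)\<^sup>2 / 2 * \<tau>) =
      c s * (1 * nome ((of_int n + of_real ((of_int s + r) / of_int M))\<^sup>2 / 2 *
          ((of_int M)\<^sup>2 * \<tau>)))" for n s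
  proof -
    have "of_int (M * n + s) + complex_of_real r =
        (of_int n + of_real ((of_int s + r) / of_int M)) * of_int M"
      using M_pos by (simp add: field_simps)
    moreover have "c (M * n + s) = c s"
      by (rule periodic) (simp add: cong_def)
    ultimately show ?thesis by (simp add: power_mult_distrib mult_ac)
  qed
  ultimately show ?thesis
    by (simp only: infsum_cmult_right' twisted_theta_def)
qed

lemma holomorphic_on_infsum:
  fixes f :: "'i \<Rightarrow> complex \<Rightarrow> complex"
  assumes "open S" and holomorphic: "\<And>n. f n holomorphic_on S"
    and normal: "\<And>K. compact K \<Longrightarrow> K \<subseteq> S \<Longrightarrow> K \<noteq> {} \<Longrightarrow>
      \<exists>M. M summable_on A \<and> (\<forall>n\<in>A. \<forall>z\<in>K. norm (f n z) \<le> M n)"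
  shows "(\<lambda>z. \<Sum>\<^sub>\<infinity>n\<in>A. f n z) holomorphic_on S"
proof -
  have "(\<lambda>z. \<Sum>\<^sub>\<infinity>n\<in>A. f n z) analytic_on {w}" if "w \<in> S" for w
  proof -
    obtain d where cball_subset: "d > 0" "cball w d \<subseteq> S"
      using \<open>open S\<close> \<open>w \<in> S\<close> open_contains_cball by blast
    then obtain M where dominated: "M summable_on A"
        "\<And>n z. n \<in> A \<Longrightarrow> z \<in> cball w d \<Longrightarrow> norm (f n z) \<le> M n"
      using normal[OF compact_cball cball_subset(2)] by force
    have holomorphic_cball: "f n holomorphic_on cball w d" for n
      using holomorphic cball_subset(2) by (rule holomorphic_on_subset)
    have "(\<lambda>z. \<Sum>\<^sub>\<infinity>n\<in>A. f n z) holomorphic_on ball w d"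
      by (rule holomorphic_uniform_limit[OF _ Weierstrass_m_test_general[OF dominated(2,1)]])
         (auto intro!: always_eventually continuous_intros holomorphic_intros
             holomorphic_on_imp_continuous_on holomorphic_cball
           intro: holomorphic_on_subset[OF holomorphic_cball ball_subset_cball])
    then show ?thesis
      using cball_subset(1) by (auto simp: analytic_at intro!: exI[of _ "ball w d"])
  qed
  then show ?thesis
    using analytic_on_analytic_at analytic_imp_holomorphic by blast
qed

lemma open_upper_half_plane: "open upper_half_plane"
  unfolding upper_half_plane_def by (rule open_halfspace_Im_gt)

lemma connected_upper_half_plane: "connected upper_half_plane"
  unfolding upper_half_plane_def by (intro convex_connected convex_halfspace_Im_gt)

lemma holomorphic_on_twisted_theta:
  assumes "bounded (range c)"
  shows "twisted_theta c r holomorphic_on upper_half_plane"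
  unfolding twisted_theta_def[abs_def]
proof (rule holomorphic_on_infsum[OF open_upper_half_plane])
  obtain C where norm_c_le: "\<And>n. norm (c n) \<le> C"
    using assms by (auto simp: bounded_iff)
  fix K assume K_compact: "compact K" "K \<subseteq> upper_half_plane" "K \<noteq> {}"
  then obtain \<tau>\<^sub>0 where minimal: "\<tau>\<^sub>0 \<in> K" "\<And>\<tau>. \<tau> \<in> K \<Longrightarrow> Im \<tau>\<^sub>0 \<le> Im \<tau>"
    using continuous_attains_inf[OF K_compact(1,3), of Im] continuous_on_Im[OF continuous_on_id]
    by auto
  then have "Im \<tau>\<^sub>0 > 0" using K_compact(2) by (auto simp: upper_half_plane_def)
  with minimal(2) show "\<exists>M. M summable_on UNIV \<and>
      (\<forall>n\<in>UNIV. \<forall>\<tau>\<in>K. norm (c n * nome ((of_int n + of_real r)\<^sup>2 / 2 * \<tau>)) \<le> M n)"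
    by (intro exI[of _ "\<lambda>n. C * exp (- (pi * Im \<tau>\<^sub>0 * (of_int n + r)\<^sup>2))"] conjI ballI
          summable_on_cmult_right summable_on_exp_neg_square twisted_theta_term_le norm_c_le) auto
qed (auto intro!: holomorphic_intros)

lemma csqrt_of_real_mult: "r > 0 \<Longrightarrow> csqrt (of_real r * z) = of_real (sqrt r) * csqrt z"
  using csqrt_mult[of "of_real r" z] by (simp add: mpi_less_Arg Arg_le_pi)

lemma csqrt_divide:
  assumes "Re z > 0" "Re w > 0"
  shows "csqrt (z / w) = csqrt z / csqrt w"
proof -
  have w_not_nonpos: "w \<notin> \<real>\<^sub>\<le>\<^sub>0" using assms(2) by (auto simp: complex_nonpos_Reals_iff)
  then have "Arg (inverse w) = - Arg w"
    using Arg_inverse[of w] Arg_eq_0[of w] assms(2) by (auto split: if_splits)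
  moreover have "\<bar>Arg z\<bar> < pi / 2" "\<bar>Arg w\<bar> < pi / 2"
    using assms by (simp_all only: Arg_Re_pos simp_thms)
  ultimately have "csqrt (z * inverse w) = csqrt z * csqrt (inverse w)"
    by (intro csqrt_mult) auto
  then show ?thesis
    using csqrt_inverse[OF w_not_nonpos] by (simp add: divide_inverse)
qed

lemma twisted_theta_imaginary:
  "twisted_theta c r (\<i> * of_real t) = (\<Sum>\<^sub>\<infinity>n. c n * of_real (exp (- (pi * t * (of_int n + r)\<^sup>2))))"
proof -
  have "nome ((of_int n + of_real r)\<^sup>2 / 2 * (\<i> * of_real t)) =
      of_real (exp (- (pi * t * (of_int n + r)\<^sup>2)))" for n :: int
    by (simp add: nome_def exp_of_real[symmetric] algebra_simps)
  then show ?thesis by (simp add: twisted_theta_def)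
qed

lemma theta_inversion_imaginary:
  assumes t_pos: "t > 0"
  shows "theta r (\<i> * of_real t) =
    of_real (1 / sqrt t) *
        twisted_theta (\<lambda>k. nome (of_real (of_int k * r))) 0 (\<i> * of_real (1 / t))"
proof -
  define f where "f = (\<lambda>x. complex_of_real (exp (- (pi * t * (x + r)\<^sup>2))))"
  have transform: "fourier_transform f (of_int k) =
      of_real (1 / sqrt t) *
          (nome (of_real (of_int k * r)) * of_real (exp (- (pi * (1 / t) * (of_int k + 0)\<^sup>2))))"
    for k :: int
    unfolding f_def fourier_transform_gaussian[OF t_pos] by simp
  have "(\<Sum>\<^sub>\<infinity>n::int. f (of_int n)) = (\<Sum>\<^sub>\<infinity>k::int. fourier_transform f (of_int k))"
  proof (rule poisson_summation)
    show "continuous_on UNIV f" unfolding f_def by (intro continuous_intros)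
    show "integrable lborel f" unfolding f_def by (rule integrable_gaussian[OF t_pos])
    show "norm (f (x + of_int n)) \<le> exp (pi * t * (1 + \<bar>r\<bar> + 1/4)) * exp (- (pi * t)) ^ nat \<bar>n\<bar>"
      if "x \<in> {0..1}" for n x
    proof -
      have "\<bar>x + r\<bar> \<le> 1 + \<bar>r\<bar>" using that by auto
      from exp_neg_square_le[OF _ this, of "pi * t" n] t_pos show ?thesis
        by (simp add: f_def add_ac)
    qed
    show "(\<lambda>n. exp (pi * t * (1 + \<bar>r\<bar> + 1/4)) *
        exp (- (pi * t)) ^ nat \<bar>n\<bar>) summable_on (UNIV :: int set)"
      using t_pos by (intro summable_on_exp_bound) simp
    show "(\<lambda>k. norm (fourier_transform f (of_int k))) summable_on (UNIV :: int set)"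
      unfolding transform norm_mult norm_of_real
      using t_pos
        summable_on_cmult_right[OF summable_on_exp_neg_square[of "pi * (1 / t)" 0], of "1 / sqrt t"]
      by (simp add: norm_nome)
  qed
  then show ?thesis
    unfolding transform twisted_theta_imaginary infsum_cmult_right' by (simp add: f_def)
qed

lemma Im_neg_inverse: "Im \<tau> > 0 \<Longrightarrow> Im (- 1 / \<tau>) > 0"
  by (auto simp: Im_divide field_simps sum_power2_gt_zero_iff)

theorem theta_inversion:
  assumes Im_pos: "Im \<tau> > 0"
  shows "theta r (- 1 / \<tau>) =
      csqrt (- \<i> * \<tau>) * twisted_theta (\<lambda>k. nome (of_real (of_int k * r))) 0 \<tau>"
proof -
  define dual where "dual = twisted_theta (\<lambda>k. nome (of_real (of_int k * r))) 0"
  define f where "f = (\<lambda>\<tau>. theta r (- 1 / \<tau>) - csqrt (- \<i> * \<tau>) * dual \<tau>)"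
  define U where "U = (\<lambda>t. \<i> * complex_of_real t) ` {0<..}"
  have "(theta r \<circ> (\<lambda>\<tau>. - 1 / \<tau>)) holomorphic_on upper_half_plane"
    by (rule holomorphic_on_compose_gen[OF _ holomorphic_on_twisted_theta])
       (auto intro!: holomorphic_intros simp: upper_half_plane_def Im_neg_inverse[simplified])
  moreover have "dual holomorphic_on upper_half_plane"
    unfolding dual_def by (rule holomorphic_on_twisted_theta[OF bounded_range_nome_of_real])
  moreover have "- \<i> * \<tau> \<notin> \<real>\<^sub>\<le>\<^sub>0" if "\<tau> \<in> upper_half_plane" for \<tau>
    using that by (auto simp: upper_half_plane_def complex_nonpos_Reals_iff)
  ultimately have "f holomorphic_on upper_half_plane"
    unfolding f_def o_def by (intro holomorphic_intros) auto
  moreover have "f z = 0" if "z \<in> U" for z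
  proof -
    obtain t where t: "t > 0" "z = \<i> * of_real t"
      using \<open>z \<in> U\<close> by (auto simp: U_def)
    then have "- 1 / z = \<i> * of_real (1 / t)" "csqrt (- \<i> * z) = of_real (sqrt t)"
      by (simp_all add: field_simps)
    then show ?thesis
      using theta_inversion_imaginary[of "1 / t" r] t by (simp add: f_def dual_def real_sqrt_divide)
  qed
  moreover have "\<i> islimpt U"
    unfolding islimpt_approachable U_def
  proof (intro allI impI)
    fix e :: real assume "e > 0"
    then show "\<exists>z\<in>(\<lambda>t. \<i> * of_real t) ` {0<..}. z \<noteq> \<i> \<and> dist z \<i> < e"
      by (intro bexI[of _ "\<i> * of_real (1 + e / 2)"])
         (auto simp: dist_norm algebra_simps norm_mult complex_eq_iff
             intro!: image_eqI[of _ _ "1 + e/2"])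
  qed
  moreover have "U \<subseteq> upper_half_plane" "\<i> \<in> upper_half_plane" "\<tau> \<in> upper_half_plane"
    using Im_pos by (auto simp: U_def upper_half_plane_def)
  ultimately have "f \<tau> = 0"
    using analytic_continuation[OF _ open_upper_half_plane connected_upper_half_plane] by blast
  then show ?thesis by (simp add: f_def dual_def)
qed

lemma
  fixes y :: real
  assumes y_pos: "y > 0"
  shows Im_theta_imaginary: "Im (theta r (\<i> * of_real y)) = 0"
    and Re_theta_imaginary_pos: "Re (theta r (\<i> * of_real y)) > 0"
proof -
  let ?f = "\<lambda>n::int. exp (- (pi * y * (of_int n + r)\<^sup>2))"
  have summable: "?f summable_on UNIV" using y_pos by (intro summable_on_exp_neg_square) simp
  have theta: "theta r (\<i> * of_real y) = of_real (infsum ?f UNIV)"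
    unfolding twisted_theta_imaginary
    by (simp add: infsumI[OF has_sum_of_real[OF has_sum_infsum[OF summable]]])
  then show "Im (theta r (\<i> * of_real y)) = 0" by simp
  have "0 < (\<Sum>n\<in>{0}. ?f n)" by simp
  also have "\<dots> \<le> infsum ?f UNIV"
    by (rule finite_sum_le_infsum[OF summable]) auto
  finally show "Re (theta r (\<i> * of_real y)) > 0" by (simp add: theta)
qed

section \<open>Holomorphy at the cusp at infinity\<close>

lemma holomorphic_at_infinity_iff_nome:
  "holomorphic_at_infinity f \<longleftrightarrow> (\<exists>N::nat. N > 0 \<and> (\<exists>g. g holomorphic_on ball 0 1 \<and>
    (\<forall>\<tau>\<in>upper_half_plane. f \<tau> = g (nome (\<tau> / of_nat N)))))"
  by (simp add: holomorphic_at_infinity_def nome_def)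

lemma nome_in_unit_ball: "\<tau> \<in> upper_half_plane \<Longrightarrow> N > 0 \<Longrightarrow> nome (\<tau> / of_nat N) \<in> ball 0 1"
  by (auto simp: upper_half_plane_def norm_nome)

lemma holomorphic_at_infinity_imp_holomorphic:
  assumes "holomorphic_at_infinity f"
  shows "f holomorphic_on upper_half_plane"
proof -
  obtain N g where N_pos: "N > 0" and g_holomorphic: "g holomorphic_on ball 0 1"
    and f_eq: "\<And>\<tau>. \<tau> \<in> upper_half_plane \<Longrightarrow> f \<tau> = g (nome (\<tau> / of_nat N))"
    using assms unfolding holomorphic_at_infinity_iff_nome by blast
  have "(g \<circ> (\<lambda>\<tau>. nome (\<tau> / of_nat N))) holomorphic_on upper_half_plane"
    by (rule holomorphic_on_compose_gen[OF _ g_holomorphic])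
       (use N_pos nome_in_unit_ball in \<open>auto intro!: holomorphic_intros\<close>)
  then show ?thesis
    by (rule holomorphic_transform) (simp add: f_eq)
qed

lemma holomorphic_at_infinity_cong:
  assumes "holomorphic_at_infinity f" "\<And>\<tau>. \<tau> \<in> upper_half_plane \<Longrightarrow> g \<tau> = f \<tau>"
  shows "holomorphic_at_infinity g"
  using assms unfolding holomorphic_at_infinity_def by metis

lemma holomorphic_at_infinity_const: "holomorphic_at_infinity (\<lambda>_. c)"
  unfolding holomorphic_at_infinity_def by (intro exI[of _ 1] conjI exI[of _ "\<lambda>_. c"]) auto

lemma holomorphic_on_unit_ball_compose_power:
  assumes "g holomorphic_on ball 0 1" "M > 0"
  shows "(\<lambda>w. g (w ^ M)) holomorphic_on ball (0::complex) 1"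
proof -
  have "(g \<circ> (\<lambda>w. w ^ M)) holomorphic_on ball 0 1"
    by (rule holomorphic_on_compose_gen[OF _ assms(1)])
       (use assms(2) in \<open>auto intro!: holomorphic_intros simp: norm_power power_less_one_iff\<close>)
  then show ?thesis by (simp add: o_def)
qed

lemma holomorphic_at_infinity_combine:
  assumes "holomorphic_at_infinity f1" "holomorphic_at_infinity f2"
    and op_holomorphic: "\<And>g1 g2. g1 holomorphic_on ball 0 1 \<Longrightarrow> g2 holomorphic_on ball 0 1 \<Longrightarrow>
      (\<lambda>w. op (g1 w) (g2 w)) holomorphic_on ball 0 1"
  shows "holomorphic_at_infinity (\<lambda>\<tau>. op (f1 \<tau>) (f2 \<tau>))"
proof -
  obtain N1 g1 N2 g2
    where f1_expansion: "N1 > 0" "g1 holomorphic_on ball 0 1"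
      "\<And>\<tau>. \<tau> \<in> upper_half_plane \<Longrightarrow> f1 \<tau> = g1 (nome (\<tau> / of_nat N1))"
    and f2_expansion: "N2 > 0" "g2 holomorphic_on ball 0 1"
      "\<And>\<tau>. \<tau> \<in> upper_half_plane \<Longrightarrow> f2 \<tau> = g2 (nome (\<tau> / of_nat N2))"
    using assms(1,2) unfolding holomorphic_at_infinity_iff_nome by metis
  have rescale: "nome (\<tau> / of_nat N1) = nome (\<tau> / of_nat (N1 * N2)) ^ N2"
    "nome (\<tau> / of_nat N2) = nome (\<tau> / of_nat (N1 * N2)) ^ N1" for \<tau>
    using f1_expansion(1) f2_expansion(1) by (simp_all add: nome_of_nat_mult[symmetric])
  show ?thesis
    unfolding holomorphic_at_infinity_iff_nome
  proof (intro exI[of _ "N1 * N2"] conjI exI[of _ "\<lambda>w. op (g1 (w ^ N2)) (g2 (w ^ N1))"]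
      op_holomorphic ballI)
    show "op (f1 \<tau>) (f2 \<tau>) =
        op (g1 (nome (\<tau> / of_nat (N1 * N2)) ^ N2)) (g2 (nome (\<tau> / of_nat (N1 * N2)) ^ N1))"
      if "\<tau> \<in> upper_half_plane" for \<tau>
      unfolding rescale[symmetric] using f1_expansion(3)[OF that] f2_expansion(3)[OF that] by simp
  qed (use f1_expansion f2_expansion holomorphic_on_unit_ball_compose_power in auto)
qed

lemma holomorphic_at_infinity_add:
  "holomorphic_at_infinity f1 \<Longrightarrow> holomorphic_at_infinity f2 \<Longrightarrow>
      holomorphic_at_infinity (\<lambda>\<tau>. f1 \<tau> + f2 \<tau>)"
  by (rule holomorphic_at_infinity_combine) (auto intro: holomorphic_intros)

lemma holomorphic_at_infinity_mult:
  "holomorphic_at_infinity f1 \<Longrightarrow> holomorphic_at_infinity f2 \<Longrightarrow>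
      holomorphic_at_infinity (\<lambda>\<tau>. f1 \<tau> * f2 \<tau>)"
  by (rule holomorphic_at_infinity_combine) (auto intro: holomorphic_intros)

lemma holomorphic_on_lacunary_series:
  fixes c :: "int \<Rightarrow> complex" and e :: "int \<Rightarrow> nat"
  assumes "bounded (range c)" and exponent_ge: "\<And>n. nat \<bar>n\<bar> \<le> e n + m"
  shows "(\<lambda>w. \<Sum>\<^sub>\<infinity>n. c n * w ^ e n) holomorphic_on ball 0 1"
proof (rule holomorphic_on_infsum)
  obtain C where norm_c_le: "\<And>n. norm (c n) \<le> C"
    using assms(1) by (auto simp: bounded_iff)
  then have "C \<ge> 0" using norm_ge_zero order_trans by blast
  fix K assume K_compact: "compact K" "K \<subseteq> ball (0::complex) 1" "K \<noteq> {}"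
  then obtain z where maximal: "z \<in> K" "\<And>w. w \<in> K \<Longrightarrow> norm w \<le> norm z"
    using continuous_attains_sup[OF K_compact(1,3) continuous_on_norm[OF continuous_on_id]] by blast
  define R where "R = (norm z + 1) / 2"
  have radius: "0 < R" "R < 1" "norm z \<le> R"
    using maximal(1) K_compact(2) by (auto simp: R_def add_nonneg_pos)
  have "norm (c n * w ^ e n) \<le> C / R ^ m * R ^ nat \<bar>n\<bar>" if "w \<in> K" for n w
  proof -
    have "norm (c n * w ^ e n) \<le> C * R ^ e n"
      unfolding norm_mult norm_power using maximal(2)[OF that] radius norm_c_le \<open>C \<ge> 0\<close>
      by (intro mult_mono power_mono) auto
    also have "\<dots> = C / R ^ m * R ^ (e n + m)"
      using radius by (simp add: power_add)
    also have "\<dots> \<le> C / R ^ m * R ^ nat \<bar>n\<bar>"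
      using radius exponent_ge \<open>C \<ge> 0\<close> by (intro mult_left_mono power_decreasing) auto
    finally show ?thesis .
  qed
  then show "\<exists>M. M summable_on UNIV \<and> (\<forall>n\<in>UNIV. \<forall>w\<in>K. norm (c n * w ^ e n) \<le> M n)"
    using radius
    by (intro exI[of _ "\<lambda>n. C / R ^ m * R ^ nat \<bar>n\<bar>"] conjI summable_on_cmult_right
          summable_on_power_nat_abs) auto
qed (auto intro!: holomorphic_intros)

lemma rational_square_exponents:
  fixes r \<alpha> :: real
  assumes "r \<in> \<rat>" "\<alpha> \<in> \<rat>" "\<alpha> > 0"
  obtains N :: nat and e :: "int \<Rightarrow> nat" and m :: nat where "N > 0"
    "\<And>n. (of_int n + r)\<^sup>2 / 2 * \<alpha> = of_nat (e n) / of_nat N" "\<And>n. nat \<bar>n\<bar> \<le> e n + m"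
proof -
  obtain p Q where r_eq: "Q > 0" "r = of_int p / of_int Q"
    using assms(1) by (cases rule: Rats_cases') auto
  obtain a b where \<alpha>_eq: "b > 0" "\<alpha> = of_int a / of_int b"
    using assms(2) by (cases rule: Rats_cases') auto
  have a_pos: "a > 0"
    using assms(3) \<alpha>_eq by (simp add: zero_less_divide_iff)
  define e where "e = (\<lambda>n. nat (a * (n * Q + p)\<^sup>2))"
  show thesis
  proof (rule that)
    show "nat (2 * b * Q\<^sup>2) > 0" using r_eq \<alpha>_eq by simp
    fix n
    have "of_int n + r = of_int (n * Q + p) / of_int Q"
      unfolding r_eq(2) using r_eq(1) by (simp add: field_simps)
    then have "(of_int n + r)\<^sup>2 = of_int ((n * Q + p)\<^sup>2) / of_int (Q\<^sup>2)"
      by (simp add: power_divide)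
    then show "(of_int n + r)\<^sup>2 / 2 * \<alpha> = of_nat (e n) / of_nat (nat (2 * b * Q\<^sup>2))"
      unfolding \<alpha>_eq(2) e_def using a_pos r_eq(1) \<alpha>_eq(1) by (simp add: mult_ac)
    have self_le_square: "\<bar>x\<bar> \<le> x\<^sup>2" for x :: int
      by (cases "x = 0") (use self_le_power[of "\<bar>x\<bar>" 2] in auto)
    have "\<bar>n\<bar> * 1 \<le> \<bar>n\<bar> * \<bar>Q\<bar>"
      using r_eq(1) by (intro mult_left_mono) auto
    then have "\<bar>n\<bar> \<le> \<bar>n * Q + p\<bar> + \<bar>p\<bar>"
      by (simp add: abs_mult[symmetric])
    also have "\<bar>n * Q + p\<bar> \<le> 1 * (n * Q + p)\<^sup>2"
      using self_le_square by simp
    also have "\<dots> \<le> a * (n * Q + p)\<^sup>2"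
      using a_pos by (intro mult_right_mono) auto
    finally show "nat \<bar>n\<bar> \<le> e n + nat \<bar>p\<bar>" by (simp add: e_def)
  qed
qed

lemma twisted_theta_holomorphic_at_infinity:
  assumes "r \<in> \<rat>" "\<alpha> \<in> \<rat>" "\<alpha> > 0" and bounded: "bounded (range c)"
  shows "holomorphic_at_infinity (\<lambda>\<tau>. twisted_theta c r (of_real \<alpha> * \<tau>))"
proof -
  obtain N e m where N_pos: "N > 0"
    and exponent_eq: "\<And>n. (of_int n + r)\<^sup>2 / 2 * \<alpha> = of_nat (e n) / of_nat N"
    and exponent_ge: "\<And>n. nat \<bar>n\<bar> \<le> e n + m"
    using rational_square_exponents[OF assms(1-3)] by blast
  have "nome ((of_int n + of_real r)\<^sup>2 / 2 * (of_real \<alpha> * \<tau>)) = nome (\<tau> / of_nat N) ^ e n" for n \<tau>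
  proof -
    have "(of_int n + of_real r)\<^sup>2 / 2 * (of_real \<alpha> * \<tau>) = of_real ((of_int n + r)\<^sup>2 / 2 * \<alpha>) * \<tau>"
      by simp
    also have "\<dots> = of_nat (e n) * (\<tau> / of_nat N)"
      unfolding exponent_eq by simp
    finally show ?thesis by (simp only: nome_of_nat_mult)
  qed
  then show ?thesis
    unfolding holomorphic_at_infinity_iff_nome twisted_theta_def
    by (intro exI[of _ N] conjI exI[of _ "\<lambda>w. \<Sum>\<^sub>\<infinity>n. c n * w ^ e n"] N_pos
        holomorphic_on_lacunary_series[OF bounded exponent_ge]) simp
qed

section \<open>The slash action\<close>

definition moebius :: "int \<Rightarrow> int \<Rightarrow> int \<Rightarrow> int \<Rightarrow> complex \<Rightarrow> complex" where
  "moebius a b c d \<tau> = (of_int a * \<tau> + of_int b) / (of_int c * \<tau> + of_int d)"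

lemma slash_eq_moebius:
  "slash w a b c d f \<tau> = (of_int c * \<tau> + of_int d) powi (- w) * f (moebius a b c d \<tau>)"
  by (simp add: slash_def moebius_def)

lemma coprime_if_det_1:
  fixes a b c d x :: int
  assumes "a * d - b * c = 1" "x dvd b * c"
  shows "coprime d x"
proof (rule coprimeI)
  fix y assume "y dvd d" "y dvd x"
  then have "y dvd a * d - b * c" using assms(2) by (meson dvd_diff dvd_mult dvd_trans)
  then show "is_unit y" using assms(1) by simp
qed

lemma moebius_denominator_nonzero:
  assumes "a * d - b * c = 1" "Im \<tau> > 0"
  shows "of_int c * \<tau> + of_int d \<noteq> 0"
proof
  assume denominator_0: "of_int c * \<tau> + of_int d = 0"
  then have "Im (of_int c * \<tau> + of_int d) = 0" by simp
  then have "c = 0" using assms(2) by simp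
  with denominator_0 assms(1) show False by simp
qed

lemma Im_moebius_pos:
  assumes "a * d - b * c = 1" "Im \<tau> > 0"
  shows "Im (moebius a b c d \<tau>) > 0"
proof -
  let ?w = "of_int c * \<tau> + of_int d"
  have "Im (moebius a b c d \<tau>) = (of_int (a * d - b * c) * Im \<tau>) / (cmod ?w)\<^sup>2"
    by (simp add: moebius_def Im_divide cmod_power2 algebra_simps)
  then show ?thesis
    using assms moebius_denominator_nonzero[OF assms] by simp
qed

lemma slash_slash:
  assumes "of_int c' * \<tau> + of_int d' \<noteq> 0"
  shows "slash w a' b' c' d' (slash w a b c d f) \<tau> =
    slash w (a * a' + b * c') (a * b' + b * d') (c * a' + d * c') (c * b' + d * d') f \<tau>"
proof -
  define x where "x = of_int c' * \<tau> + of_int d'"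
  have "x \<noteq> 0" using assms by (simp add: x_def)
  have expand: "of_int m * moebius a' b' c' d' \<tau> + of_int n =
      (of_int (m * a' + n * c') * \<tau> + of_int (m * b' + n * d')) / x" for m n
  proof -
    have "of_int (m * a' + n * c') * \<tau> + of_int (m * b' + n * d') =
        of_int m * (of_int a' * \<tau> + of_int b') + of_int n * x"
      by (simp add: x_def algebra_simps)
    then show ?thesis
      using \<open>x \<noteq> 0\<close>
      by (simp only: moebius_def x_def[symmetric] times_divide_eq_right divide_add_eq_iff simp_thms)
  qed
  have "moebius a b c d (moebius a' b' c' d' \<tau>) =
      moebius (a * a' + b * c') (a * b' + b * d') (c * a' + d * c') (c * b' + d * d') \<tau>"
    using \<open>x \<noteq> 0\<close> by (simp only: moebius_def[of a b c d] expand) (simp add: moebius_def)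
  then show ?thesis
    using \<open>x \<noteq> 0\<close>
    by (simp only: slash_eq_moebius expand power_int_divide_distrib x_def[symmetric]) simp
qed

lemma slash_identity: "slash w 1 0 0 1 f \<tau> = f \<tau>"
  by (simp add: slash_def)

lemma slash_translation: "slash w 1 j 0 1 f \<tau> = f (\<tau> + of_int j)"
  by (simp add: slash_def)

lemma slash_uminus: "slash w (- a) (- b) (- c) (- d) f \<tau> = (- 1) powi w * slash w a b c d f \<tau>"
proof -
  have "of_int (- m) * \<tau> + of_int (- n) = - 1 * (of_int m * \<tau> + of_int n)" for m n :: int
    by simp
  moreover have "((- 1) :: complex) powi (- w) = (- 1) powi w"
    by (simp add: power_int_minus_left)
  ultimately show ?thesis
    by (simp only: slash_def power_int_mult_distrib mult_divide_mult_cancel_left_if mult.assoc) simp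
qed

lemma slash_cmult: "slash w a b c d (\<lambda>\<tau>. k * f \<tau>) \<tau> = k * slash w a b c d f \<tau>"
  by (simp add: slash_def)

lemma slash_times:
  assumes "of_int c * \<tau> + of_int d \<noteq> 0"
  shows "slash (v + w) a b c d (\<lambda>\<tau>. f \<tau> * g \<tau>) \<tau> = slash v a b c d f \<tau> * slash w a b c d g \<tau>"
  using assms by (simp add: slash_def power_int_diff power_int_minus field_simps)

lemma slash_prod:
  assumes "of_int c * \<tau> + of_int d \<noteq> 0" "finite A"
  shows "slash (int (card A) * w) a b c d (\<lambda>\<tau>. \<Prod>i\<in>A. f i \<tau>) \<tau> = (\<Prod>i\<in>A. slash w a b c d (f i) \<tau>)"
  using assms(2)
proof (induction rule: finite_induct)
  case (insert x A)
  then show ?case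
    using slash_times[OF assms(1), of w "int (card A) * w" a b "f x"] by (simp add: distrib_right)
qed (simp add: slash_def)

lemma slash_rescale:
  "slash w a b (j * c) d (\<lambda>\<tau>. f (of_int j * \<tau>)) \<tau> = slash w a (j * b) c d f (of_int j * \<tau>)"
  by (simp add: slash_def algebra_simps)

lemma slash_cong:
  assumes "a * d - b * c = 1" "Im \<tau> > 0" "\<And>\<tau>. Im \<tau> > 0 \<Longrightarrow> f \<tau> = g \<tau>"
  shows "slash w a b c d f \<tau> = slash w a b c d g \<tau>"
  using assms(3)[OF Im_moebius_pos[OF assms(1,2)]] by (simp add: slash_eq_moebius)

lemma exists_abs_diff_mult_less:
  fixes x y :: int
  assumes "y \<noteq> 0" "\<bar>y\<bar> < 2 * \<bar>x\<bar>"
  shows "\<exists>s. \<bar>x - s * y\<bar> < \<bar>x\<bar>"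
  using assms by (intro exI[of _ "sgn x * sgn y"]) (auto simp: sgn_if abs_if split: if_splits)

lemma lower_row_reduction:
  fixes N c d :: int
  assumes N_bounds: "1 \<le> N" "N \<le> 3" and nonzero: "c \<noteq> 0" "d \<noteq> 0"
  obtains (change_d) s where "\<bar>d - s * c\<bar> < \<bar>d\<bar>" | (change_c) s where "\<bar>c - s * (N * d)\<bar> < \<bar>c\<bar>"
proof (cases "\<bar>c\<bar> < 2 * \<bar>d\<bar>")
  case True
  then show thesis using exists_abs_diff_mult_less[OF nonzero(1)] change_d by blast
next
  case False
  then have "\<bar>N * d\<bar> < 2 * \<bar>c\<bar>"
    using mult_right_mono[OF N_bounds(2), of "\<bar>d\<bar>"] zero_less_abs_iff[of d] nonzero(2) N_bounds(1)
    unfolding abs_mult by linarith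
  then show thesis using exists_abs_diff_mult_less[of "N * d" c] nonzero(2) N_bounds(1) change_c
    by auto
qed

text \<open>Euclid's algorithm on the lower row \<open>(c, d)\<close>: as \<open>N < 4\<close>, subtracting a multiple of \<open>c\<close>
  from \<open>d\<close> or a multiple of \<open>N d\<close> from \<open>c\<close> always makes the row smaller.\<close>

lemma Gamma0_induct [consumes 4, case_names identity uminus translate lower]:
  fixes N a b c d :: int
  assumes N_bounds: "1 \<le> N" "N \<le> 3" and det: "a * d - b * c = 1" and dvd: "N dvd c"
    and identity: "P 1 0 0 1"
    and uminus: "\<And>a b c d. a * d - b * c = 1 \<Longrightarrow> N dvd c \<Longrightarrow> P a b c d \<Longrightarrow> P (- a) (- b) (- c) (- d)"
    and translate: "\<And>a b c d j. a * d - b * c = 1 \<Longrightarrow> N dvd c \<Longrightarrow> P a b c d \<Longrightarrow>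
        P a (b + j * a) c (d + j * c)"
    and lower: "\<And>a b c d j. a * d - b * c = 1 \<Longrightarrow> N dvd c \<Longrightarrow> P a b c d \<Longrightarrow>
        P (a + j * N * b) b (c + j * N * d) d"
  shows "P a b c d"
  using det dvd
proof (induction "nat (\<bar>c\<bar> + \<bar>d\<bar>)" arbitrary: a b c d rule: less_induct)
  case less
  have upper_triangular: "P a b 0 d" if "a * d = 1" for a b d
  proof -
    have "P 1 n 0 1" for n using translate[OF _ _ identity, of n] by simp
    then have "P 1 b 0 1" "P (- 1) b 0 (- 1)" using uminus[of 1 1 "- b" 0] by simp_all
    then show ?thesis using that by (auto simp: zmult_eq_1_iff)
  qed
  consider (c_zero) "c = 0" | (d_zero) "d = 0" | (reduce) "c \<noteq> 0" "d \<noteq> 0" by blast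
  then show ?case
  proof cases
    case c_zero
    then show ?thesis using upper_triangular less.prems by simp
  next
    case d_zero
    then have minus_bc: "- b * c = 1" using less.prems by simp
    then have "N dvd 1" using less.prems(2) by (metis dvd_trans dvd_triv_right)
    then have "N = 1" using N_bounds by simp
    have "P (- b) (a + b) 0 c" using upper_triangular minus_bc by simp
    from lower[OF _ _ this, of 1] minus_bc \<open>N = 1\<close> have "P a (a + b) c c" by simp
    from translate[OF _ _ this, of "- 1"] minus_bc \<open>N = 1\<close> d_zero show ?thesis
      by (simp add: algebra_simps)
  next
    case reduce
    with N_bounds show ?thesis
    proof (cases rule: lower_row_reduction)
      case (change_d s)
      then have "P a (b - s * a) c (d - s * c)"
        using less.prems by (intro less.hyps) (auto simp: algebra_simps)
      from translate[OF _ _ this, of s] less.prems show ?thesis by (simp add: algebra_simps)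
    next
      case (change_c s)
      have dvd': "N dvd c - s * N * d" using less.prems(2) by auto
      have "P (a - s * N * b) b (c - s * N * d) d"
        using less.prems dvd' change_c by (intro less.hyps) (auto simp: algebra_simps)
      from lower[OF _ dvd' this, of s] less.prems show ?thesis by (simp add: algebra_simps)
    qed
  qed
qed

section \<open>Polynomials in theta series\<close>

inductive theta_poly :: "nat \<Rightarrow> (complex \<Rightarrow> complex) \<Rightarrow> bool" where
  const: "theta_poly 0 (\<lambda>_. c)"
| mult: "theta_poly m f \<Longrightarrow> r \<in> \<rat> \<Longrightarrow> \<alpha> \<in> \<rat> \<Longrightarrow> \<alpha> > 0 \<Longrightarrow>
    theta_poly (Suc m) (\<lambda>\<tau>. theta r (of_real \<alpha> * \<tau>) * f \<tau>)"
| add: "theta_poly m f \<Longrightarrow> theta_poly m g \<Longrightarrow> theta_poly m (\<lambda>\<tau>. f \<tau> + g \<tau>)"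
| cong: "theta_poly m f \<Longrightarrow> (\<And>\<tau>. \<tau> \<in> upper_half_plane \<Longrightarrow> g \<tau> = f \<tau>) \<Longrightarrow> theta_poly m g"

lemma theta_poly_cmult: "theta_poly m f \<Longrightarrow> theta_poly m (\<lambda>\<tau>. k * f \<tau>)"
proof (induction rule: theta_poly.induct)
  case (mult m f r \<alpha>)
  then show ?case using theta_poly.mult[OF mult.IH mult.hyps(2-4)] by (simp add: mult.left_commute)
next
  case (add m f g)
  then show ?case using theta_poly.add[OF add.IH] by (simp add: ring_distribs)
next
  case (cong m f g)
  then show ?case by (auto intro: theta_poly.cong)
qed (rule theta_poly.const)

lemma theta_poly_sum:
  assumes "finite A" "A \<noteq> {}" "\<And>s. s \<in> A \<Longrightarrow> theta_poly m (f s)"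
  shows "theta_poly m (\<lambda>\<tau>. \<Sum>s\<in>A. f s \<tau>)"
  using assms by (induction rule: finite_ne_induct) (simp_all add: theta_poly.add)

lemma theta_poly_times:
  assumes "theta_poly m f" "theta_poly n g"
  shows "theta_poly (m + n) (\<lambda>\<tau>. f \<tau> * g \<tau>)"
  using assms(1)
proof (induction rule: theta_poly.induct)
  case (const c)
  then show ?case using theta_poly_cmult[OF assms(2)] by simp
next
  case (mult m f r \<alpha>)
  then show ?case using theta_poly.mult[OF mult.IH, of r \<alpha>] by (simp add: mult.assoc)
next
  case (add m f h)
  then show ?case using theta_poly.add[OF add.IH] by (simp add: ring_distribs)
next
  case (cong m f h)
  then show ?case by (intro theta_poly.cong[OF cong.IH]) auto
qed

lemma theta_poly_theta: "r \<in> \<rat> \<Longrightarrow> \<alpha> \<in> \<rat> \<Longrightarrow> \<alpha> > 0 \<Longrightarrow> theta_poly 1 (\<lambda>\<tau>. theta r (of_real \<alpha> * \<tau>))"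
  using theta_poly.mult[OF theta_poly.const[of 1]] by simp

lemma theta_poly_prod:
  assumes "finite A" "\<And>i. i \<in> A \<Longrightarrow> theta_poly m (f i)"
  shows "theta_poly (card A * m) (\<lambda>\<tau>. \<Prod>i\<in>A. f i \<tau>)"
  using assms
proof (induction rule: finite_induct)
  case empty
  then show ?case using theta_poly.const[of 1] by simp
next
  case (insert x A)
  then show ?case using theta_poly_times[of m "f x" "card A * m"] by simp
qed

lemma theta_poly_holomorphic_at_infinity: "theta_poly m f \<Longrightarrow> holomorphic_at_infinity f"
proof (induction rule: theta_poly.induct)
  case (mult m f r \<alpha>)
  have "holomorphic_at_infinity (\<lambda>\<tau>. theta r (of_real \<alpha> * \<tau>))"
    using mult.hyps by (intro twisted_theta_holomorphic_at_infinity) auto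
  then show ?case using mult.IH by (rule holomorphic_at_infinity_mult)
qed (auto intro: holomorphic_at_infinity_const holomorphic_at_infinity_add
    holomorphic_at_infinity_cong)

lemma theta_poly_twisted_theta_mult:
  assumes poly: "theta_poly m f" and r_rational: "r \<in> \<rat>" and \<alpha>_rational_pos: "\<alpha> \<in> \<rat>" "\<alpha> > 0"
    and M_pos: "M > 0" and periodic: "\<And>x y. [x = y] (mod M) \<Longrightarrow> c x = c y"
  shows "theta_poly (Suc m) (\<lambda>\<tau>. twisted_theta c r (of_real \<alpha> * \<tau>) * f \<tau>)"
proof (rule theta_poly.cong)
  let ?r = "\<lambda>s. (of_int s + r) / of_int M" and ?\<alpha> = "(of_int M)\<^sup>2 * \<alpha>"
  show "theta_poly (Suc m) (\<lambda>\<tau>. \<Sum>s\<in>{0..<M}. c s * (theta (?r s) (of_real ?\<alpha> * \<tau>) * f \<tau>))"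
    using M_pos r_rational \<alpha>_rational_pos
    by (intro theta_poly_sum theta_poly_cmult theta_poly.mult poly) auto
  fix \<tau> assume "\<tau> \<in> upper_half_plane"
  then have "Im (of_real \<alpha> * \<tau>) > 0" using \<alpha>_rational_pos by (simp add: upper_half_plane_def)
  from twisted_theta_periodic[of _ M c r, OF this M_pos periodic]
  show "twisted_theta c r (of_real \<alpha> * \<tau>) * f \<tau> =
      (\<Sum>s\<in>{0..<M}. c s * (theta (?r s) (of_real ?\<alpha> * \<tau>) * f \<tau>))"
    by (simp add: sum_distrib_right sum_distrib_left mult_ac)
qed

lemma nome_rational_linear_periodic:
  assumes "r \<in> \<rat>"
  obtains M :: int where "M > 0"
    "\<And>m n. [m = n] (mod M) \<Longrightarrow> nome (of_real (of_int m * r)) = nome (of_real (of_int n * r))"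
proof -
  obtain p Q where r_eq: "Q > 0" "r = of_int p / of_int Q"
    using assms by (cases rule: Rats_cases') auto
  have "nome (of_real (of_int m * r)) = nome (of_real (of_int n * r))"
    if cong: "[m = n] (mod Q)" for m n
  proof -
    obtain k where m_eq: "m = n + Q * k" using cong by (metis cong_iff_lin cong_sym)
    have "of_real (of_int m * r) = of_real (of_int n * r) + complex_of_int (k * p)"
      unfolding m_eq r_eq(2) using r_eq(1) by (simp add: field_simps)
    then show ?thesis by (simp only: nome_add_of_int)
  qed
  then show thesis using that r_eq(1) by blast
qed

lemma nome_rational_square_periodic:
  fixes r x :: real
  assumes "r \<in> \<rat>" "x \<in> \<rat>"
  obtains M :: int where "M > 0"
    "\<And>m n. [m = n] (mod M) \<Longrightarrow>
      nome (of_real (x * (of_int m + r)\<^sup>2 / 2)) = nome (of_real (x * (of_int n + r)\<^sup>2 / 2))"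
proof -
  obtain p Q where r_eq: "Q > 0" "r = of_int p / of_int Q"
    using assms(1) by (cases rule: Rats_cases') auto
  obtain a b where x_eq: "b > 0" "x = of_int a / of_int b"
    using assms(2) by (cases rule: Rats_cases') auto
  define M where "M = 2 * b * Q"
  have "nome (of_real (x * (of_int m + r)\<^sup>2 / 2)) = nome (of_real (x * (of_int n + r)\<^sup>2 / 2))"
    if cong: "[m = n] (mod M)" for m n
  proof -
    obtain k where m_eq: "m = n + M * k" using cong by (metis cong_iff_lin cong_sym)
    have "x * (of_int m + r)\<^sup>2 / 2 =
        x * (of_int n + r)\<^sup>2 / 2 + of_int (a * k * (2 * n * Q + 2 * p + M * k * Q))"
      unfolding m_eq r_eq(2) x_eq(2) M_def using r_eq(1) x_eq(1)
      by (simp add: field_simps power2_eq_square)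
    then show ?thesis
      by (simp only: of_real_add of_real_of_int_eq nome_add_of_int)
  qed
  moreover have "M > 0" using r_eq(1) x_eq(1) by (simp add: M_def)
  ultimately show thesis using that by blast
qed

lemma theta_poly_translate:
  assumes "theta_poly m f"
  shows "theta_poly m (\<lambda>\<tau>. f (\<tau> + of_int j))"
  using assms
proof (induction rule: theta_poly.induct)
  case (mult m f r \<alpha>)
  let ?c = "\<lambda>n. nome (of_real (\<alpha> * of_int j * (of_int n + r)\<^sup>2 / 2))"
  obtain M where period: "M > 0" "\<And>m n. [m = n] (mod M) \<Longrightarrow> ?c m = ?c n"
    using nome_rational_square_periodic[of r "\<alpha> * of_int j"] mult.hyps by auto
  have "theta r (of_real \<alpha> * (\<tau> + of_int j)) = twisted_theta ?c r (of_real \<alpha> * \<tau>)" for \<tau>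
    using twisted_theta_add_of_real[of "\<lambda>_. 1" r "of_real \<alpha> * \<tau>" "\<alpha> * of_int j"]
    by (simp add: ring_distribs)
  then show ?case
    using theta_poly_twisted_theta_mult[OF mult.IH mult.hyps(2-4) period(1), of ?c] period(2)
    by simp
next
  case (cong m f g)
  then show ?case
    by (intro theta_poly.cong[OF cong.IH]) (auto simp: upper_half_plane_def)
qed (auto intro: theta_poly.intros)

lemma theta_inversion_rescaled:
  assumes "\<alpha> > 0" "Im \<tau> > 0"
  shows "theta r (of_real \<alpha> * (- 1 / \<tau>)) = csqrt (- \<i> * \<tau>) *
    (of_real (1 / sqrt \<alpha>) *
        twisted_theta (\<lambda>k. nome (of_real (of_int k * r))) 0 (of_real (1 / \<alpha>) * \<tau>))"
proof -
  define \<sigma> where "\<sigma> = of_real (1 / \<alpha>) * \<tau>"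
  have "Im \<sigma> > 0" "of_real \<alpha> * (- 1 / \<tau>) = - 1 / \<sigma>"
    using assms by (simp_all add: \<sigma>_def)
  moreover have "- \<i> * \<sigma> = of_real (1 / \<alpha>) * (- \<i> * \<tau>)"
    by (simp add: \<sigma>_def)
  then have "csqrt (- \<i> * \<sigma>) = csqrt (- \<i> * \<tau>) * of_real (1 / sqrt \<alpha>)"
    using assms(1) csqrt_of_real_mult[of "1 / \<alpha>" "- \<i> * \<tau>"] by (simp add: real_sqrt_divide)
  ultimately show ?thesis
    using theta_inversion[of \<sigma> r] by (simp add: \<sigma>_def mult_ac)
qed

lemma theta_poly_invert:
  assumes "theta_poly m f"
  shows "theta_poly m (\<lambda>\<tau>. f (- 1 / \<tau>) / csqrt (- \<i> * \<tau>) ^ m)"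
  using assms
proof (induction rule: theta_poly.induct)
  case (mult m f r \<alpha>)
  let ?c = "\<lambda>k. nome (of_real (of_int k * r))" and ?F = "\<lambda>\<tau>. f (- 1 / \<tau>) / csqrt (- \<i> * \<tau>) ^ m"
  obtain M where period: "M > 0" "\<And>m n. [m = n] (mod M) \<Longrightarrow> ?c m = ?c n"
    using nome_rational_linear_periodic[OF mult.hyps(2)] by blast
  have "theta_poly (Suc m) (\<lambda>\<tau>. twisted_theta ?c 0 (of_real (1 / \<alpha>) * \<tau>) * ?F \<tau>)"
    using mult.hyps period(1)
    by (intro theta_poly_twisted_theta_mult[OF mult.IH _ _ _ _ period(2)]) auto
  then have "theta_poly (Suc m) (\<lambda>\<tau>. of_real (1 / sqrt \<alpha>) *
      (twisted_theta ?c 0 (of_real (1 / \<alpha>) * \<tau>) * ?F \<tau>))"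
    by (rule theta_poly_cmult)
  then show ?case
  proof (rule theta_poly.cong)
    fix \<tau> assume "\<tau> \<in> upper_half_plane"
    then have "Im \<tau> > 0" by (simp add: upper_half_plane_def)
    then have "csqrt (- \<i> * \<tau>) \<noteq> 0" by auto
    with theta_inversion_rescaled[OF mult.hyps(4) \<open>Im \<tau> > 0\<close>, of r]
    show "theta r (of_real \<alpha> * (- 1 / \<tau>)) * f (- 1 / \<tau>) / csqrt (- \<i> * \<tau>) ^ Suc m =
        of_real (1 / sqrt \<alpha>) * (twisted_theta ?c 0 (of_real (1 / \<alpha>) * \<tau>) * ?F \<tau>)"
      by simp
  qed
next
  case (add m f g)
  then show ?case using theta_poly.add[OF add.IH] by (simp add: add_divide_distrib)
next
  case (cong m f g)
  show ?case
  proof (rule theta_poly.cong[OF cong.IH])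
    fix \<tau> assume "\<tau> \<in> upper_half_plane"
    then have "- 1 / \<tau> \<in> upper_half_plane" using Im_neg_inverse by (simp add: upper_half_plane_def)
    then show "g (- 1 / \<tau>) / csqrt (- \<i> * \<tau>) ^ m = f (- 1 / \<tau>) / csqrt (- \<i> * \<tau>) ^ m"
      using cong.hyps by simp
  qed
qed (simp add: theta_poly.const)

lemma theta_poly_slash_inversion:
  assumes "theta_poly (2 * w) f"
  shows "theta_poly (2 * w) (slash (int w) 0 (- 1) 1 0 f)"
proof (rule theta_poly.cong[OF theta_poly_cmult[OF theta_poly_invert[OF assms]]])
  fix \<tau> :: complex
  have "csqrt (- \<i> * \<tau>) ^ (2 * w) = (- \<i>) ^ w * \<tau> ^ w"
    by (simp only: power_mult power2_csqrt power_mult_distrib)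
  then show "slash (int w) 0 (- 1) 1 0 f \<tau> = (- \<i>) ^ w * (f (- 1 / \<tau>) / csqrt (- \<i> * \<tau>) ^ (2 * w))"
    by (simp add: slash_def power_int_minus field_simps)
qed

lemma theta_poly_slash_lower:
  assumes "theta_poly (2 * w) f"
  shows "theta_poly (2 * w) (slash (int w) 1 0 j 1 f)"
proof -
  let ?S = "slash (int w) 0 (- 1) 1 0"
  have "theta_poly (2 * w) (\<lambda>\<tau>. (- 1) powi int w * ?S (\<lambda>\<tau>. ?S f (\<tau> + of_int (- j))) \<tau>)"
    by (intro theta_poly_cmult theta_poly_slash_inversion theta_poly_translate assms)
  then show ?thesis
  proof (rule theta_poly.cong)
    fix \<tau> assume "\<tau> \<in> upper_half_plane"
    then have "Im \<tau> > 0" by (simp add: upper_half_plane_def)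
    then have denominator: "of_int 1 * \<tau> + of_int 0 \<noteq> 0" by auto
    have "?S (\<lambda>\<tau>. ?S f (\<tau> + of_int (- j))) \<tau> = ?S (slash (int w) 1 (- j) 0 1 (?S f)) \<tau>"
      by (simp only: slash_translation[abs_def])
    also have "slash (int w) 1 (- j) 0 1 (?S f) = slash (int w) 0 (- 1) 1 (- j) f"
      by (rule ext, subst slash_slash) simp_all
    also have "?S (slash (int w) 0 (- 1) 1 (- j) f) \<tau> = slash (int w) (- 1) (- 0) (- j) (- 1) f \<tau>"
      by (subst slash_slash[OF denominator]) simp
    also have "\<dots> = (- 1) powi int w * slash (int w) 1 0 j 1 f \<tau>"
      by (rule slash_uminus)
    finally show "slash (int w) 1 0 j 1 f \<tau> = (- 1) powi int w * ?S (\<lambda>\<tau>. ?S f (\<tau> + of_int (- j))) \<tau>"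
      by (simp add: mult.assoc[symmetric] power_mult_distrib[symmetric])
  qed
qed

theorem theta_poly_slash:
  assumes poly: "theta_poly (2 * w) f" and det: "a * d - b * c = 1"
  shows "theta_poly (2 * w) (slash (int w) a b c d f)"
  using order_refl one_le_numeral det one_dvd
proof (induction rule: Gamma0_induct)
  case identity
  show ?case by (rule theta_poly.cong[OF poly]) (rule slash_identity)
next
  case (uminus a b c d)
  from theta_poly_cmult[OF uminus(3)] show ?case
    by (rule theta_poly.cong) (rule slash_uminus)
next
  case (translate a b c d j)
  from theta_poly_translate[OF translate(3), of j] show ?case
    by (rule theta_poly.cong)
       (simp add: slash_translation[of "int w", symmetric] slash_slash add_ac mult_ac)
next
  case (lower a b c d j)
  from theta_poly_slash_lower[OF lower(3), of j] show ?case
  proof (rule theta_poly.cong)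
    fix \<tau> assume "\<tau> \<in> upper_half_plane"
    then have "of_int j * \<tau> + of_int 1 \<noteq> 0"
      using moebius_denominator_nonzero[of 1 1 0 j \<tau>] by (simp add: upper_half_plane_def)
    then show "slash (int w) (a + j * 1 * b) b (c + j * 1 * d) d f \<tau> =
        slash (int w) 1 0 j 1 (slash (int w) a b c d f) \<tau>"
      by (simp add: slash_slash mult.commute)
  qed
qed

section \<open>Legendre and Kronecker symbols\<close>

lemma Legendre_values: "Legendre a p \<in> {- 1, 0, 1}"
  by (simp add: Legendre_def)

lemma Legendre_eq_0_iff: "Legendre a p = 0 \<longleftrightarrow> p dvd a"
  by (simp add: Legendre_def cong_0_iff)

lemma Legendre_square: "\<not> p dvd a \<Longrightarrow> Legendre a p * Legendre a p = 1"
  using Legendre_values[of a p] Legendre_eq_0_iff[of a p] by auto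

lemma Legendre_cong:
  assumes "[a = b] (mod p)"
  shows "Legendre a p = Legendre b p"
proof -
  have "[a = 0] (mod p) \<longleftrightarrow> [b = 0] (mod p)" "QuadRes p a \<longleftrightarrow> QuadRes p b"
    unfolding QuadRes_def using assms by (metis cong_sym cong_trans)+
  then show ?thesis by (simp add: Legendre_def)
qed

lemma Legendre_1_left: "p > 2 \<Longrightarrow> Legendre 1 p = 1"
  unfolding Legendre_def QuadRes_def by (auto simp: cong_def intro!: exI[of _ 1])

lemma Legendre_mult:
  fixes p :: int
  assumes "prime p" "p > 2"
  shows "Legendre (a * b) p = Legendre a p * Legendre b p"
proof -
  obtain q where q_prime: "p = int q" "prime q" "q > 2"
    using assms
    by (metis prime_int_nat_transfer nat_0_le prime_ge_0_int zless_nat_eq_int_zless of_nat_numeral)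
  have "[Legendre (a * b) p = (a * b) ^ ((q - 1) div 2)] (mod p)"
    unfolding q_prime by (rule euler_criterion[OF q_prime(2,3)])
  also have "(a * b) ^ ((q - 1) div 2) = a ^ ((q - 1) div 2) * b ^ ((q - 1) div 2)"
    by (simp add: power_mult_distrib)
  also have "[\<dots> = Legendre a p * Legendre b p] (mod p)"
    unfolding q_prime by (intro cong_mult cong_sym[OF euler_criterion[OF q_prime(2,3)]])
  finally have "p dvd Legendre (a * b) p - Legendre a p * Legendre b p"
    by (simp add: cong_iff_dvd_diff)
  moreover have "Legendre a p * Legendre b p \<in> {- 1, 0, 1}"
    using Legendre_values[of a p] Legendre_values[of b p] by auto
  then have "\<bar>Legendre (a * b) p - Legendre a p * Legendre b p\<bar> \<le> 2"
    using Legendre_values[of "a * b" p] by auto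
  ultimately show ?thesis
    using assms(2) zdvd_imp_le[of p "\<bar>Legendre (a * b) p - Legendre a p * Legendre b p\<bar>"] by auto
qed

lemma Legendre_minus_3: "Legendre (- a) 3 = - Legendre a 3"
proof -
  have "\<not> [y\<^sup>2 = - 1] (mod 3)" for y :: int
  proof
    assume "[y\<^sup>2 = - 1] (mod 3)"
    then have "(y mod 3)\<^sup>2 mod 3 = 2" by (simp add: cong_def power_mod)
    moreover have "y mod 3 = 0 \<or> y mod 3 = 1 \<or> y mod 3 = 2" by presburger
    ultimately show False by auto
  qed
  then have "Legendre (- 1) 3 = - 1"
    unfolding Legendre_def QuadRes_def by (auto simp: cong_def)
  then show ?thesis
    using Legendre_mult[of 3 "- 1" a] by simp
qed

lemma Legendre_3_power:
  assumes "\<not> 3 dvd d"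
  shows "Legendre d 3 ^ n = (if even n then 1 else Legendre d 3)"
  using Legendre_square[OF assms] by (auto simp: power_mult power2_eq_square elim!: evenE oddE)

lemma kronecker_eq_prod_mset:
  assumes "n \<noteq> 0"
  shows "kronecker m n =
      (if n < 0 \<and> m < 0 then - 1 else 1) *
      prod_mset (image_mset (kronecker_prime m) (prime_factorization n))"
  using assms by (simp add: kronecker_def image_prod_mset_multiplicity count_prime_factorization)
    (auto intro!: prod.cong simp: count_prime_factorization in_prime_factors_iff)

lemma kronecker_mult_right:
  assumes "a > 0" "b > 0"
  shows "kronecker m (a * b) = kronecker m a * kronecker m b"
  using assms by (auto simp: kronecker_eq_prod_mset prime_factorization_mult mult_less_0_iff)

lemma kronecker_minus_right:
  assumes "n > 0"
  shows "kronecker m (- n) = (if m < 0 then - kronecker m n else kronecker m n)"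
proof -
  have "prime_factorization (- n) = prime_factorization n"
    by (rule prime_factorization_cong) simp
  then show ?thesis using assms by (simp add: kronecker_eq_prod_mset)
qed

lemma kronecker_prime_right:
  assumes "prime p" "p > 2"
  shows "kronecker m p = Legendre m p"
  using assms by (simp add: kronecker_eq_prod_mset prime_factorization_prime kronecker_prime_def)

lemma odd_prime_factor_gt_2:
  fixes n :: int
  assumes "odd n" "p \<in># prime_factorization n"
  shows "prime p" "p > 2"
proof -
  show "prime p" using assms(2) by blast
  have "p \<noteq> 2" using assms by blast
  then show "p > 2" using prime_ge_2_int[OF \<open>prime p\<close>] by simp
qed

lemma kronecker_mult_left:
  assumes "odd n" "n > 0"
  shows "kronecker (a * b) n = kronecker a n * kronecker b n"
proof -
  have "image_mset (kronecker_prime (a * b)) (prime_factorization n) =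
      image_mset (\<lambda>p. kronecker_prime a p * kronecker_prime b p) (prime_factorization n)"
    by (intro image_mset_cong)
       (use odd_prime_factor_gt_2[OF assms(1)] in \<open>auto simp: kronecker_prime_def Legendre_mult\<close>)
  then show ?thesis
    using assms by (simp add: kronecker_eq_prod_mset prod_mset.distrib)
qed

lemma kronecker_1_left:
  assumes "odd n" "n > 0"
  shows "kronecker 1 n = 1"
proof -
  have "image_mset (kronecker_prime 1) (prime_factorization n) =
      image_mset (\<lambda>_. 1) (prime_factorization n)"
    by (intro image_mset_cong)
       (use odd_prime_factor_gt_2(2)[OF assms(1)] in
         \<open>force simp: kronecker_prime_def Legendre_1_left\<close>)
  then show ?thesis
    using assms by (simp add: kronecker_eq_prod_mset)
qed

lemma kronecker_square:
  assumes "odd n" "n > 0" "coprime m n"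
  shows "kronecker m n * kronecker m n = 1"
proof -
  have "kronecker_prime m p * kronecker_prime m p = 1" if "p \<in># prime_factorization n" for p
  proof -
    note p = odd_prime_factor_gt_2[OF assms(1) that]
    have "\<not> p dvd m"
      using assms(3) that p
      by (metis coprime_common_divisor in_prime_factors_imp_dvd not_prime_unit)
    then show ?thesis
      using p Legendre_square by (simp add: kronecker_prime_def)
  qed
  then have "image_mset (\<lambda>p. kronecker_prime m p * kronecker_prime m p) (prime_factorization n) =
      image_mset (\<lambda>_. 1) (prime_factorization n)"
    by (intro image_mset_cong)
  then have "(\<Prod>p\<in>#prime_factorization n. kronecker_prime m p * kronecker_prime m p) = 1"
    by simp
  then show ?thesis
    using assms by (simp add: kronecker_eq_prod_mset prod_mset.distrib)
qed

lemma kronecker_prod_left: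
  assumes "odd n" "n > 0" "finite A"
  shows "kronecker (\<Prod>i\<in>A. f i) n = (\<Prod>i\<in>A. kronecker (f i) n)"
  using assms(3)
  by (induction rule: finite_induct)
     (simp_all add: kronecker_1_left kronecker_mult_left assms(1,2))

lemma kronecker_power_left:
  assumes "odd n" "n > 0"
  shows "kronecker (m ^ j) n = kronecker m n ^ j"
  by (induction j) (simp_all add: kronecker_1_left kronecker_mult_left assms)

lemma kronecker_4_left:
  assumes "odd n" "n > 0"
  shows "kronecker 4 n = 1"
proof -
  have "kronecker (2 * 2) n = 1"
    unfolding kronecker_mult_left[OF assms] using assms by (intro kronecker_square) auto
  then show ?thesis by simp
qed

section \<open>Quadratic Gauss sums\<close>

lemma nome_cong:
  assumes "[a = b] (mod D)"
  shows "nome (of_int a / of_int D) = nome (of_int b / of_int D)"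
proof (cases "D = 0")
  case False
  obtain k where "a = b + D * k"
    using assms by (metis cong_iff_lin cong_sym)
  then have "of_int a / of_int D = of_int b / of_int D + complex_of_int k"
    using False by (simp add: field_simps)
  then show ?thesis by simp
qed simp

lemma sum_residues_affine:
  fixes f :: "int \<Rightarrow> 'a::comm_monoid_add"
  assumes D_pos: "D > 0" and periodic: "\<And>x y. [x = y] (mod D) \<Longrightarrow> f x = f y"
    and coprime: "coprime a D"
  shows "(\<Sum>x\<in>{0..<D}. f (a * x + b)) = (\<Sum>x\<in>{0..<D}. f x)"
proof -
  let ?g = "\<lambda>x. (a * x + b) mod D"
  have "inj_on ?g {0..<D}"
  proof (rule inj_onI)
    fix x y assume residues: "x \<in> {0..<D}" "y \<in> {0..<D}" "?g x = ?g y"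
    then have "[a * x = a * y] (mod D)" by (simp add: cong_def[symmetric] cong_add_rcancel)
    then have "[x = y] (mod D)" using coprime by (simp add: cong_mult_lcancel)
    then show "x = y" using residues by (simp add: cong_def)
  qed
  moreover have "?g ` {0..<D} \<subseteq> {0..<D}" using D_pos by auto
  ultimately have "bij_betw ?g {0..<D} {0..<D}"
    by (metis bij_betw_def endo_inj_surj finite_atLeastLessThan_int)
  then have "(\<Sum>x\<in>{0..<D}. f x) = (\<Sum>x\<in>{0..<D}. f (?g x))"
    by (rule sum.reindex_bij_betw[symmetric])
  also have "\<dots> = (\<Sum>x\<in>{0..<D}. f (a * x + b))"
    by (intro sum.cong refl periodic) (simp add: cong_def)
  finally show ?thesis ..
qed

lemma sum_nome_residues:
  assumes D_pos: "D > 0"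
  shows "(\<Sum>y\<in>{0..<D}. nome (of_int (c * y) / of_int D)) = (if D dvd c then of_int D else 0)"
proof (cases "D dvd c")
  case True
  then have "nome (of_int (c * y) / of_int D) = 1" for y
    using nome_cong[of "c * y" 0 D] by (simp add: cong_0_iff)
  then show ?thesis using True D_pos by simp
next
  case False
  let ?f = "\<lambda>y. nome (of_int (c * y) / of_int D)"
  have "sum ?f {0..<D} = (\<Sum>y\<in>{0..<D}. ?f (1 * y + 1))"
    by (rule sum_residues_affine[symmetric, where f = ?f])
       (use D_pos in \<open>auto intro!: nome_cong cong_mult simp del: of_int_mult\<close>)
  also have "\<dots> = nome (of_int c / of_int D) * sum ?f {0..<D}"
    unfolding sum_distrib_left nome_add[symmetric]
    by (intro sum.cong refl arg_cong[of _ _ nome]) (simp add: field_simps)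
  finally have "(1 - nome (of_int c / of_int D)) * sum ?f {0..<D} = 0"
    by (simp add: algebra_simps)
  moreover have "nome (of_int c / of_int D) \<noteq> 1"
  proof
    assume "nome (of_int c / of_int D) = 1"
    then have "of_int c / of_int D \<in> (\<int> :: real set)"
      using nome_eq_1_iff[of "of_int c / of_int D"] by simp
    then obtain n where "of_int c / of_int D = (of_int n :: real)" by (elim Ints_cases)
    then have "of_int c = (of_int (n * D) :: real)" using D_pos by (simp add: field_simps)
    then have "c = n * D" by (simp only: of_int_eq_iff)
    with False show False by simp
  qed
  ultimately show ?thesis using False by simp
qed

definition gauss_sum :: "int \<Rightarrow> int \<Rightarrow> complex" where
  "gauss_sum b D = (\<Sum>x\<in>{0..<D}. nome (of_int (b * x\<^sup>2) / of_int D))"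

lemma gauss_sum_mult_gauss_sum_minus:
  assumes D_pos_odd: "D > 0" "odd D" and coprime: "coprime b D"
  shows "gauss_sum b D * gauss_sum (- b) D = of_int D"
proof -
  have "gauss_sum b D * gauss_sum (- b) D =
      (\<Sum>y\<in>{0..<D}. \<Sum>x\<in>{0..<D}. nome (of_int (b * x\<^sup>2 - b * y\<^sup>2) / of_int D))"
    unfolding gauss_sum_def sum_product
    by (subst sum.swap) (intro sum.cong refl, simp add: nome_add[symmetric] diff_divide_distrib)
  also have "\<dots> = (\<Sum>y\<in>{0..<D}. \<Sum>x\<in>{0..<D}. nome (of_int (b * (1 * x + y)\<^sup>2 - b * y\<^sup>2) / of_int D))"
    by (intro sum.cong refl nome_cong cong_diff cong_mult cong_pow sum_residues_affine[symmetric,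
          where f = "\<lambda>x. nome (of_int (b * x\<^sup>2 - b * y\<^sup>2) / of_int D)" for y])
       (use D_pos_odd in auto)
  also have "\<dots> = (\<Sum>x\<in>{0..<D}. \<Sum>y\<in>{0..<D}. nome (of_int (b * x\<^sup>2) / of_int D) *
      nome (of_int ((2 * b * x) * y) / of_int D))"
    by (subst sum.swap, intro sum.cong refl, subst nome_add[symmetric], rule arg_cong[of _ _ nome])
       (simp add: add_divide_distrib[symmetric] power2_eq_square algebra_simps)
  also have "\<dots> = (\<Sum>x\<in>{0..<D}. nome (of_int (b * x\<^sup>2) / of_int D) *
      (if D dvd 2 * b * x then of_int D else 0))"
    unfolding sum_distrib_left[symmetric] sum_nome_residues[OF D_pos_odd(1)] ..
  also have "\<dots> = (\<Sum>x\<in>{0..<D}. if x = 0 then of_int D else 0)"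
  proof (intro sum.cong refl)
    fix x assume x_range: "x \<in> {0..<D}"
    have "coprime D (2 * b)" using D_pos_odd coprime by (simp add: coprime_commute)
    then have "D dvd 2 * b * x \<longleftrightarrow> D dvd x" by (simp add: coprime_dvd_mult_right_iff)
    also have "\<dots> \<longleftrightarrow> x = 0" using x_range zdvd_imp_le[of D x] by (cases "x = 0") auto
    finally show "nome (of_int (b * x\<^sup>2) / of_int D) * (if D dvd 2 * b * x then of_int D else 0) =
        (if x = 0 then of_int D else 0)"
      by auto
  qed
  also have "\<dots> = of_int D" using D_pos_odd by simp
  finally show ?thesis .
qed

lemma bij_betw_mixed_radix:
  fixes m n :: int
  assumes "m > 0" "n > 0"
  shows "bij_betw (\<lambda>(x, y). x + m * y) ({0..<m} \<times> {0..<n}) {0..<m * n}" (is "bij_betw ?f ?A ?B")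
proof -
  have "inj_on ?f ?A"
  proof (rule inj_onI, clarify)
    fix x y x' y' assume residues: "x \<in> {0..<m}" "x' \<in> {0..<m}" "x + m * y = x' + m * y'"
    then have "(x + m * y) mod m = (x' + m * y') mod m" by simp
    then have "x = x'" using residues(1,2) by simp
    then show "x = x' \<and> y = y'" using residues(3) assms(1) by simp
  qed
  moreover have "?f ` ?A \<subseteq> ?B"
  proof (rule image_subsetI, clarify)
    fix x y assume residues: "x \<in> {0..<m}" "y \<in> {0..<n}"
    have "x + m * y < m * (y + 1)" using residues by (simp add: algebra_simps)
    also have "\<dots> \<le> m * n" using residues assms by (intro mult_left_mono) auto
    finally show "x + m * y \<in> ?B" using residues assms by simp
  qed
  moreover have "card ?A = card ?B"
    using assms by (simp add: card_cartesian_product nat_mult_distrib)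
  ultimately show ?thesis
    by (simp add: bij_betw_def card_image card_subset_eq)
qed

lemma bij_betw_chinese_remainder:
  fixes m n :: int
  assumes "m > 0" "n > 0" "coprime m n"
  shows "bij_betw (\<lambda>(y, z). (m * y + n * z) mod (m * n)) ({0..<n} \<times> {0..<m}) {0..<m * n}"
    (is "bij_betw ?f ?A ?B")
proof -
  have "inj_on ?f ?A"
  proof (rule inj_onI, clarify)
    fix y z y' z'
    assume residues: "y \<in> {0..<n}" "z \<in> {0..<m}" "y' \<in> {0..<n}" "z' \<in> {0..<m}"
      and "(m * y + n * z) mod (m * n) = (m * y' + n * z') mod (m * n)"
    then have cong: "[m * y + n * z = m * y' + n * z'] (mod m * n)" by (simp add: cong_def)
    have "[m * y + n * z = m * y' + n * z'] (mod n)"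
      using cong by (metis cong_modulus_mult mult.commute)
    then have "[m * y = m * y'] (mod n)" by (simp add: cong_def)
    then have "[y = y'] (mod n)" using assms(3) by (simp add: cong_mult_lcancel)
    moreover have "[m * y + n * z = m * y' + n * z'] (mod m)"
      using cong by (metis cong_modulus_mult)
    then have "[n * z = n * z'] (mod m)" by (simp add: cong_def)
    then have "[z = z'] (mod m)" using assms(3) by (simp add: cong_mult_lcancel coprime_commute)
    ultimately show "y = y' \<and> z = z'" using residues by (simp add: cong_def)
  qed
  moreover have "?f ` ?A \<subseteq> ?B" using assms by auto
  moreover have "card ?A = card ?B"
    using assms by (simp add: card_cartesian_product nat_mult_distrib mult.commute)
  ultimately show ?thesis
    by (simp add: bij_betw_def card_image card_subset_eq)
qed

lemma gauss_sum_mult_coprime: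
  assumes m_pos: "m > 0" and n_pos: "n > 0" and "coprime m n"
  shows "gauss_sum b (m * n) = gauss_sum (b * m) n * gauss_sum (b * n) m"
proof -
  have split: "nome (of_int (b * ((m * y + n * z) mod (m * n))\<^sup>2) / of_int (m * n)) =
      nome (of_int (b * m * y\<^sup>2) / of_int n) * nome (of_int (b * n * z\<^sup>2) / of_int m)" for y z
  proof -
    have "nome (of_int (b * ((m * y + n * z) mod (m * n))\<^sup>2) / of_int (m * n)) =
        nome (of_int (b * (m * y + n * z)\<^sup>2) / of_int (m * n))"
      by (intro nome_cong cong_mult cong_pow) auto
    also have "of_int (b * (m * y + n * z)\<^sup>2) / of_int (m * n) =
        of_int (b * m * y\<^sup>2) / of_int n + of_int (b * n * z\<^sup>2) / of_int m +
            complex_of_int (2 * b * y * z)"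
      using m_pos n_pos by (simp add: field_simps power2_eq_square)
    finally show ?thesis
      by (simp only: nome_add nome_of_int mult_1_right)
  qed
  have "gauss_sum b (m * n) =
      (\<Sum>(y, z)\<in>{0..<n} \<times> {0..<m}. nome (of_int (b * ((m * y + n * z) mod (m * n))\<^sup>2) /
          of_int (m * n)))"
    unfolding gauss_sum_def sum.reindex_bij_betw[OF bij_betw_chinese_remainder[OF assms], symmetric]
    by (simp add: case_prod_unfold)
  then show ?thesis
    by (simp only: split gauss_sum_def sum_product sum.cartesian_product)
qed

lemma gauss_sum_mult_square:
  assumes D_pos: "D > 0" and p_odd: "p > 0" "odd p" "coprime b p"
  shows "gauss_sum b (p\<^sup>2 * D) = of_int p * gauss_sum b D"
proof -
  define M where "M = p * D"
  have M_eq: "M > 0" "p\<^sup>2 * D = M * p" using D_pos p_odd by (simp_all add: M_def power2_eq_square)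
  define f where "f = (\<lambda>x. nome (of_int (b * x\<^sup>2) / of_int (M * p)))"
  have shift: "f (x + M * y) = f x * nome (of_int ((2 * b * x) * y) / of_int p)" for x y
  proof -
    have "of_int (b * (x + M * y)\<^sup>2) / of_int (M * p) =
        of_int (b * x\<^sup>2) / of_int (M * p) + of_int ((2 * b * x) * y) / of_int p +
            complex_of_int (b * D * y\<^sup>2)"
      using D_pos p_odd by (simp add: M_def field_simps power2_eq_square)
    then show ?thesis
      by (simp only: f_def nome_add nome_of_int mult_1_right)
  qed
  have "coprime p (2 * b)" using p_odd by (simp add: coprime_commute)
  then have dvd_iff: "p dvd 2 * b * x \<longleftrightarrow> p dvd x" for x by (simp add: coprime_dvd_mult_right_iff)
  have "gauss_sum b (p\<^sup>2 * D) = (\<Sum>(x, y)\<in>{0..<M} \<times> {0..<p}. f (x + M * y))"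
    unfolding gauss_sum_def M_eq(2)
        sum.reindex_bij_betw[OF bij_betw_mixed_radix[OF M_eq(1) p_odd(1)], symmetric]
    by (simp add: f_def case_prod_unfold)
  also have "\<dots> = (\<Sum>x\<in>{0..<M}. f x * (if p dvd x then of_int p else 0))"
    unfolding sum.cartesian_product[symmetric] shift sum_distrib_left[symmetric]
        sum_nome_residues[OF p_odd(1)] dvd_iff ..
  also have "\<dots> = (\<Sum>x\<in>{0..<M}. if p dvd x then of_int p * f x else 0)"
    by (intro sum.cong) auto
  also have "\<dots> = (\<Sum>x\<in>{x\<in>{0..<M}. p dvd x}. of_int p * f x)"
    by (simp only: sum.inter_filter[OF finite_atLeastLessThan_int])
  also have "\<dots> = (\<Sum>z\<in>{0..<D}. of_int p * f (p * z))"
    by (rule sum.reindex_bij_witness[of _ "\<lambda>z. p * z" "\<lambda>x. x div p"])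
       (use p_odd D_pos in \<open>auto simp: M_def zero_le_mult_iff elim!: dvdE\<close>)
  also have "\<dots> = (\<Sum>z\<in>{0..<D}. of_int p * nome (of_int (b * z\<^sup>2) / of_int D))"
    unfolding f_def M_def using p_odd D_pos
    by (intro sum.cong refl arg_cong[of _ _ "\<lambda>x. of_int p * nome x"])
       (simp add: field_simps power2_eq_square)
  finally show ?thesis
    by (simp only: gauss_sum_def sum_distrib_left)
qed

lemma square_roots_mod_prime:
  fixes p y :: int
  assumes prime: "prime p"
  shows "{x\<in>{0..<p}. [x\<^sup>2 = y\<^sup>2] (mod p)} = {y mod p, (- y) mod p}"
proof -
  have p_pos: "p > 0" using prime by (rule prime_gt_0_int)
  have square_cong_iff: "[x\<^sup>2 = y\<^sup>2] (mod p) \<longleftrightarrow> x mod p = y mod p \<or> x mod p = (- y) mod p" for x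
  proof -
    have "[x\<^sup>2 = y\<^sup>2] (mod p) \<longleftrightarrow> p dvd (x - y) * (x - (- y))"
      by (simp add: cong_iff_dvd_diff power2_eq_square algebra_simps)
    also have "\<dots> \<longleftrightarrow> p dvd x - y \<or> p dvd x - (- y)"
      by (rule prime_dvd_mult_iff[OF prime])
    finally show ?thesis by (simp only: mod_eq_dvd_iff)
  qed
  show ?thesis
  proof (intro equalityI subsetI)
    fix x assume "x \<in> {y mod p, (- y) mod p}"
    then have "x \<in> {0..<p}" "x mod p = y mod p \<or> x mod p = (- y) mod p"
      using p_pos by auto
    then show "x \<in> {x\<in>{0..<p}. [x\<^sup>2 = y\<^sup>2] (mod p)}" by (simp add: square_cong_iff)
  qed (use square_cong_iff in auto)
qed

lemma card_square_roots_mod_prime: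
  fixes p r :: int
  assumes prime: "prime p" "p > 2" and r_range: "r \<in> {0..<p}"
  shows "int (card {x\<in>{0..<p}. x\<^sup>2 mod p = r}) = 1 + Legendre r p"
proof (cases "QuadRes p r")
  case False
  then have "{x\<in>{0..<p}. x\<^sup>2 mod p = r} = {}"
    using r_range by (auto simp: QuadRes_def cong_def)
  moreover have "r \<noteq> 0" using False unfolding QuadRes_def by (metis cong_refl zero_power2)
  then have "Legendre r p = - 1" using False r_range by (simp add: Legendre_def cong_def)
  ultimately show ?thesis by (metis add.right_inverse card.empty of_nat_0)
next
  case True
  then obtain y where root: "[y\<^sup>2 = r] (mod p)" by (auto simp: QuadRes_def)
  then have roots: "{x\<in>{0..<p}. x\<^sup>2 mod p = r} = {y mod p, (- y) mod p}"
    using square_roots_mod_prime[OF prime(1), of y] r_range by (simp add: cong_def)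
  have "y mod p = (- y) mod p \<longleftrightarrow> p dvd 2 * y"
    by (simp add: mod_eq_dvd_iff)
  also have "\<dots> \<longleftrightarrow> p dvd y"
    using prime by (auto simp: prime_dvd_mult_iff dest: zdvd_imp_le)
  also have "\<dots> \<longleftrightarrow> p dvd y\<^sup>2"
    using prime by (simp add: prime_dvd_power_iff)
  also have "\<dots> \<longleftrightarrow> [r = 0] (mod p)"
    using root by (metis cong_0_iff cong_sym cong_trans)
  finally show ?thesis
    unfolding roots using True by (auto simp: Legendre_def)
qed

lemma gauss_sum_prime_eq_Legendre_sum:
  assumes prime: "prime p" "p > 2" and not_dvd: "\<not> p dvd b"
  shows "gauss_sum b p = (\<Sum>r\<in>{0..<p}. of_int (Legendre r p) * nome (of_int (b * r) / of_int p))"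
proof -
  have p_pos: "p > 0" using prime by simp
  have "gauss_sum b p = (\<Sum>x\<in>{0..<p}. nome (of_int (b * (x\<^sup>2 mod p)) / of_int p))"
    unfolding gauss_sum_def by (intro sum.cong refl nome_cong cong_mult) (auto simp: cong_def)
  also have "\<dots> = (\<Sum>r\<in>{0..<p}. \<Sum>x\<in>{x\<in>{0..<p}. x\<^sup>2 mod p = r}.
      nome (of_int (b * (x\<^sup>2 mod p)) / of_int p))"
    by (rule sum.group[symmetric]) (use p_pos in auto)
  also have "\<dots> = (\<Sum>r\<in>{0..<p}. of_int (int (card {x\<in>{0..<p}. x\<^sup>2 mod p = r})) *
      nome (of_int (b * r) / of_int p))"
    by (intro sum.cong refl) simp
  also have "\<dots> = (\<Sum>r\<in>{0..<p}. nome (of_int (b * r) / of_int p) +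
      of_int (Legendre r p) * nome (of_int (b * r) / of_int p))"
    by (intro sum.cong refl)
       (subst card_square_roots_mod_prime[OF prime], simp_all add: ring_distribs)
  also have "\<dots> = (\<Sum>r\<in>{0..<p}. of_int (Legendre r p) * nome (of_int (b * r) / of_int p))"
    unfolding sum.distrib sum_nome_residues[OF p_pos] using not_dvd by simp
  finally show ?thesis .
qed

lemma gauss_sum_prime:
  assumes prime: "prime p" "p > 2" and coprime: "coprime b p"
  shows "gauss_sum b p = of_int (Legendre b p) * gauss_sum 1 p"
proof -
  let ?f = "\<lambda>r. of_int (Legendre r p) * nome (of_int r / of_int p)"
  have p_pos: "p > 0" using prime by simp
  have not_dvd: "\<not> p dvd b" "\<not> p dvd 1"
    using prime coprime
    by (auto simp: coprime_absorb_right not_prime_unit dest: coprime_common_divisor)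
  have "of_int (Legendre b p) * gauss_sum b p = (\<Sum>r\<in>{0..<p}. ?f (b * r + 0))"
    unfolding gauss_sum_prime_eq_Legendre_sum[OF prime not_dvd(1)] sum_distrib_left
    by (simp add: Legendre_mult[OF prime] mult_ac)
  also have "\<dots> = (\<Sum>r\<in>{0..<p}. ?f r)"
    by (rule sum_residues_affine[OF p_pos _ coprime, where f = ?f])
       (auto intro!: arg_cong2[of _ _ _ _ "(*)"] nome_cong Legendre_cong)
  also have "\<dots> = gauss_sum 1 p"
    using gauss_sum_prime_eq_Legendre_sum[OF prime not_dvd(2)] by simp
  finally have "of_int (Legendre b p * Legendre b p) * gauss_sum b p =
      of_int (Legendre b p) * gauss_sum 1 p"
    by simp
  then show ?thesis by (simp add: Legendre_square[OF not_dvd(1)])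
qed

lemma gauss_sum_eq_kronecker_mult_coprime:
  assumes m_pos_odd: "m > 0" "odd m" and n_pos_odd: "n > 0" "odd n"
    and coprime: "coprime m n" "coprime b (m * n)"
    and gauss_m: "\<And>b. coprime b m \<Longrightarrow> gauss_sum b m = of_int (kronecker b m) * gauss_sum 1 m"
    and gauss_n: "\<And>b. coprime b n \<Longrightarrow> gauss_sum b n = of_int (kronecker b n) * gauss_sum 1 n"
  shows "gauss_sum b (m * n) = of_int (kronecker b (m * n)) * gauss_sum 1 (m * n)"
proof -
  have "gauss_sum (b * m) n = of_int (kronecker b n) * gauss_sum m n"
    using gauss_n[of "b * m"] gauss_n[of m] coprime n_pos_odd by (simp add: kronecker_mult_left)
  moreover have "gauss_sum (b * n) m = of_int (kronecker b m) * gauss_sum n m"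
    using gauss_m[of "b * n"] gauss_m[of n] coprime m_pos_odd
    by (simp add: kronecker_mult_left coprime_commute)
  ultimately show ?thesis
    using m_pos_odd n_pos_odd coprime(1) by (simp add: gauss_sum_mult_coprime kronecker_mult_right)
qed

lemma gauss_sum_eq_kronecker_mult_square:
  assumes p_pos_odd: "p > 0" "odd p" and n_pos: "n > 0" and coprime: "coprime b p"
    and gauss_n: "gauss_sum b n = of_int (kronecker b n) * gauss_sum 1 n"
  shows "gauss_sum b (p\<^sup>2 * n) = of_int (kronecker b (p\<^sup>2 * n)) * gauss_sum 1 (p\<^sup>2 * n)"
proof -
  have "kronecker b (p\<^sup>2 * n) = kronecker b p * kronecker b p * kronecker b n"
    using p_pos_odd(1) n_pos by (simp add: power2_eq_square kronecker_mult_right)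
  also have "\<dots> = kronecker b n"
    using kronecker_square[OF p_pos_odd(2,1) coprime] by simp
  finally show ?thesis
    using p_pos_odd n_pos coprime gauss_n by (simp add: gauss_sum_mult_square)
qed

theorem gauss_sum_eq_kronecker:
  assumes "odd D" "D > 0" "coprime b D"
  shows "gauss_sum b D = of_int (kronecker b D) * gauss_sum 1 D"
  using assms
proof (induction "nat D" arbitrary: D b rule: less_induct)
  case less
  show ?case
  proof (cases "D = 1")
    case False
    with less.prems obtain p where prime: "prime p" "p dvd D"
      using prime_divisor_exists[of D] by auto
    then have "odd p" using less.prems(1) by (metis dvd_trans)
    with prime have "p > 2" using prime_ge_2_int[of p] by (cases "p = 2") auto
    obtain E where D_eq: "D = p * E" using prime(2) by (elim dvdE)
    have E_props: "E > 0" "odd E" "coprime b E" "coprime b p"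
      using less.prems D_eq \<open>p > 2\<close> by (auto simp: zero_less_mult_iff)
    have "E < D" unfolding D_eq using \<open>p > 2\<close> E_props by simp
    show ?thesis
    proof (cases "p dvd E")
      case True
      then obtain F where "E = p * F" by (elim dvdE)
      then have "D = p\<^sup>2 * F" "F > 0" "odd F" "coprime b F" "F < E"
        using D_eq E_props \<open>p > 2\<close> by (auto simp: power2_eq_square zero_less_mult_iff)
      then show ?thesis
        using gauss_sum_eq_kronecker_mult_square[OF _ \<open>odd p\<close> _ E_props(4), of F] less.hyps[of F b]
            \<open>p > 2\<close> \<open>E < D\<close>
        by auto
    next
      case False
      then have "coprime p E" using prime(1) by (simp add: prime_imp_coprime)
      show ?thesis
        unfolding D_eq
      proof (rule gauss_sum_eq_kronecker_mult_coprime[OF _ \<open>odd p\<close> E_props(1,2) \<open>coprime p E\<close>])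
        show "gauss_sum c p = of_int (kronecker c p) * gauss_sum 1 p" if "coprime c p" for c
          using gauss_sum_prime[OF prime(1) \<open>p > 2\<close> that]
          by (simp add: kronecker_prime_right[OF prime(1) \<open>p > 2\<close>])
        show "gauss_sum c E = of_int (kronecker c E) * gauss_sum 1 E" if "coprime c E" for c
          using less.hyps[of E c] \<open>E < D\<close> E_props that by auto
      qed (use \<open>p > 2\<close> less.prems D_eq in auto)
    qed
  qed (simp add: kronecker_def gauss_sum_def del: of_int_mult of_int_power)
qed

lemma gauss_sum_1_square:
  assumes "odd D" "D > 0"
  shows "(gauss_sum 1 D)\<^sup>2 = of_int (kronecker (- 1) D * D)"
proof -
  have "gauss_sum 1 D * (of_int (kronecker (- 1) D) * gauss_sum 1 D) = of_int D"
    using gauss_sum_mult_gauss_sum_minus[of D 1] gauss_sum_eq_kronecker[of D "- 1"] assms by simp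
  then have "of_int (kronecker (- 1) D * kronecker (- 1) D) * (gauss_sum 1 D)\<^sup>2 =
      of_int (kronecker (- 1) D * D)"
    by (simp add: power2_eq_square mult_ac)
  then show ?thesis
    using kronecker_square[of D "- 1"] assms by simp
qed

lemma prod_gauss_sum_even_card:
  assumes D_odd_pos: "odd D" "D > 0" and card_A: "finite A" "card A = 2 * m"
    and coprime_b: "coprime b D" and coprime_c: "\<And>j. j \<in> A \<Longrightarrow> coprime (c j) D"
  shows "(\<Prod>j\<in>A. gauss_sum (b * c j) D) =
      of_int (kronecker ((- 1) ^ m * (\<Prod>j\<in>A. c j)) D) * of_int D ^ m"
proof -
  define G where "G = of_int (kronecker b D) * gauss_sum 1 D"
  have "G\<^sup>2 = of_int (kronecker b D * kronecker b D) * (gauss_sum 1 D)\<^sup>2"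
    by (simp add: G_def power2_eq_square)
  then have G_square: "G\<^sup>2 = of_int (kronecker (- 1) D * D)"
    by (simp only: kronecker_square[OF D_odd_pos coprime_b] gauss_sum_1_square[OF D_odd_pos]) simp
  have "(\<Prod>j\<in>A. gauss_sum (b * c j) D) = (\<Prod>j\<in>A. of_int (kronecker (c j) D) * G)"
  proof (rule prod.cong[OF refl])
    fix j assume "j \<in> A"
    then have "coprime (b * c j) D" using coprime_b coprime_c by simp
    from gauss_sum_eq_kronecker[OF D_odd_pos this]
    show "gauss_sum (b * c j) D = of_int (kronecker (c j) D) * G"
      by (simp add: G_def kronecker_mult_left[OF D_odd_pos])
  qed
  also have "\<dots> = of_int (\<Prod>j\<in>A. kronecker (c j) D) * (G\<^sup>2) ^ m"
    by (simp add: prod.distrib card_A(2) power_mult)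
  also have "\<dots> = of_int (kronecker ((- 1) ^ m * (\<Prod>j\<in>A. c j)) D) * of_int D ^ m"
    unfolding G_square kronecker_mult_left[OF D_odd_pos] kronecker_power_left[OF D_odd_pos]
        kronecker_prod_left[OF D_odd_pos card_A(1)]
    by (simp add: power_mult_distrib)
  finally show ?thesis .
qed

section \<open>The binary form \<open>m\<^sup>2 + mn + n\<^sup>2\<close>\<close>

lemma has_sum_product:
  fixes f :: "'a \<Rightarrow> complex" and g :: "'b \<Rightarrow> complex"
  assumes f_summable: "(\<lambda>x. norm (f x)) summable_on A"
    and g_summable: "(\<lambda>y. norm (g y)) summable_on B"
  shows "((\<lambda>(x, y). f x * g y) has_sum (infsum f A * infsum g B)) (A \<times> B)"
proof (rule has_sum_SigmaI)
  show "((\<lambda>y. case (x, y) of (x, y) \<Rightarrow> f x * g y) has_sum f x * infsum g B) B" for x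
    using abs_summable_summable[OF g_summable] by (simp add: has_sum_cmult_right)
  show "((\<lambda>x. f x * infsum g B) has_sum infsum f A * infsum g B) A"
    using abs_summable_summable[OF f_summable] by (intro has_sum_cmult_left) simp
  have "(\<lambda>x. norm (f x) * infsum (\<lambda>y. norm (g y)) B) summable_on A"
    using f_summable by (rule summable_on_cmult_left)
  moreover have "infsum (\<lambda>y. norm (g y)) B \<ge> 0" by (rule infsum_nonneg) auto
  ultimately have "(\<lambda>z. norm (case z of (x, y) \<Rightarrow> f x * g y)) summable_on A \<times> B"
    using g_summable by (subst Infinite_Sum.abs_summable_on_Sigma_iff)
      (simp add: norm_mult infsum_cmult_right' summable_on_cmult_right)
  then show "(\<lambda>(x, y). f x * g y) summable_on A \<times> B"
    by (rule abs_summable_summable)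
qed

lemma nome_powi: "nome \<tau> powi n = nome (of_int n * \<tau>)"
  by (cases n rule: int_cases2) (simp_all add: nome_of_nat_mult nome_minus power_int_minus)

lemma has_sum_theta_times_theta:
  assumes "Im \<tau> > 0"
  shows "((\<lambda>(x, y). nome (((of_int x + of_real r)\<^sup>2 + 3 * (of_int y + of_real r)\<^sup>2) * \<tau>)) has_sum
    theta r (2 * \<tau>) * theta r (6 * \<tau>)) (UNIV :: (int \<times> int) set)"
proof -
  have "((\<lambda>(x, y). (1 * nome ((of_int x + of_real r)\<^sup>2 / 2 * (2 * \<tau>))) *
      (1 * nome ((of_int y + of_real r)\<^sup>2 / 2 * (6 * \<tau>))))
      has_sum theta r (2 * \<tau>) * theta r (6 * \<tau>)) (UNIV \<times> UNIV)"
    unfolding twisted_theta_def using assms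
    by (intro has_sum_product twisted_theta_abs_summable) auto
  moreover have "(1 * nome ((of_int x + of_real r)\<^sup>2 / 2 * (2 * \<tau>))) *
      (1 * nome ((of_int y + of_real r)\<^sup>2 / 2 * (6 * \<tau>))) =
      nome (((of_int x + of_real r)\<^sup>2 + 3 * (of_int y + of_real r)\<^sup>2) * \<tau>)" for x y :: int
    by (simp add: nome_add[symmetric] algebra_simps)
  ultimately show ?thesis by simp
qed

text \<open>With \<open>m = x - y\<close> and \<open>n = 2y + e\<close> the form becomes \<open>(x + e/2)\<^sup>2 + 3(y + e/2)\<^sup>2\<close>.\<close>

lemma F_theta_eq_theta:
  assumes Im_pos: "Im \<tau> > 0"
  shows "F_theta \<tau> = theta 0 (2 * \<tau>) * theta 0 (6 * \<tau>) + theta (1/2) (2 * \<tau>) * theta (1/2) (6 * \<tau>)"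
proof -
  let ?F = "\<lambda>(m, n). nome \<tau> powi (m\<^sup>2 + m * n + n\<^sup>2)"
  define coset where "coset = (\<lambda>e :: int. range (\<lambda>(x, y). (x - y, 2 * y + e)))"
  have coset: "(?F has_sum (theta (of_int e / 2) (2 * \<tau>) * theta (of_int e / 2) (6 * \<tau>))) (coset e)"
    for e
  proof -
    have "inj (\<lambda>(x, y). (x - y, 2 * y + e))" by (auto simp: inj_def)
    moreover have "of_int ((x - y)\<^sup>2 + (x - y) * (2 * y + e) + (2 * y + e)\<^sup>2) =
        (of_int x + of_real (of_int e / 2))\<^sup>2 + 3 * (of_int y + complex_of_real (of_int e / 2))\<^sup>2"
      for x y
      by (simp add: power2_eq_square field_simps)
    then have "?F \<circ> (\<lambda>(x, y). (x - y, 2 * y + e)) =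
        (\<lambda>(x, y). nome (((of_int x + of_real (of_int e / 2))\<^sup>2 +
            3 * (of_int y + of_real (of_int e / 2))\<^sup>2) * \<tau>))"
      by (simp add: fun_eq_iff nome_powi del: of_int_add of_int_power of_int_mult of_int_diff)
    ultimately show ?thesis
      using has_sum_theta_times_theta[OF Im_pos, of "of_int e / 2"]
      by (simp add: coset_def has_sum_reindex)
  qed
  have "coset 0 \<inter> coset 1 = {}"
    by (auto simp: coset_def) presburger
  then have "(?F has_sum (theta (of_int 0 / 2) (2 * \<tau>) * theta (of_int 0 / 2) (6 * \<tau>) +
      theta (of_int 1 / 2) (2 * \<tau>) * theta (of_int 1 / 2) (6 * \<tau>))) (coset 0 \<union> coset 1)"
    by (intro has_sum_Un_disjoint coset)
  moreover have "(m, n) \<in> coset 0 \<union> coset 1" for m n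
  proof -
    have "(m, n) \<in> coset (n mod 2)"
      unfolding coset_def by (rule image_eqI[of _ _ "(m + n div 2, n div 2)"]) auto
    moreover have "n mod 2 = 0 \<or> n mod 2 = 1" by presburger
    ultimately show ?thesis by auto
  qed
  then have "coset 0 \<union> coset 1 = UNIV" by auto
  ultimately show ?thesis
    unfolding F_theta_def by (simp add: infsumI)
qed

lemma theta_0_inversion:
  assumes "Im \<tau> > 0"
  shows "theta 0 (- 1 / \<tau>) = csqrt (- \<i> * \<tau>) * (theta 0 (4 * \<tau>) + theta (1/2) (4 * \<tau>))"
  and "theta (1/2) (- 1 / \<tau>) = csqrt (- \<i> * \<tau>) * (theta 0 (4 * \<tau>) - theta (1/2) (4 * \<tau>))"
proof -
  have residues: "{0..<2::int} = {0, 1}" by auto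
  have half: "nome (of_real (of_int k * (1/2))) = (if even k then 1 else - 1)" for k
    using nome_half_of_int[of k] by simp
  show "theta 0 (- 1 / \<tau>) = csqrt (- \<i> * \<tau>) * (theta 0 (4 * \<tau>) + theta (1/2) (4 * \<tau>))"
    unfolding theta_inversion[OF assms] using assms
    by (subst twisted_theta_periodic[of _ 2]) (auto simp: residues)
  show "theta (1/2) (- 1 / \<tau>) = csqrt (- \<i> * \<tau>) * (theta 0 (4 * \<tau>) - theta (1/2) (4 * \<tau>))"
    unfolding theta_inversion[OF assms] half using assms
    by (subst twisted_theta_periodic[of _ 2]) (auto simp: residues cong_def even_iff_mod_2_eq_zero)
qed

lemma F_theta_fricke:
  assumes Im_pos: "Im \<tau> > 0"
  shows "F_theta (- 1 / (3 * \<tau>)) = - \<i> * of_real (sqrt 3) * \<tau> * F_theta \<tau>"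
proof -
  define \<sigma> where "\<sigma> = \<tau> / 2"
  define x where "x = csqrt (- \<i> * \<sigma>)"
  have Im_\<sigma>_pos: "Im \<sigma> > 0" "Im (3 * \<sigma>) > 0" using Im_pos by (simp_all add: \<sigma>_def)
  have csqrt_3: "csqrt (- \<i> * (3 * \<sigma>)) = of_real (sqrt 3) * x"
    using csqrt_of_real_mult[of 3 "- \<i> * \<sigma>"] by (simp add: x_def mult_ac)
  have x_square: "x * x = - \<i> * \<tau> / 2"
    unfolding x_def power2_eq_square[symmetric] power2_csqrt by (simp add: \<sigma>_def)
  have args: "2 * (- 1 / (3 * \<tau>)) = - 1 / (3 * \<sigma>)" "6 * (- 1 / (3 * \<tau>)) = - 1 / \<sigma>"
      "4 * (3 * \<sigma>) = 6 * \<tau>" "4 * \<sigma> = 2 * \<tau>"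
    by (simp_all add: \<sigma>_def)
  have "Im (- 1 / (3 * \<tau>)) > 0"
    using Im_neg_inverse[of "3 * \<tau>"] Im_pos by simp
  from F_theta_eq_theta[OF this]
  have "F_theta (- 1 / (3 * \<tau>)) = of_real (sqrt 3) * (2 * (x * x)) *
      (theta 0 (2 * \<tau>) * theta 0 (6 * \<tau>) + theta (1/2) (2 * \<tau>) * theta (1/2) (6 * \<tau>))"
    unfolding args csqrt_3 x_def[symmetric]
        theta_0_inversion[OF Im_\<sigma>_pos(1)] theta_0_inversion[OF Im_\<sigma>_pos(2)]
    by (simp add: algebra_simps)
  then show ?thesis
    unfolding F_theta_eq_theta[OF Im_pos] x_square by simp
qed

lemma F_theta_translate: "F_theta (\<tau> + of_int n) = F_theta \<tau>"
  by (simp add: F_theta_def)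

lemma F_theta_slash_lower:
  assumes Im_pos: "Im \<tau> > 0"
  shows "slash 1 1 0 (3 * j) 1 F_theta \<tau> = F_theta \<tau>"
proof -
  have \<tau>_nonzero: "\<tau> \<noteq> 0" using Im_pos by auto
  define x where "x = of_int (3 * j) * \<tau> + 1"
  have x_nonzero: "x \<noteq> 0"
    using moebius_denominator_nonzero[of 1 1 0 "3 * j" \<tau>] Im_pos by (simp add: x_def)
  define \<sigma> where "\<sigma> = - 1 / (3 * \<tau>)"
  have Im_\<sigma>_pos: "Im \<sigma> > 0" unfolding \<sigma>_def using Im_neg_inverse[of "3 * \<tau>"] Im_pos by simp
  have shift: "3 * (\<sigma> + of_int (- j)) = - (x / \<tau>)"
    unfolding \<sigma>_def x_def using \<tau>_nonzero by (simp add: field_simps)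
  then have "F_theta (\<tau> / x) = F_theta (- 1 / (3 * (\<sigma> + of_int (- j))))"
    using \<tau>_nonzero x_nonzero by simp
  also have "\<dots> = - \<i> * of_real (sqrt 3) * (\<sigma> + of_int (- j)) * F_theta (\<sigma> + of_int (- j))"
    using Im_\<sigma>_pos by (intro F_theta_fricke) simp
  also have "F_theta (\<sigma> + of_int (- j)) = - \<i> * of_real (sqrt 3) * \<tau> * F_theta \<tau>"
    unfolding F_theta_translate \<sigma>_def by (rule F_theta_fricke[OF Im_pos])
  also have "- \<i> * of_real (sqrt 3) * (\<sigma> + of_int (- j)) *
      (- \<i> * of_real (sqrt 3) * \<tau> * F_theta \<tau>) =
      - ((of_real (sqrt 3) * of_real (sqrt 3)) * ((\<sigma> + of_int (- j)) * \<tau>)) * F_theta \<tau>"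
    by (simp add: mult_ac)
  also have "complex_of_real (sqrt 3) * of_real (sqrt 3) = 3"
    unfolding of_real_mult[symmetric] by simp
  also have "- (3 * ((\<sigma> + of_int (- j)) * \<tau>)) = x"
    using \<tau>_nonzero by (simp only: mult.assoc[symmetric] shift) simp
  finally show ?thesis
    using x_nonzero by (simp add: slash_def power_int_minus x_def)
qed

theorem F_theta_slash:
  assumes det: "a * d - b * c = 1" and dvd: "3 dvd c" and Im_pos: "Im \<tau> > 0"
  shows "slash 1 a b c d F_theta \<tau> = of_int (Legendre d 3) * F_theta \<tau>"
  using one_le_numeral order_refl det dvd Im_pos
proof (induction arbitrary: \<tau> rule: Gamma0_induct)
  case identity
  show ?case by (simp add: slash_identity Legendre_1_left)
next
  case (uminus a b c d)
  then show ?case by (simp add: slash_uminus Legendre_minus_3)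
next
  case (translate a b c d j)
  have "slash 1 a (b + j * a) c (d + j * c) F_theta \<tau> = slash 1 1 j 0 1 (slash 1 a b c d F_theta) \<tau>"
    by (subst slash_slash) (simp_all add: add_ac mult_ac)
  also have "\<dots> = of_int (Legendre d 3) * F_theta \<tau>"
    using translate by (simp add: slash_translation F_theta_translate)
  also have "Legendre d 3 = Legendre (d + j * c) 3"
    using translate(2) by (intro Legendre_cong) (simp add: cong_iff_dvd_diff)
  finally show ?case .
next
  case (lower a b c d j)
  then have "of_int (3 * j) * \<tau> + of_int 1 \<noteq> 0"
    using moebius_denominator_nonzero[of 1 1 0 "3 * j" \<tau>] by simp
  then have "slash 1 (a + j * 3 * b) b (c + j * 3 * d) d F_theta \<tau> =
      slash 1 1 0 (3 * j) 1 (slash 1 a b c d F_theta) \<tau>"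
    by (subst slash_slash) (simp_all add: mult_ac)
  also have "\<dots> = slash 1 1 0 (3 * j) 1 (\<lambda>\<tau>. of_int (Legendre d 3) * F_theta \<tau>) \<tau>"
    using lower by (intro slash_cong) auto
  also have "\<dots> = of_int (Legendre d 3) * F_theta \<tau>"
    using lower by (simp only: slash_cmult F_theta_slash_lower)
  finally show ?case .
qed

lemma F_theta_rescaled_slash:
  assumes det: "A * D - B * C = 1" and a_pos_dvd: "a > 0" "3 * int a dvd C" and Im_pos: "Im \<tau> > 0"
  shows "slash 1 A B C D (\<lambda>\<tau>. F_theta (of_nat a * \<tau>)) \<tau> =
      of_int (Legendre D 3) * F_theta (of_nat a * \<tau>)"
proof -
  obtain C' where "C = 3 * int a * C'" using a_pos_dvd(2) by (elim dvdE)
  then have C_eq: "C = int a * (3 * C')" by simp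
  have "A * D - (int a * B) * (3 * C') = 1" using det C_eq by (simp add: mult_ac)
  moreover have "Im (of_nat a * \<tau>) > 0" using a_pos_dvd Im_pos by simp
  ultimately show ?thesis
    using slash_rescale[of 1 A B "int a" "3 * C'" D F_theta \<tau>] F_theta_slash by (simp add: C_eq)
qed

lemma theta_poly_F_theta:
  assumes "a > 0"
  shows "theta_poly 2 (\<lambda>\<tau>. F_theta (of_nat a * \<tau>))"
proof (rule theta_poly.cong)
  show "theta_poly 2 (\<lambda>\<tau>. theta 0 (of_real (2 * of_nat a) * \<tau>) *
      theta 0 (of_real (6 * of_nat a) * \<tau>) +
      theta (1/2) (of_real (2 * of_nat a) * \<tau>) * theta (1/2) (of_real (6 * of_nat a) * \<tau>))"
    unfolding one_add_one[symmetric] using assms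
    by (intro theta_poly.add theta_poly_times theta_poly_theta) (auto simp: one_add_one)
  fix \<tau> assume "\<tau> \<in> upper_half_plane"
  then have "Im (of_nat a * \<tau>) > 0" using assms by (simp add: upper_half_plane_def)
  from F_theta_eq_theta[OF this]
  show "F_theta (of_nat a * \<tau>) =
      theta 0 (of_real (2 * of_nat a) * \<tau>) * theta 0 (of_real (6 * of_nat a) * \<tau>) +
      theta (1/2) (of_real (2 * of_nat a) * \<tau>) * theta (1/2) (of_real (6 * of_nat a) * \<tau>)"
    by (simp add: mult.assoc)
qed

lemma F_theta_imaginary_nonzero:
  assumes "y > 0"
  shows "F_theta (\<i> * of_real y) \<noteq> 0"
proof -
  have arg: "2 * (\<i> * of_real y) = \<i> * of_real (2 * y)" "6 * (\<i> * of_real y) = \<i> * of_real (6 * y)"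
    by simp_all
  have "Im (\<i> * of_real y) > 0" using assms by simp
  from F_theta_eq_theta[OF this] have "Re (F_theta (\<i> * of_real y)) > 0"
    unfolding arg using assms
    by (simp add: Im_theta_imaginary Re_theta_imaginary_pos add_pos_pos del: of_real_mult)
  then show ?thesis by (metis less_irrefl zero_complex.simps(1))
qed

section \<open>The theta series with characteristic one half\<close>

lemma sums_int_reflection:
  fixes f :: "int \<Rightarrow> complex"
  assumes summable: "f summable_on UNIV" and reflect: "\<And>n. f (- 1 - n) = f n"
  shows "(\<lambda>n. f (int n)) sums (infsum f UNIV / 2)"
proof -
  have "infsum f (range int \<union> range (\<lambda>n. - 1 - int n)) =
      infsum f (range int) + infsum f (range (\<lambda>n. - 1 - int n))"
    by (intro infsum_Un_disjoint summable_on_subset_banach[OF summable]) auto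
  moreover have "infsum f (range int) = (\<Sum>\<^sub>\<infinity>n. f (int n))"
    by (subst infsum_reindex) (auto simp: o_def)
  moreover have "infsum f (range (\<lambda>n. - 1 - int n)) = (\<Sum>\<^sub>\<infinity>n. f (int n))"
    by (subst infsum_reindex) (auto simp: o_def inj_on_def reflect)
  moreover have "range int \<union> range (\<lambda>n. - 1 - int n) = UNIV"
  proof (rule UNIV_eq_I[symmetric])
    fix x show "x \<in> range int \<union> range (\<lambda>n. - 1 - int n)"
      by (cases "x \<ge> 0") (auto intro: image_eqI[of _ _ "nat x"] image_eqI[of _ _ "nat (- 1 - x)"])
  qed
  ultimately have "(\<Sum>\<^sub>\<infinity>n. f (int n)) = infsum f UNIV / 2" by simp
  moreover have "f summable_on range int"
    using summable by (rule summable_on_subset_banach) simp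
  then have "(\<lambda>n. f (int n)) summable_on UNIV"
    by (simp add: summable_on_reindex o_def)
  ultimately show ?thesis
    by (metis has_sum_imp_sums has_sum_infsum)
qed

lemma Psi_theta_eq_theta:
  assumes "Im \<tau> > 0"
  shows "nome (\<tau> / 8) * Psi_theta \<tau> = theta (1/2) \<tau> / 2"
proof -
  let ?f = "\<lambda>n::int. 1 * nome ((of_int n + of_real (1/2))\<^sup>2 / 2 * \<tau>)"
  have "?f (int n) = nome (\<tau> / 8) * nome \<tau> ^ (n * (n + 1) div 2)" for n
  proof -
    define k where "k = n * (n + 1) div 2"
    have "2 * k = n * (n + 1)" by (simp add: k_def)
    then have "2 * complex_of_nat k = of_nat n * (of_nat n + 1)"
      by (metis of_nat_1 of_nat_add of_nat_mult of_nat_numeral)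
    then have "(of_int (int n) + of_real (1/2))\<^sup>2 / 2 * \<tau> = \<tau> / 8 + (2 * of_nat k) * \<tau> / 2"
      by (simp only:) (simp add: power2_eq_square field_simps)
    also have "\<dots> = \<tau> / 8 + of_nat k * \<tau>" by simp
    finally show ?thesis
      by (simp only: k_def[symmetric] nome_add nome_of_nat_mult mult_1_left)
  qed
  moreover have "?f summable_on UNIV"
    using assms by (intro twisted_theta_summable) auto
  then have "(\<lambda>n. ?f (int n)) sums (theta (1/2) \<tau> / 2)"
    unfolding twisted_theta_def
    by (rule sums_int_reflection) (simp add: power2_eq_square algebra_simps)
  ultimately have "(\<lambda>n. nome (\<tau> / 8) * nome \<tau> ^ (n * (n + 1) div 2)) sums (theta (1/2) \<tau> / 2)"
    by simp
  from sums_mult[OF this, of "inverse (nome (\<tau> / 8))"]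
  have "Psi_theta \<tau> = inverse (nome (\<tau> / 8)) * (theta (1/2) \<tau> / 2)"
    unfolding Psi_theta_def mult.assoc[symmetric] by (simp add: sums_iff)
  then show ?thesis by (simp add: field_simps)
qed

definition odd_square_phase :: "int \<Rightarrow> int \<Rightarrow> int \<Rightarrow> complex" where
  "odd_square_phase B D s = nome (of_int (B * (2 * s + 1)\<^sup>2) / of_int (8 * D))"

lemma odd_square_phase_cong:
  assumes "odd D" "[x = y] (mod D)"
  shows "odd_square_phase B D x = odd_square_phase B D y"
  unfolding odd_square_phase_def
proof (rule nome_cong)
  obtain k where x_eq: "x = y + D * k"
    using assms(2) by (metis cong_iff_lin cong_sym)
  have "even (k * (2 * y + 1 + D * k))" using assms(1) by simp
  then obtain t where t_eq: "k * (2 * y + 1 + D * k) = 2 * t" by blast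
  have "B * (2 * x + 1)\<^sup>2 - B * (2 * y + 1)\<^sup>2 = B * 4 * D * (k * (2 * y + 1 + D * k))"
    unfolding x_eq by (simp add: power2_eq_square algebra_simps)
  also have "\<dots> = 8 * D * (B * t)"
    unfolding t_eq by simp
  finally show "[B * (2 * x + 1)\<^sup>2 = B * (2 * y + 1)\<^sup>2] (mod 8 * D)"
    by (simp only: cong_iff_dvd_diff dvd_triv_left)
qed

text \<open>The substitution \<open>s = 2t + (D - 1)/2\<close>, that is \<open>2s + 1 = 4t + D\<close>, gives a Gauss sum.\<close>

lemma sum_odd_square_phase:
  assumes D_odd_pos: "odd D" "D > 0"
  shows "(\<Sum>s\<in>{0..<D}. odd_square_phase B D s) = nome (of_int (B * D) / 8) * gauss_sum (2 * B) D"
proof -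
  obtain e where D_eq: "D = 2 * e + 1" using D_odd_pos(1) by (elim oddE)
  have "odd_square_phase B D (2 * t + e) =
      nome (of_int (B * D) / 8) * nome (of_int (2 * B * t\<^sup>2) / of_int D)" for t
  proof -
    have "2 * (2 * t + e) + 1 = 4 * t + D" by (simp add: D_eq)
    then have "of_int (B * (2 * (2 * t + e) + 1)\<^sup>2) / of_int (8 * D) =
        of_int (B * (4 * t + D)\<^sup>2) / complex_of_int (8 * D)"
      by (simp only:)
    also have "\<dots> = of_int (B * D) / 8 + of_int (2 * B * t\<^sup>2) / of_int D + of_int (B * t)"
      using D_odd_pos(2) by (simp add: power2_eq_square field_simps)
    finally show ?thesis
      by (simp only: odd_square_phase_def nome_add nome_of_int mult_1_right)
  qed
  moreover have "(\<Sum>s\<in>{0..<D}. odd_square_phase B D s) =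
      (\<Sum>t\<in>{0..<D}. odd_square_phase B D (2 * t + e))"
    using D_odd_pos by (intro sum_residues_affine[symmetric] odd_square_phase_cong) auto
  ultimately show ?thesis
    by (simp only: gauss_sum_def sum_distrib_left)
qed

lemma theta_half_add_rational:
  assumes D_odd_pos: "odd D" "D > 0" and Im_pos: "Im \<sigma> > 0"
  shows "theta (1/2) (\<sigma> + of_int B / of_int D) =
    (\<Sum>s\<in>{0..<D}. odd_square_phase B D s * theta ((of_int s + 1/2) / of_int D) ((of_int D)\<^sup>2 * \<sigma>))"
proof -
  have "1 * nome (of_real (of_int B / of_int D * (of_int n + 1/2)\<^sup>2 / 2)) = odd_square_phase B D n"
    for n :: int
    using D_odd_pos(2) by (simp add: odd_square_phase_def power2_eq_square field_simps)
  then have "theta (1/2) (\<sigma> + of_real (of_int B / of_int D)) =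
      twisted_theta (odd_square_phase B D) (1/2) \<sigma>"
    by (simp only: twisted_theta_add_of_real)
  also have "\<dots> = (\<Sum>s\<in>{0..<D}. odd_square_phase B D s *
      theta ((of_int s + 1/2) / of_int D) ((of_int D)\<^sup>2 * \<sigma>))"
    by (intro twisted_theta_periodic Im_pos D_odd_pos(2) odd_square_phase_cong[OF D_odd_pos(1)])
  finally show ?thesis by simp
qed

lemma odd_square_phase_complete_square:
  assumes det: "A * D - B * C = 1" and C_even: "even C" and D_pos: "D > 0"
  shows "odd_square_phase B D s *
      (nome (of_real (of_int l * ((of_int s + 1/2) / of_int D))) *
          nome (of_real (- of_int C / of_int D * (of_int l + 0)\<^sup>2 / 2))) =
    nome (of_int l / 2) * odd_square_phase B D (1 * s + (- C * l))"
proof -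
  obtain C' where C_eq: "C = 2 * C'" using C_even by blast
  have "odd (A * D)" using det C_even by (metis diff_add_cancel even_add even_mult_iff odd_one)
  then have "odd A" by simp
  define y where "y = 2 * s + 1"
  have "odd (A * y)" using \<open>odd A\<close> by (simp add: y_def)
  then obtain v where v_eq: "A * y = 2 * v + 1" by (elim oddE)
  have BC_eq: "B * C = A * D - 1" using det by simp
  have "B * (y - 2 * C * l)\<^sup>2 = B * y\<^sup>2 - 4 * (B * C) * l * y + 4 * (B * C) * C * l\<^sup>2"
    by (simp add: power2_eq_square algebra_simps)
  also have "\<dots> = B * y\<^sup>2 - 4 * D * l * (A * y) + 4 * l * y + 4 * (A * D - 1) * C * l\<^sup>2"
    unfolding BC_eq by (simp add: algebra_simps)
  also have "\<dots> = (B * y\<^sup>2 + 4 * l * y - 4 * C * l\<^sup>2 - 4 * D * l) + 8 * D * (A * C' * l\<^sup>2 - l * v)"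
    unfolding v_eq C_eq by (simp add: algebra_simps)
  finally have square: "B * y\<^sup>2 + 4 * l * y - 4 * C * l\<^sup>2 =
      4 * D * l + B * (y - 2 * C * l)\<^sup>2 + 8 * D * (l * v - A * C' * l\<^sup>2)"
    by (simp add: algebra_simps)
  have shifted_odd: "2 * (1 * s + (- C * l)) + 1 = y - 2 * C * l" by (simp add: y_def)
  have "of_int (B * y\<^sup>2) / of_int (8 * D) +
      (of_real (of_int l * ((of_int s + 1/2) / of_int D)) +
          of_real (- of_int C / of_int D * (of_int l + 0)\<^sup>2 / 2)) =
      of_int (B * y\<^sup>2 + 4 * l * y - 4 * C * l\<^sup>2) / complex_of_int (8 * D)"
    using D_pos by (simp add: y_def field_simps)
  also have "\<dots> = of_int l / 2 + of_int (B * (y - 2 * C * l)\<^sup>2) / of_int (8 * D) +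
      of_int (l * v - A * C' * l\<^sup>2)"
    unfolding square using D_pos by (simp add: field_simps)
  finally show ?thesis
    by (simp only: odd_square_phase_def shifted_odd y_def[symmetric] nome_add[symmetric])
       (simp only: nome_add_of_int)
qed

lemma sum_twisted_theta_odd_square_phase:
  assumes det: "A * D - B * C = 1" and "even C" "D > 0" "Im \<sigma> > 0"
  defines "\<rho> \<equiv> \<sigma> + of_real (- of_int C / of_int D)"
  shows "(\<Sum>s\<in>{0..<D}. odd_square_phase B D s *
      twisted_theta (\<lambda>l. nome (of_real (of_int l * ((of_int s + 1/2) / of_int D)))) 0 \<rho>) =
    nome (of_int (B * D) / 8) * gauss_sum (2 * B) D *
        twisted_theta (\<lambda>l. nome (of_real (of_int l * (1/2)))) 0 \<sigma>"
proof -
  have "odd D" using coprime_if_det_1[OF det, of 2] \<open>even C\<close> by simp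
  define coeff where "coeff = (\<lambda>s l. nome (of_real (of_int l * ((of_int s + 1/2) / of_int D))) *
      nome (of_real (- of_int C / of_int D * (of_int l + 0)\<^sup>2 / 2)))"
  define K where "K = (\<Sum>s\<in>{0..<D}. odd_square_phase B D s)"
  have sum_coeff: "(\<Sum>s\<in>{0..<D}. odd_square_phase B D s * coeff s l) =
      K * nome (of_real (of_int l * (1/2)))" for l
  proof -
    have "(\<Sum>s\<in>{0..<D}. odd_square_phase B D (1 * s + (- C * l))) = K"
      unfolding K_def using \<open>D > 0\<close>
      by (intro sum_residues_affine odd_square_phase_cong[OF \<open>odd D\<close>]) auto
    then show ?thesis
      unfolding coeff_def odd_square_phase_complete_square[OF assms(1-3)]
          sum_distrib_left[symmetric] by simp
  qed
  have "(\<Sum>s\<in>{0..<D}. odd_square_phase B D s *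
        twisted_theta (\<lambda>l. nome (of_real (of_int l * ((of_int s + 1/2) / of_int D)))) 0 \<rho>) =
      (\<Sum>s\<in>{0..<D}. twisted_theta (\<lambda>l. odd_square_phase B D s * coeff s l) 0 \<sigma>)"
    unfolding \<rho>_def twisted_theta_add_of_real coeff_def twisted_theta_cmult ..
  also have "\<dots> = twisted_theta (\<lambda>l. \<Sum>s\<in>{0..<D}. odd_square_phase B D s * coeff s l) 0 \<sigma>"
    by (intro twisted_theta_sum[symmetric] \<open>Im \<sigma> > 0\<close>)
       (auto intro!: boundedI[of _ 1] simp: coeff_def odd_square_phase_def norm_mult norm_nome)
  also have "\<dots> = K * twisted_theta (\<lambda>l. nome (of_real (of_int l * (1/2)))) 0 \<sigma>"
    unfolding sum_coeff by (rule twisted_theta_cmult)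
  finally show ?thesis
    unfolding K_def sum_odd_square_phase[OF \<open>odd D\<close> \<open>D > 0\<close>] .
qed

lemma moebius_eq_add_rational:
  assumes det: "A * D - B * C = 1" and "D \<noteq> 0" "Im \<tau> > 0"
  shows "moebius A B C D \<tau> = \<tau> / (of_int D * (of_int C * \<tau> + of_int D)) + of_int B / of_int D"
proof -
  define w where "w = of_int C * \<tau> + of_int D"
  have "w \<noteq> 0" unfolding w_def by (rule moebius_denominator_nonzero[OF det \<open>Im \<tau> > 0\<close>])
  have "of_int A * of_int D = of_int B * of_int C + (1 :: complex)"
    using det by (metis diff_add_cancel add.commute of_int_1 of_int_add of_int_mult)
  then have "(of_int A * \<tau> + of_int B) * of_int D = of_int B * w + \<tau>"
    unfolding w_def by (simp add: algebra_simps)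
  then show ?thesis
    unfolding moebius_def w_def[symmetric] using \<open>w \<noteq> 0\<close> \<open>D \<noteq> 0\<close> by (simp add: field_simps)
qed

text \<open>Here \<open>(A\<tau> + B) / (C\<tau> + D) = \<sigma> + B / D\<close>. Inversion moves \<open>D\<^sup>2\<sigma>\<close> to \<open>\<rho> = - 1 / \<tau> - C / D\<close>,
  and a second inversion moves \<open>- 1 / \<tau>\<close> back to \<open>\<tau>\<close>.\<close>

theorem theta_half_moebius:
  assumes det: "A * D - B * C = 1" and "even C" "D > 0" "Im \<tau> > 0"
  shows "theta (1/2) (moebius A B C D \<tau>) =
    nome (of_int (B * D) / 8) * gauss_sum (2 * B) D * csqrt ((of_int C * \<tau> + of_int D) / of_int D) *
        theta (1/2) \<tau>"
proof -
  have Re_neg_ii_mult: "Re (- \<i> * z) = Im z" for z by simp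
  have "\<tau> \<noteq> 0" using \<open>Im \<tau> > 0\<close> by auto
  have "odd D" using coprime_if_det_1[OF det, of 2] \<open>even C\<close> by simp
  define \<sigma> where "\<sigma> = \<tau> / (of_int D * (of_int C * \<tau> + of_int D))"
  define \<rho> where "\<rho> = - 1 / \<tau> + of_real (- of_int C / of_int D)"
  have moebius: "moebius A B C D \<tau> = \<sigma> + of_int B / of_int D"
    unfolding \<sigma>_def using \<open>D > 0\<close> \<open>Im \<tau> > 0\<close> by (intro moebius_eq_add_rational[OF det]) auto
  have "Im \<sigma> = Im (moebius A B C D \<tau>)"
    unfolding moebius using Im_complex_of_real[of "of_int B / of_int D"] by simp
  then have "Im \<sigma> > 0" using Im_moebius_pos[OF det \<open>Im \<tau> > 0\<close>] by simp
  have "Im \<rho> > 0"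
    unfolding \<rho>_def using Im_neg_inverse[OF \<open>Im \<tau> > 0\<close>]
    by (simp only: plus_complex.simps Im_complex_of_real add_0_right)
  have "\<rho> = - ((of_int C * \<tau> + of_int D) / (of_int D * \<tau>))"
    unfolding \<rho>_def using \<open>\<tau> \<noteq> 0\<close> \<open>D > 0\<close> by (simp add: field_simps)
  then have \<rho>: "(of_int D)\<^sup>2 * \<sigma> = - 1 / \<rho>"
    unfolding \<sigma>_def using \<open>D > 0\<close> by (simp add: power2_eq_square)
  have "theta (1/2) (moebius A B C D \<tau>) = csqrt (- \<i> * \<rho>) * (\<Sum>s\<in>{0..<D}. odd_square_phase B D s *
      twisted_theta (\<lambda>l. nome (of_real (of_int l * ((of_int s + 1/2) / of_int D)))) 0 \<rho>)"
    unfolding moebius theta_half_add_rational[OF \<open>odd D\<close> \<open>D > 0\<close> \<open>Im \<sigma> > 0\<close>] \<rho>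
      theta_inversion[OF \<open>Im \<rho> > 0\<close>] sum_distrib_left by (simp only: mult_ac)
  also have "\<dots> = csqrt (- \<i> * \<rho>) * (nome (of_int (B * D) / 8) * gauss_sum (2 * B) D *
      twisted_theta (\<lambda>l. nome (of_real (of_int l * (1/2)))) 0 (- 1 / \<tau>))"
    using sum_twisted_theta_odd_square_phase[OF assms(1-3) Im_neg_inverse[OF \<open>Im \<tau> > 0\<close>]]
    by (simp only: \<rho>_def)
  also have "\<dots> = nome (of_int (B * D) / 8) * gauss_sum (2 * B) D *
      (csqrt (- \<i> * \<rho>) / csqrt (- \<i> * (- 1 / \<tau>))) * theta (1/2) \<tau>"
    using theta_inversion[OF Im_neg_inverse[OF \<open>Im \<tau> > 0\<close>], of "1/2"] \<open>\<tau> \<noteq> 0\<close> by simp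
  also have "csqrt (- \<i> * \<rho>) / csqrt (- \<i> * (- 1 / \<tau>)) = csqrt ((- \<i> * \<rho>) / (- \<i> * (- 1 / \<tau>)))"
    using Re_neg_ii_mult[of \<rho>] Re_neg_ii_mult[of "- 1 / \<tau>"] \<open>Im \<rho> > 0\<close> Im_neg_inverse[OF \<open>Im \<tau> > 0\<close>]
    by (intro csqrt_divide[symmetric]) (simp_all only:)
  also have "(- \<i> * \<rho>) / (- \<i> * (- 1 / \<tau>)) = (of_int C * \<tau> + of_int D) / of_int D"
    unfolding \<rho>_def using \<open>\<tau> \<noteq> 0\<close> \<open>D > 0\<close> by (simp add: field_simps)
  finally show ?thesis .
qed

lemma theta_half_rescaled_moebius:
  assumes det: "A * D - B * C = 1" and c_pos_dvd: "c > 0" "2 * int c dvd C" and "D > 0" "Im \<tau> > 0"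
  shows "theta (1/2) (of_nat c * moebius A B C D \<tau>) =
    nome (of_nat c * of_int (B * D) / 8) * gauss_sum (2 * B * int c) D *
    csqrt ((of_int C * \<tau> + of_int D) / of_int D) * theta (1/2) (of_nat c * \<tau>)"
proof -
  obtain C' where "C = 2 * int c * C'" using c_pos_dvd(2) by (elim dvdE)
  then have C_eq: "C = int c * (2 * C')" by simp
  have "A * D - (int c * B) * (2 * C') = 1" using det C_eq by (simp add: mult_ac)
  moreover have "Im (of_nat c * \<tau>) > 0" using c_pos_dvd(1) \<open>Im \<tau> > 0\<close> by simp
  ultimately have "theta (1/2) (moebius A (int c * B) (2 * C') D (of_nat c * \<tau>)) =
      nome (of_int (int c * B * D) / 8) * gauss_sum (2 * (int c * B)) D *
      csqrt ((of_int (2 * C') * (of_nat c * \<tau>) + of_int D) / of_int D) * theta (1/2) (of_nat c * \<tau>)"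
    using \<open>D > 0\<close> by (intro theta_half_moebius) auto
  moreover have "of_nat c * moebius A B C D \<tau> = moebius A (int c * B) (2 * C') D (of_nat c * \<tau>)"
    by (simp add: moebius_def C_eq algebra_simps)
  moreover have "of_int (2 * C') * (of_nat c * \<tau>) = of_int C * \<tau>" "2 * (int c * B) = 2 * B * int c"
      "of_int (int c * B * D) = of_nat c * (of_int (B * D) :: complex)"
    by (simp_all add: C_eq)
  ultimately show ?thesis by (simp only:)
qed

lemma prod_nome_eighth:
  assumes "finite J" "8 dvd (\<Sum>j\<in>J. c j)"
  shows "(\<Prod>j\<in>J. nome (of_nat (c j) * z / 8)) = nome z ^ ((\<Sum>j\<in>J. c j) div 8)"
proof -
  obtain n where n_eq: "(\<Sum>j\<in>J. c j) = 8 * n" using assms(2) by (elim dvdE)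
  have "(\<Sum>j\<in>J. of_nat (c j) * z / 8) = of_nat (\<Sum>j\<in>J. c j) * z / 8"
    by (simp add: sum_distrib_right sum_divide_distrib)
  also have "\<dots> = of_nat n * z" unfolding n_eq by simp
  finally show ?thesis
    unfolding n_eq nome_sum[OF assms(1), symmetric] by (simp add: nome_of_nat_mult)
qed

theorem prod_theta_half_slash:
  assumes det: "A * D - B * C = 1" and J_card: "finite J" "card J = 2 * m" "J \<noteq> {}"
    and c_pos_dvd: "\<And>j. j \<in> J \<Longrightarrow> c j > 0" "\<And>j. j \<in> J \<Longrightarrow> 2 * int (c j) dvd C"
    and sum_dvd: "8 dvd (\<Sum>j\<in>J. c j)" and "D > 0" "Im \<tau> > 0"
  shows "slash (int m) A B C D (\<lambda>\<tau>. \<Prod>j\<in>J. theta (1/2) (of_nat (c j) * \<tau>)) \<tau> =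
    of_int (kronecker ((- 1) ^ m * 4 * (\<Prod>j\<in>J. int (c j))) D) *
        (\<Prod>j\<in>J. theta (1/2) (of_nat (c j) * \<tau>))"
proof -
  define w where "w = of_int C * \<tau> + of_int D"
  have "w \<noteq> 0" unfolding w_def by (rule moebius_denominator_nonzero[OF det \<open>Im \<tau> > 0\<close>])
  have "even C" using c_pos_dvd(2) J_card(3) by (auto dest: dvd_mult_left)
  then have "odd D" "coprime (2 * B) D"
    using coprime_if_det_1[OF det, of 2] coprime_if_det_1[OF det, of "2 * B"]
        mult_dvd_mono[of B B 2 C]
    by (auto simp: mult.commute coprime_commute)
  moreover have "coprime (int (c j)) D" if "j \<in> J" for j
    using coprime_if_det_1[OF det dvd_mult[OF dvd_mult_right[OF c_pos_dvd(2)[OF that]]]]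
    by (simp add: coprime_commute)
  ultimately have gauss_sums: "(\<Prod>j\<in>J. gauss_sum (2 * B * int (c j)) D) =
      of_int (kronecker ((- 1) ^ m * (\<Prod>j\<in>J. int (c j))) D) * of_int D ^ m"
    using \<open>D > 0\<close> J_card by (intro prod_gauss_sum_even_card) auto
  have "(\<Prod>j\<in>J. theta (1/2) (of_nat (c j) * moebius A B C D \<tau>)) =
      (\<Prod>j\<in>J. nome (of_nat (c j) * of_int (B * D) / 8)) * (\<Prod>j\<in>J. gauss_sum (2 * B * int (c j)) D) *
      ((csqrt (w / of_int D))\<^sup>2) ^ m * (\<Prod>j\<in>J. theta (1/2) (of_nat (c j) * \<tau>))"
    using theta_half_rescaled_moebius[OF det c_pos_dvd \<open>D > 0\<close> \<open>Im \<tau> > 0\<close>] J_card(2)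
    by (simp add: w_def[symmetric] prod.distrib power_mult del: power2_csqrt)
  also have "\<dots> = of_int (kronecker ((- 1) ^ m * (\<Prod>j\<in>J. int (c j))) D) * w ^ m *
      (\<Prod>j\<in>J. theta (1/2) (of_nat (c j) * \<tau>))"
    unfolding prod_nome_eighth[OF J_card(1) sum_dvd] gauss_sums power2_csqrt power_divide
        nome_of_int using \<open>D > 0\<close> by simp
  finally show ?thesis
    unfolding slash_eq_moebius w_def[symmetric] kronecker_mult_left[OF \<open>odd D\<close> \<open>D > 0\<close>]
      kronecker_4_left[OF \<open>odd D\<close> \<open>D > 0\<close>]
    using \<open>w \<noteq> 0\<close> by (simp add: power_int_minus)
qed

section \<open>Modular forms from theta polynomials\<close>

lemma obtain_upper_row:
  fixes c d :: int
  assumes "coprime d c"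
  obtains a b where "a * d - b * c = 1"
proof -
  obtain x y where "x * d + y * c = 1"
    using assms by (metis bezout_int coprime_iff_gcd_eq_1)
  then show thesis using that[of x "- y"] by simp
qed

locale slash_eigenfunction =
  fixes w :: int and L :: nat and chi :: "int \<Rightarrow> complex" and f :: "complex \<Rightarrow> complex"
    and \<tau>\<^sub>0 :: complex
  assumes slash_eq: "\<And>a b c d \<tau>. a * d - b * c = 1 \<Longrightarrow> int L dvd c \<Longrightarrow> Im \<tau> > 0 \<Longrightarrow>
      slash w a b c d f \<tau> = chi d * f \<tau>"
    and Im_pos: "Im \<tau>\<^sub>0 > 0" and nonzero: "f \<tau>\<^sub>0 \<noteq> 0"
begin

lemma chi_1: "chi 1 = 1"
  using slash_eq[of 1 1 0 0 \<tau>\<^sub>0] Im_pos nonzero by (simp add: slash_identity)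

lemma translate: "Im \<tau> > 0 \<Longrightarrow> f (\<tau> + of_int t) = f \<tau>"
  using slash_eq[of 1 1 t 0 \<tau>] by (simp add: slash_translation chi_1)

lemma chi_cong:
  assumes "coprime m (int L)" "[m = n] (mod int L)"
  shows "chi m = chi n"
proof -
  obtain t where n_eq: "n = m + int L * t"
    using assms(2) by (metis cong_iff_lin)
  obtain a b where det: "a * m - b * int L = 1"
    using obtain_upper_row[OF assms(1)] .
  have "a * n - (b + a * t) * int L = 1"
    using det by (simp add: n_eq algebra_simps)
  then have "chi n * f \<tau>\<^sub>0 = slash w a (b + a * t) (int L) n f \<tau>\<^sub>0"
    using slash_eq Im_pos by simp
  also have "\<dots> = slash w 1 t 0 1 (slash w a b (int L) m f) \<tau>\<^sub>0"
    by (subst slash_slash) (simp_all add: n_eq algebra_simps)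
  also have "\<dots> = chi m * f \<tau>\<^sub>0"
    unfolding slash_translation using slash_eq[OF det dvd_refl, of "\<tau>\<^sub>0 + of_int t"] Im_pos
    by (simp add: translate)
  finally show ?thesis using nonzero by simp
qed

lemma chi_mult:
  assumes "coprime m (int L)" "coprime n (int L)"
  shows "chi (m * n) = chi m * chi n"
proof -
  obtain a b where det_m: "a * m - b * int L = 1"
    using obtain_upper_row[OF assms(1)] .
  obtain a' b' where det_n: "a' * n - b' * int L = 1"
    using obtain_upper_row[OF assms(2)] .
  define d where "d = int L * b' + m * n"
  have det: "(a * a' + b * int L) * d - (a * b' + b * n) * (int L * a' + m * int L) = 1"
    using arg_cong2[OF det_m det_n, of "(*)"] by (simp add: d_def algebra_simps)
  have "chi d * f \<tau>\<^sub>0 =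
      slash w (a * a' + b * int L) (a * b' + b * n) (int L * a' + m * int L) d f \<tau>\<^sub>0"
    using slash_eq[OF det] Im_pos by simp
  also have "\<dots> = slash w a' b' (int L) n (slash w a b (int L) m f) \<tau>\<^sub>0"
    using moebius_denominator_nonzero[OF det_n Im_pos] by (subst slash_slash) (simp_all add: d_def)
  also have "\<dots> = slash w a' b' (int L) n (\<lambda>\<tau>. chi m * f \<tau>) \<tau>\<^sub>0"
    using slash_eq[OF det_m dvd_refl] by (intro slash_cong[OF det_n Im_pos]) auto
  also have "\<dots> = chi m * chi n * f \<tau>\<^sub>0"
    using slash_eq[OF det_n dvd_refl Im_pos] by (simp add: slash_cmult)
  finally have "chi d = chi m * chi n" using nonzero by simp
  moreover have "chi (m * n) = chi d"
    using assms by (intro chi_cong) (auto simp: d_def cong_def)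
  ultimately show ?thesis by simp
qed

theorem character_mod: "character_mod L chi"
  unfolding character_mod_def using chi_1 chi_cong chi_mult by blast

end

theorem theta_poly_in_modular_forms:
  assumes poly: "theta_poly (2 * w) f" and nonzero: "Im \<tau>\<^sub>0 > 0" "f \<tau>\<^sub>0 \<noteq> 0" and "L \<noteq> 1"
    and slash_pos: "\<And>a b c d \<tau>. a * d - b * c = 1 \<Longrightarrow> int L dvd c \<Longrightarrow> d > 0 \<Longrightarrow> Im \<tau> > 0 \<Longrightarrow>
      slash (int w) a b c d f \<tau> = chi d * f \<tau>"
    and parity: "\<And>d. d > 0 \<Longrightarrow> coprime d (int L) \<Longrightarrow> chi (- d) = (- 1) ^ w * chi d"
  shows "f \<in> modular_forms (int w) L chi"
proof -
  have slash: "slash (int w) a b c d f \<tau> = chi d * f \<tau>"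
    if det: "a * d - b * c = 1" and dvd: "int L dvd c" and Im_pos: "Im \<tau> > 0" for a b c d \<tau>
  proof -
    have coprime: "coprime d (int L)" by (rule coprime_if_det_1[OF det dvd_mult[OF dvd]])
    with \<open>L \<noteq> 1\<close> have "d \<noteq> 0" by auto
    then consider (positive) "d > 0" | (negative) "- d > 0" by linarith
    then show ?thesis
    proof cases
      case negative
      have "slash (int w) (- a) (- b) (- c) (- d) f \<tau> = chi (- d) * f \<tau>"
        using det dvd Im_pos negative by (intro slash_pos) auto
      then have "(- 1) ^ w * slash (int w) a b c d f \<tau> = chi (- d) * f \<tau>"
        by (simp add: slash_uminus)
      moreover have "chi d = (- 1) ^ w * chi (- d)"
        using parity[OF negative] coprime by simp
      moreover have "(- 1) ^ w * ((- 1) ^ w * z) = z" for z :: complex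
        by (simp add: mult.assoc[symmetric] power_mult_distrib[symmetric])
      ultimately show ?thesis
        by (metis mult.assoc)
    qed (rule slash_pos[OF det dvd _ Im_pos])
  qed
  interpret slash_eigenfunction "int w" L chi f \<tau>\<^sub>0
    by unfold_locales (fact slash nonzero)+
  show ?thesis
    unfolding modular_forms_def
  proof (intro CollectI conjI allI impI ballI character_mod)
    show "f holomorphic_on upper_half_plane"
      by (intro holomorphic_at_infinity_imp_holomorphic theta_poly_holomorphic_at_infinity[OF poly])
    show "holomorphic_at_infinity (slash (int w) a b c d f)" if "a * d - b * c = 1" for a b c d
      by (intro theta_poly_holomorphic_at_infinity[OF theta_poly_slash] poly that)
  qed (auto simp: upper_half_plane_def slash)
qed

lemma modular_forms_scaled:
  assumes f_modular: "f \<in> modular_forms w L chi" and g_eq: "\<And>\<tau>. Im \<tau> > 0 \<Longrightarrow> g \<tau> = k * f \<tau>"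
  shows "g \<in> modular_forms w L chi"
proof -
  have slash: "slash w a b c d g \<tau> = k * slash w a b c d f \<tau>"
    if "a * d - b * c = 1" "Im \<tau> > 0" for a b c d \<tau>
    using slash_cong[OF that g_eq] by (simp only: slash_cmult)
  show ?thesis
    unfolding modular_forms_def
  proof (intro CollectI conjI allI impI ballI)
    show "character_mod L chi" using f_modular by (simp add: modular_forms_def)
    have "(\<lambda>\<tau>. k * f \<tau>) holomorphic_on upper_half_plane"
      using f_modular by (auto simp: modular_forms_def intro: holomorphic_intros)
    then show "g holomorphic_on upper_half_plane"
      by (rule holomorphic_transform) (simp add: g_eq upper_half_plane_def)
    fix a b c d :: int assume det: "a * d - b * c = 1"
    have "holomorphic_at_infinity (\<lambda>\<tau>. k * slash w a b c d f \<tau>)"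
      using f_modular det by (intro holomorphic_at_infinity_mult holomorphic_at_infinity_const)
          (auto simp: modular_forms_def)
    then show "holomorphic_at_infinity (slash w a b c d g)"
      by (rule holomorphic_at_infinity_cong) (simp add: slash[OF det] upper_half_plane_def)
    fix \<tau> assume "int L dvd c" "\<tau> \<in> upper_half_plane"
    then show "slash w a b c d g \<tau> = chi d * g \<tau>"
      using f_modular det by (simp add: modular_forms_def slash g_eq upper_half_plane_def)
  qed
qed

lemma modular_forms_character_cong:
  assumes f_modular: "f \<in> modular_forms w L chi"
    and chi_eq: "\<And>d. coprime d (int L) \<Longrightarrow> chi' d = chi d"
  shows "f \<in> modular_forms w L chi'"
proof -
  have "character_mod L chi"
    using f_modular by (simp add: modular_forms_def)
  moreover have "coprime n (int L)" if "coprime m (int L)" "[m = n] (mod int L)" for m n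
    using that by (metis cong_imp_coprime)
  ultimately have "character_mod L chi'"
    unfolding character_mod_def by (simp add: chi_eq)
  then show ?thesis
    using f_modular chi_eq coprime_if_det_1[OF _ dvd_mult] unfolding modular_forms_def
    by (simp; blast)
qed

section \<open>Products of theta functions\<close>

definition theta_product :: "'i set \<Rightarrow> ('i \<Rightarrow> nat) \<Rightarrow> 'j set \<Rightarrow> ('j \<Rightarrow> nat) \<Rightarrow> complex \<Rightarrow> complex" where
  "theta_product I a J c \<tau> =
      (\<Prod>i\<in>I. F_theta (of_nat (a i) * \<tau>)) * (\<Prod>j\<in>J. theta (1/2) (of_nat (c j) * \<tau>))"

lemma theta_poly_theta_product:
  assumes "finite I" "finite J" "\<And>i. i \<in> I \<Longrightarrow> a i > 0" "\<And>j. j \<in> J \<Longrightarrow> c j > 0"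
  shows "theta_poly (2 * card I + card J) (theta_product I a J c)"
proof -
  have "theta_poly 1 (\<lambda>\<tau>. theta (1/2) (of_nat (c j) * \<tau>))" if "j \<in> J" for j
    using theta_poly_theta[of "1/2" "of_nat (c j)"] assms(4)[OF that] by simp
  then have "theta_poly (card I * 2 + card J * 1) (theta_product I a J c)"
    unfolding theta_product_def[abs_def] using assms
    by (intro theta_poly_times theta_poly_prod theta_poly_F_theta)
  then show ?thesis by (simp add: mult.commute)
qed

lemma theta_product_ii_nonzero:
  assumes "finite I" "finite J" "\<And>i. i \<in> I \<Longrightarrow> a i > 0" "\<And>j. j \<in> J \<Longrightarrow> c j > 0"
  shows "theta_product I a J c \<i> \<noteq> 0"
proof -
  have imaginary_arg: "of_nat n * \<i> = \<i> * of_real (of_nat n)" for n by simp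
  have "theta (1/2) (\<i> * of_real (of_nat (c j))) \<noteq> 0" if "j \<in> J" for j
    using Re_theta_imaginary_pos[of "of_nat (c j)" "1/2"] assms(4)[OF that] by auto
  moreover have "F_theta (\<i> * of_real (of_nat (a i))) \<noteq> 0" if "i \<in> I" for i
    using assms(3)[OF that] by (intro F_theta_imaginary_nonzero) simp
  ultimately show ?thesis
    unfolding theta_product_def imaginary_arg using assms(1,2) by simp
qed

lemma theta_product_slash:
  assumes det: "A * D - B * C = 1" and D_pos: "D > 0" and Im_pos: "Im \<tau> > 0"
    and finite_I: "finite I" and a_pos_dvd: "\<And>i. i \<in> I \<Longrightarrow> a i > 0" "\<And>i. i \<in> I \<Longrightarrow> 3 * int (a i) dvd C"
    and J_card: "finite J" "card J = 2 * m" "J \<noteq> {}"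
    and c_pos_dvd: "\<And>j. j \<in> J \<Longrightarrow> c j > 0" "\<And>j. j \<in> J \<Longrightarrow> 2 * int (c j) dvd C"
    and sum_dvd: "8 dvd (\<Sum>j\<in>J. c j)"
  shows "slash (int (card I + m)) A B C D (theta_product I a J c) \<tau> =
    of_int (Legendre D 3 ^ card I * kronecker ((- 1) ^ m * 4 * (\<Prod>j\<in>J. int (c j))) D) *
        theta_product I a J c \<tau>"
proof -
  have denominator: "of_int C * \<tau> + of_int D \<noteq> 0"
    by (rule moebius_denominator_nonzero[OF det Im_pos])
  have "slash (int (card I) * 1) A B C D (\<lambda>\<tau>. \<Prod>i\<in>I. F_theta (of_nat (a i) * \<tau>)) \<tau> =
      (\<Prod>i\<in>I. of_int (Legendre D 3) * F_theta (of_nat (a i) * \<tau>))"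
    unfolding slash_prod[OF denominator finite_I]
    using F_theta_rescaled_slash[OF det a_pos_dvd Im_pos] by simp
  then show ?thesis
    using slash_times[OF denominator, of "int (card I)" "int m"]
        prod_theta_half_slash[OF det J_card c_pos_dvd sum_dvd D_pos Im_pos]
    unfolding theta_product_def[abs_def] by (simp add: prod.distrib)
qed

theorem theta_product_in_modular_forms:
  assumes finite_I: "finite I" and a_pos_dvd: "\<And>i. i \<in> I \<Longrightarrow> a i > 0" "\<And>i. i \<in> I \<Longrightarrow> 3 * a i dvd L"
    and J_card: "finite J" "card J = 2 * m" "J \<noteq> {}"
    and c_pos_dvd: "\<And>j. j \<in> J \<Longrightarrow> c j > 0" "\<And>j. j \<in> J \<Longrightarrow> 2 * c j dvd L"
    and sum_dvd: "8 dvd (\<Sum>j\<in>J. c j)"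
  defines "chi \<equiv> \<lambda>d. Legendre d 3 ^ card I * kronecker ((- 1) ^ m * 4 * (\<Prod>j\<in>J. int (c j))) d"
  shows "theta_product I a J c \<in> modular_forms (int (card I + m)) L (\<lambda>d. of_int (chi d))"
proof (rule theta_poly_in_modular_forms)
  show "theta_poly (2 * (card I + m)) (theta_product I a J c)"
    using theta_poly_theta_product[OF finite_I J_card(1) a_pos_dvd(1) c_pos_dvd(1)]
    by (simp add: J_card(2))
  show "Im \<i> > 0" "theta_product I a J c \<i> \<noteq> 0"
    using theta_product_ii_nonzero[OF finite_I J_card(1) a_pos_dvd(1) c_pos_dvd(1)] by auto
  have "2 dvd L" using c_pos_dvd(2) J_card(3) by (auto dest: dvd_mult_left)
  then show "L \<noteq> 1" by auto
next
  fix A B C D \<tau> assume "A * D - B * C = 1" "int L dvd C" "D > 0" "Im \<tau> > 0"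
  moreover from this(2) have "3 * int (a i) dvd C" if "i \<in> I" for i
    using a_pos_dvd(2)[OF that] by (metis dvd_trans of_nat_dvd_iff of_nat_mult of_nat_numeral)
  moreover have "2 * int (c j) dvd C" if "j \<in> J" for j
    using c_pos_dvd(2)[OF that] \<open>int L dvd C\<close>
    by (metis dvd_trans of_nat_dvd_iff of_nat_mult of_nat_numeral)
  ultimately show "slash (int (card I + m)) A B C D (theta_product I a J c) \<tau> =
      of_int (chi D) * theta_product I a J c \<tau>"
    unfolding chi_def using finite_I a_pos_dvd J_card c_pos_dvd sum_dvd
    by (intro theta_product_slash)
next
  fix d :: int assume "d > 0"
  have "(\<Prod>j\<in>J. int (c j)) > 0" using c_pos_dvd(1) by (intro prod_pos) auto
  then have "(- 1) ^ m * 4 * (\<Prod>j\<in>J. int (c j)) < 0 \<longleftrightarrow> odd m"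
    by (cases "even m") (simp_all add: mult_less_0_iff)
  then have "chi (- d) = (- 1) ^ (card I + m) * chi d"
    unfolding chi_def kronecker_minus_right[OF \<open>d > 0\<close>]
    by (simp add: Legendre_minus_3 power_minus[of "Legendre d 3"] power_add)
  then show "complex_of_int (chi (- d)) = (- 1) ^ (card I + m) * of_int (chi d)" by simp
qed

lemma nome_mult_psi_eq_theta_product:
  assumes dvd: "8 dvd (\<Sum>j\<in>{1..k}. c j)" and c_pos: "\<And>j. j \<in> {1..k} \<Longrightarrow> c j > 0" and "Im \<tau> > 0"
  shows "nome \<tau> ^ ((\<Sum>j\<in>{1..k}. c j) div 8) * psi u k a c \<tau> =
      (1/2) ^ k * theta_product {1..u} a {1..k} c \<tau>"
proof -
  have "nome \<tau> ^ ((\<Sum>j\<in>{1..k}. c j) div 8) * (\<Prod>j\<in>{1..k}. Psi_theta (of_nat (c j) * \<tau>)) =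
      (\<Prod>j\<in>{1..k}. nome (of_nat (c j) * \<tau> / 8) * Psi_theta (of_nat (c j) * \<tau>))"
    by (simp only: prod.distrib prod_nome_eighth[OF finite_atLeastAtMost dvd])
  also have "\<dots> = (\<Prod>j\<in>{1..k}. (1/2) * theta (1/2) (of_nat (c j) * \<tau>))"
    using c_pos \<open>Im \<tau> > 0\<close> by (intro prod.cong refl) (simp add: Psi_theta_eq_theta)
  also have "\<dots> = (1/2) ^ k * (\<Prod>j\<in>{1..k}. theta (1/2) (of_nat (c j) * \<tau>))"
    by (simp only: prod.distrib prod_constant card_atLeastAtMost) simp
  finally show ?thesis
    unfolding psi_def theta_product_def by (simp add: mult_ac)
qed

theorem theorem1p2:
  fixes u k :: nat and a c :: "nat \<Rightarrow> nat"
  defines "h \<equiv> (\<Sum>j\<in>{1..k}. c j)"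
  defines "L \<equiv> lcm (3 * (LCM i\<in>{1..u}. a i)) (2 * (LCM j\<in>{1..k}. c j))"
  defines "chi \<equiv> kronecker ((- 1) ^ (k div 2) * 4 * (\<Prod>j\<in>{1..k}. int (c j)))"
  defines "chi' \<equiv> (if even u then chi else (\<lambda>d. Legendre d 3 * chi d))"
  assumes "k > 0" and "even k"
    and "\<And>i. i \<in> {1..u} \<Longrightarrow> a i \<in> {1, 2, 4, 8}"
    and "\<And>j. j \<in> {1..k} \<Longrightarrow> c j \<in> {1, 2, 3, 4, 6}"
    and "[h = 0] (mod 8)"
  shows "(\<lambda>\<tau>. nome \<tau> ^ (h div 8) * psi u k a c \<tau>)
           \<in> modular_forms (int (u + k div 2)) L (\<lambda>d. of_int (chi' d))"
proof -
  have a_pos_dvd: "a i > 0" "3 * a i dvd L" if "i \<in> {1..u}" for i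
    using assms(7)[OF that] that unfolding L_def by (auto intro!: dvd_lcmI1 mult_dvd_mono dvd_Lcm)
  have c_pos_dvd: "c j > 0" "2 * c j dvd L" if "j \<in> {1..k}" for j
    using assms(8)[OF that] that unfolding L_def by (auto intro!: dvd_lcmI2 mult_dvd_mono dvd_Lcm)
  have h_dvd: "8 dvd (\<Sum>j\<in>{1..k}. c j)"
    using assms(9) by (simp add: h_def cong_0_iff)
  have "theta_product {1..u} a {1..k} c \<in>
      modular_forms (int (u + k div 2)) L (\<lambda>d. of_int (Legendre d 3 ^ u * chi d))"
    using theta_product_in_modular_forms[where I = "{1..u}" and J = "{1..k}" and m = "k div 2", OF _
        a_pos_dvd _ _ _ c_pos_dvd h_dvd]
      \<open>k > 0\<close> \<open>even k\<close> by (simp add: chi_def)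
  moreover have "chi' d = Legendre d 3 ^ u * chi d" if "coprime d (int L)" for d
  proof -
    have "3 dvd int L" by (simp add: L_def lcm_int_int_eq[symmetric] dvd_lcmI1)
    then have "\<not> 3 dvd d" using coprime_common_divisor[OF that, of 3] by auto
    then show ?thesis by (simp add: Legendre_3_power chi'_def)
  qed
  ultimately have "theta_product {1..u} a {1..k} c \<in>
      modular_forms (int (u + k div 2)) L (\<lambda>d. of_int (chi' d))"
    by (elim modular_forms_character_cong) simp
  then show ?thesis
    unfolding h_def by (rule modular_forms_scaled)
        (rule nome_mult_psi_eq_theta_product[OF h_dvd c_pos_dvd(1)])
qed

end
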